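(* Let $(\Omega,\Sigma)$ be a measurable space whose $\sigma$-algebra is countably generated. Let $\mathscr{S}=(S_t)_{t\in(0,\infty)}$ be a bounded semigroup of positive kernel operators on $\mathscr{M}(\Omega)$ and denote the kernel associated with $S_t$ by $k_t$. Assume that $\mu$ is a positive, finite, $\mathscr{S}$-invariant measure, i.e. $S_t\mu=\mu$ for all $t>0$, and that for some time $t_0>0$ and every $x\in\Omega$ the measure $k_{t_0}(x,\cdot)$ is absolutely continuous with respect to $\mu$. Then, for every $\nu\in\mathscr{M}(\Omega)$, $S_t\nu$ converges in total variation norm as $t\to\infty$.
   Context: $\mathscr{M}(\Omega)$ is the space of finite signed measures on $(\Omega,\Sigma)$ with the total variation norm. A bounded kernel on $\Omega$ is a map $k:\Omega\times\Sigma\to\mathbb{R}$ such that $k(\cdot,A)$ is measurable for each $A\in\Sigma$, $k(x,\cdot)$ is a finite signed measure for each $x\in\Omega$, and $\sup_x|k|(x,\Omega)<\infty$, where $|k|(x,\cdot)$ is the total variation of $k(x,\cdot)$. An operator $S$ on $\mathscr{M}(\Omega)$ is a kernel operator with kernel $k$ if $(S\mu)(A)=\int_\Omega k(x,A)\,d\mu(x)$ for all $\mu\in\mathscr{M}(\Omega)$, $A\in\Sigma$; it is positive iff $k\ge 0$. A semigroup $(S_t)_{t\in(0,\infty)}$ satisfies $S_{t+s}=S_tS_s$ for $s,t>0$ (no regularity in $t$ is assumed) and is bounded if $\sup_{t>0}\|S_t\|<\infty$. $\Sigma$ is countably generated if it is the smallest $\sigma$-algebra containing some countable family of sets. *)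

theory Defs
  imports "HOL-Probability.Probability"
begin

text \<open>
  Throughout, a measurable space is represented by an \<^typ>\<open>'a measure\<close> \<open>M\<close> of which only
  \<open>space M\<close> and \<open>sets M\<close> are used.  Finite signed measures are real-valued set functions,
  set to \<open>0\<close> outside \<open>sets M\<close> so that two of them are equal as HOL functions iff they agree
  on \<open>sets M\<close>.
\<close>

definition signed_measures :: "'a measure \<Rightarrow> ('a set \<Rightarrow> real) set" where
  "signed_measures M = {\<nu>. \<nu> {} = 0 \<and>
     (\<forall>A. range A \<subseteq> sets M \<longrightarrow> disjoint_family A \<longrightarrow>
        (\<lambda>i::nat. \<nu> (A i)) sums \<nu> (\<Union>i. A i)) \<and>
     (\<forall>A. A \<notin> sets M \<longrightarrow> \<nu> A = 0)}"

definition nonneg_measure :: "'a measure \<Rightarrow> ('a set \<Rightarrow> real) \<Rightarrow> bool" where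
  "nonneg_measure M \<nu> \<longleftrightarrow> (\<forall>A\<in>sets M. 0 \<le> \<nu> A)"

text \<open>The value \<open>\<bar>\<nu>\<bar>(A)\<close>, as a supremum over the finite measurable partitions of \<open>A\<close>.\<close>

definition variation :: "'a measure \<Rightarrow> ('a set \<Rightarrow> real) \<Rightarrow> 'a set \<Rightarrow> ennreal" where
  "variation M \<nu> A =
     (SUP P \<in> {P. finite P \<and> disjoint P \<and> P \<subseteq> sets M \<and> \<Union>P = A}. \<Sum>B\<in>P. ennreal \<bar>\<nu> B\<bar>)"

definition tv_norm :: "'a measure \<Rightarrow> ('a set \<Rightarrow> real) \<Rightarrow> ennreal" where
  "tv_norm M \<nu> = variation M \<nu> (space M)"

definition abs_cont :: "'a measure \<Rightarrow> ('a set \<Rightarrow> real) \<Rightarrow> ('a set \<Rightarrow> real) \<Rightarrow> bool" where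
  "abs_cont M \<nu> \<mu> \<longleftrightarrow> (\<forall>A\<in>sets M. variation M \<mu> A = 0 \<longrightarrow> \<nu> A = 0)"

text \<open>
  The Jordan decomposition \<open>\<nu>\<^sup>+(A) = sup {\<nu> B | B \<subseteq> A measurable}\<close>, \<open>\<nu>\<^sup>- = (-\<nu>)\<^sup>+\<close>.
  The truncation of negative values by \<^const>\<open>ennreal\<close> is harmless as \<open>B = {}\<close> is allowed.
  Lemma \<open>emeasure_pos_part\<close> below shows that \<^const>\<open>measure_of\<close> does not degenerate here.
\<close>

definition pos_part :: "'a measure \<Rightarrow> ('a set \<Rightarrow> real) \<Rightarrow> 'a measure" where
  "pos_part M \<nu> =
     measure_of (space M) (sets M) (\<lambda>A. SUP B \<in> {B \<in> sets M. B \<subseteq> A}. ennreal (\<nu> B))"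

definition neg_part :: "'a measure \<Rightarrow> ('a set \<Rightarrow> real) \<Rightarrow> 'a measure" where
  "neg_part M \<nu> = pos_part M (\<lambda>A. - \<nu> A)"

definition signed_integral :: "'a measure \<Rightarrow> ('a set \<Rightarrow> real) \<Rightarrow> ('a \<Rightarrow> real) \<Rightarrow> real" where
  "signed_integral M \<nu> f = (\<integral>x. f x \<partial>pos_part M \<nu>) - (\<integral>x. f x \<partial>neg_part M \<nu>)"

definition countably_generated :: "'a measure \<Rightarrow> bool" where
  "countably_generated M \<longleftrightarrow>
     (\<exists>G. countable G \<and> G \<subseteq> Pow (space M) \<and> sets M = sigma_sets (space M) G)"

definition bounded_kernel :: "'a measure \<Rightarrow> ('a \<Rightarrow> 'a set \<Rightarrow> real) \<Rightarrow> bool" where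
  "bounded_kernel M k \<longleftrightarrow>
     (\<forall>A\<in>sets M. (\<lambda>x. k x A) \<in> borel_measurable M) \<and>
     (\<forall>x\<in>space M. k x \<in> signed_measures M) \<and>
     (SUP x\<in>space M. variation M (k x) (space M)) < \<infinity>"

text \<open>Linearity of \<open>S\<close> on \<^const>\<open>signed_measures\<close> is a consequence of the integral formula.\<close>

definition kernel_operator ::
  "'a measure \<Rightarrow> ('a \<Rightarrow> 'a set \<Rightarrow> real) \<Rightarrow> (('a set \<Rightarrow> real) \<Rightarrow> ('a set \<Rightarrow> real)) \<Rightarrow> bool" where
  "kernel_operator M k S \<longleftrightarrow>
     bounded_kernel M k \<and>
     S \<in> signed_measures M \<rightarrow> signed_measures M \<and>
     (\<forall>\<mu>\<in>signed_measures M. \<forall>A\<in>sets M. S \<mu> A = signed_integral M \<mu> (\<lambda>x. k x A))"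

text \<open>For kernel operators this amounts to \<open>k \<ge> 0\<close>; see \<open>kernel_operator_positive_iff\<close> below.\<close>

definition positive_operator ::
  "'a measure \<Rightarrow> (('a set \<Rightarrow> real) \<Rightarrow> ('a set \<Rightarrow> real)) \<Rightarrow> bool" where
  "positive_operator M S \<longleftrightarrow>
     (\<forall>\<mu>\<in>signed_measures M. nonneg_measure M \<mu> \<longrightarrow> nonneg_measure M (S \<mu>))"

definition operator_norm ::
  "'a measure \<Rightarrow> (('a set \<Rightarrow> real) \<Rightarrow> ('a set \<Rightarrow> real)) \<Rightarrow> ennreal" where
  "operator_norm M S = (SUP \<nu> \<in> {\<nu> \<in> signed_measures M. tv_norm M \<nu> \<le> 1}. tv_norm M (S \<nu>))"

text \<open>Semigroups are indexed by the reals; only the values at \<open>t > 0\<close> matter.\<close>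

definition bounded_semigroup ::
  "'a measure \<Rightarrow> (real \<Rightarrow> ('a set \<Rightarrow> real) \<Rightarrow> ('a set \<Rightarrow> real)) \<Rightarrow> bool" where
  "bounded_semigroup M S \<longleftrightarrow>
     (\<forall>s>0. \<forall>t>0. \<forall>\<nu>\<in>signed_measures M. S (t + s) \<nu> = S t (S s \<nu>)) \<and>
     (SUP t\<in>{0<..}. operator_norm M (S t)) < \<infinity>"

definition tv_convergent :: "'a measure \<Rightarrow> (real \<Rightarrow> 'a set \<Rightarrow> real) \<Rightarrow> bool" where
  "tv_convergent M \<phi> \<longleftrightarrow>
     (\<exists>\<rho>\<in>signed_measures M. ((\<lambda>t. tv_norm M (\<lambda>A. \<phi> t A - \<rho> A)) \<longlongrightarrow> 0) at_top)"


lemma sets_pos_part [simp]: "sets (pos_part M \<nu>) = sets M"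
  and space_pos_part [simp]: "space (pos_part M \<nu>) = space M"
  unfolding pos_part_def by (auto simp: sets.space_closed sets.sigma_sets_eq)

lemma signed_measures_sums:
  assumes "\<nu> \<in> signed_measures M" "range A \<subseteq> sets M" "disjoint_family A"
  shows "(\<lambda>i::nat. \<nu> (A i)) sums \<nu> (\<Union>i. A i)"
  using assms unfolding signed_measures_def by auto

lemma signed_measures_Un:
  assumes \<nu>: "\<nu> \<in> signed_measures M" and A: "A \<in> sets M" and B: "B \<in> sets M" and "A \<inter> B = {}"
  shows "\<nu> (A \<union> B) = \<nu> A + \<nu> B"
proof -
  have 0: "\<nu> {} = 0" using \<nu> by (auto simp: signed_measures_def)
  have "(\<lambda>i. \<nu> (binaryset A B i)) sums \<nu> (\<Union>i. binaryset A B i)"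
    by (rule signed_measures_sums[OF \<nu>])
       (use assms in \<open>auto simp: range_binaryset_eq disjoint_family_on_def binaryset_def\<close>)
  with binaryset_sums[of \<nu> A B, OF 0] show ?thesis
    by (metis UN_binaryset_eq sums_unique2)
qed

lemma signed_measures_uminus:
  assumes "\<nu> \<in> signed_measures M"
  shows "(\<lambda>A. - \<nu> A) \<in> signed_measures M"
  using assms unfolding signed_measures_def by (auto intro!: sums_minus)

lemma emeasure_pos_part:
  assumes \<nu>: "\<nu> \<in> signed_measures M" and A: "A \<in> sets M"
  shows "emeasure (pos_part M \<nu>) A = (SUP B \<in> {B \<in> sets M. B \<subseteq> A}. ennreal (\<nu> B))"
proof -
  define f where "f A = (SUP B \<in> {B \<in> sets M. B \<subseteq> A}. ennreal (\<nu> B))" for A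
  have 0: "\<nu> {} = 0" using \<nu> by (auto simp: signed_measures_def)
  have upper: "ennreal (\<nu> B) \<le> f A" if "B \<in> sets M" "B \<subseteq> A" for A B
    unfolding f_def by (rule SUP_upper) (use that in auto)
  have mono: "f A \<le> f B" if "A \<subseteq> B" for A B
    unfolding f_def by (rule SUP_subset_mono) (use that in auto)
  have f0: "f {} = 0"
    unfolding f_def by (intro antisym SUP_least) (auto simp: 0)
  have super: "f A1 + f A2 \<le> f (A1 \<union> A2)" if d: "A1 \<inter> A2 = {}" for A1 A2
  proof -
    have pt: "ennreal (\<nu> B1) + ennreal (\<nu> B2) \<le> f (A1 \<union> A2)"
      if "B1 \<in> sets M" "B1 \<subseteq> A1" "B2 \<in> sets M" "B2 \<subseteq> A2" for B1 B2
    proof -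
      have un: "\<nu> (B1 \<union> B2) = \<nu> B1 + \<nu> B2"
        by (rule signed_measures_Un[OF \<nu>]) (use that d in auto)
      have b: "ennreal (\<nu> B1) \<le> f (A1 \<union> A2)" "ennreal (\<nu> B2) \<le> f (A1 \<union> A2)"
        "ennreal (\<nu> (B1 \<union> B2)) \<le> f (A1 \<union> A2)"
        by (rule upper; use that in auto)+
      show ?thesis
      proof (cases "0 \<le> \<nu> B1 \<and> 0 \<le> \<nu> B2")
        case True
        then show ?thesis using b(3) un by (simp add: ennreal_plus)
      next
        case False
        then show ?thesis using b(1,2) by (auto simp: ennreal_neg not_le)
      qed
    qed
    have ne: "{B \<in> sets M. B \<subseteq> A} \<noteq> {}" for A by blast
    have "f A1 + ennreal (\<nu> B2) \<le> f (A1 \<union> A2)" if "B2 \<in> sets M" "B2 \<subseteq> A2" for B2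
      unfolding f_def[of A1] ennreal_SUP_add_left[OF ne, symmetric]
      by (rule SUP_least) (use pt that in auto)
    then have "(SUP B \<in> {B \<in> sets M. B \<subseteq> A2}. f A1 + ennreal (\<nu> B)) \<le> f (A1 \<union> A2)"
      by (intro SUP_least) auto
    then show ?thesis
      unfolding f_def[of A2] by (subst ennreal_SUP_add_right[OF ne])
  qed
  have "countably_additive (sets M) f"
    unfolding countably_additive_def
  proof (intro allI impI)
    fix A :: "nat \<Rightarrow> 'a set"
    assume A: "range A \<subseteq> sets M" and disj: "disjoint_family A"
    have fin: "(\<Sum>i<n. f (A i)) \<le> f (\<Union>i<n. A i)" for n
    proof (induction n)
      case 0
      then show ?case by (simp add: f0)
    next
      case (Suc n)
      have "A i \<inter> A n = {}" if "i < n" for i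
        using disjoint_family_onD[OF disj, of i n] that by simp
      then have "(\<Union>i<n. A i) \<inter> A n = {}" by blast
      then have "f (\<Union>i<n. A i) + f (A n) \<le> f ((\<Union>i<n. A i) \<union> A n)" by (rule super)
      also have "(\<Union>i<n. A i) \<union> A n = (\<Union>i<Suc n. A i)" by (simp add: lessThan_Suc Un_commute)
      finally have "f (\<Union>i<n. A i) + f (A n) \<le> f (\<Union>i<Suc n. A i)" .
      with add_right_mono[OF Suc, of "f (A n)"] show ?case
        unfolding sum.lessThan_Suc by (rule order_trans)
    qed
    have "(\<Sum>i<n. f (A i)) \<le> f (\<Union>i. A i)" for n
      by (rule order_trans[OF fin mono]) auto
    then have le: "(\<Sum>i. f (A i)) \<le> f (\<Union>i. A i)"
      by (intro suminf_le_const summableI) auto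
    have "ennreal (\<nu> B) \<le> (\<Sum>i. f (A i))" if B: "B \<in> sets M" "B \<subseteq> (\<Union>i. A i)" for B
    proof -
      have eq: "(\<Union>i. B \<inter> A i) = B" using B by auto
      have "(\<lambda>i. \<nu> (B \<inter> A i)) sums \<nu> (\<Union>i. B \<inter> A i)"
      proof (rule signed_measures_sums[OF \<nu>])
        show "range (\<lambda>i. B \<inter> A i) \<subseteq> sets M" using A B by auto
        show "disjoint_family (\<lambda>i. B \<inter> A i)"
          using disj by (rule disjoint_family_on_bisimulation) blast
      qed
      then have s: "(\<lambda>n. ennreal (\<Sum>i<n. \<nu> (B \<inter> A i))) \<longlonglongrightarrow> ennreal (\<nu> B)"
        unfolding eq sums_def by (rule tendsto_ennrealI)
      have "ennreal (\<Sum>i<n. \<nu> (B \<inter> A i)) \<le> (\<Sum>i. f (A i))" for n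
      proof -
        have "ennreal (\<Sum>i<n. \<nu> (B \<inter> A i)) \<le> ennreal (\<Sum>i<n. max 0 (\<nu> (B \<inter> A i)))"
          by (intro ennreal_leI sum_mono) auto
        also have "\<dots> = (\<Sum>i<n. ennreal (max 0 (\<nu> (B \<inter> A i))))"
          by (rule sum_ennreal[symmetric]) auto
        also have "\<dots> \<le> (\<Sum>i<n. f (A i))"
          by (intro sum_mono) (use A B in \<open>auto simp: max_def intro!: upper\<close>)
        also have "\<dots> \<le> (\<Sum>i. f (A i))"
          by (rule sum_le_suminf) (auto intro: summableI)
        finally show ?thesis .
      qed
      then show ?thesis by (intro LIMSEQ_le_const2[OF s]) auto
    qed
    then have "f (\<Union>i. A i) \<le> (\<Sum>i. f (A i))"
      unfolding f_def[of "\<Union>i. A i"] by (intro SUP_least) auto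
    with le show "(\<Sum>i. f (A i)) = f (\<Union>i. A i)" by (rule antisym)
  qed
  moreover have "positive (sets M) f" by (simp add: positive_def f0)
  moreover have "pos_part M \<nu> = measure_of (space M) (sets M) f"
    unfolding pos_part_def f_def ..
  ultimately show ?thesis
    using emeasure_measure_of_sigma[OF sets.sigma_algebra_axioms _ _ A, of f]
    by (simp add: f_def)
qed

lemma emeasure_neg_part_nonneg:
  assumes \<nu>: "\<nu> \<in> signed_measures M" and "nonneg_measure M \<nu>" and A: "A \<in> sets M"
  shows "emeasure (neg_part M \<nu>) A = 0"
  unfolding neg_part_def emeasure_pos_part[OF signed_measures_uminus[OF \<nu>] A]
  using assms(2) by (intro antisym SUP_least) (auto simp: nonneg_measure_def ennreal_neg)

lemma signed_integral_nonneg_measure: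
  assumes "\<nu> \<in> signed_measures M" "nonneg_measure M \<nu>"
  shows "signed_integral M \<nu> f = (\<integral>x. f x \<partial>pos_part M \<nu>)"
proof -
  have "emeasure (neg_part M \<nu>) (space (neg_part M \<nu>)) = 0"
    using emeasure_neg_part_nonneg[OF assms] by (simp add: neg_part_def)
  then have "AE x in neg_part M \<nu>. f x = 0"
    by (intro AE_I'[of "space (neg_part M \<nu>)"]) (auto simp: null_sets_def)
  then have "(\<integral>x. f x \<partial>neg_part M \<nu>) = 0"
    by (rule integral_eq_zero_AE)
  then show ?thesis by (simp add: signed_integral_def)
qed

lemma kernel_operator_positive_iff:
  assumes S: "kernel_operator M k S"
  shows "positive_operator M S \<longleftrightarrow> (\<forall>x\<in>space M. \<forall>A\<in>sets M. 0 \<le> k x A)"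
proof
  assume k: "\<forall>x\<in>space M. \<forall>A\<in>sets M. 0 \<le> k x A"
  show "positive_operator M S"
    unfolding positive_operator_def
  proof (intro ballI impI)
    fix \<mu> assume \<mu>: "\<mu> \<in> signed_measures M" "nonneg_measure M \<mu>"
    show "nonneg_measure M (S \<mu>)"
      unfolding nonneg_measure_def
    proof
      fix A assume A: "A \<in> sets M"
      have "S \<mu> A = (\<integral>x. k x A \<partial>pos_part M \<mu>)"
        using S A \<mu> signed_integral_nonneg_measure[OF \<mu>] by (simp add: kernel_operator_def)
      also have "\<dots> \<ge> 0"
        using k A by (intro integral_nonneg_AE AE_I2) auto
      finally show "0 \<le> S \<mu> A" .
    qed
  qed
next
  assume pos: "positive_operator M S"
  show "\<forall>x\<in>space M. \<forall>A\<in>sets M. 0 \<le> k x A"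
  proof (intro ballI)
    fix x A assume x: "x \<in> space M" and A: "A \<in> sets M"
    define \<delta> where "\<delta> = measure (return M x)"
    interpret prob_space "return M x" by (rule prob_space_return[OF x])
    have \<delta>_ind: "\<delta> B = indicator B x" if "B \<in> sets M" for B
      using that x by (simp add: \<delta>_def measure_return)
    have \<delta>: "\<delta> \<in> signed_measures M"
      unfolding signed_measures_def \<delta>_def
      by (auto intro!: finite_measure_UNION simp: measure_notin_sets)
    have nn: "nonneg_measure M \<delta>"
      by (simp add: nonneg_measure_def \<delta>_def)
    have "pos_part M \<delta> = return M x"
    proof (rule measure_eqI)
      fix B assume "B \<in> sets (pos_part M \<delta>)"
      then have B: "B \<in> sets M" by simp
      have "(SUP C \<in> {C \<in> sets M. C \<subseteq> B}. ennreal (\<delta> C)) = ennreal (\<delta> B)"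
      proof (intro antisym SUP_least SUP_upper)
        fix C assume "C \<in> {C \<in> sets M. C \<subseteq> B}"
        then show "ennreal (\<delta> C) \<le> ennreal (\<delta> B)"
          unfolding \<delta>_def using B by (intro ennreal_leI finite_measure_mono) auto
      qed (use B in auto)
      then show "emeasure (pos_part M \<delta>) B = emeasure (return M x) B"
        unfolding emeasure_pos_part[OF \<delta> B] by (simp add: \<delta>_def emeasure_eq_measure)
    qed simp
    then have "S \<delta> A = (\<integral>y. k y A \<partial>return M x)"
      using S A \<delta> signed_integral_nonneg_measure[OF \<delta> nn] by (simp add: kernel_operator_def)
    also have "\<dots> = k x A"
      using S A x by (intro integral_return) (auto simp: kernel_operator_def bounded_kernel_def)
    finally have "S \<delta> A = k x A" .
    moreover have "nonneg_measure M (S \<delta>)"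
      using pos \<delta> nn unfolding positive_operator_def by blast
    ultimately show "0 \<le> k x A"
      using A by (auto simp: nonneg_measure_def)
  qed
qed

end

theory Submission
  imports Defs "HOL-Complex_Analysis.Great_Picard"
begin

text \<open>
  Write \<open>N\<close> for the measure \<open>\<mu>\<close>. Since \<open>S\<^sub>t \<mu> = \<mu>\<close>, the operators \<open>S\<^sub>t\<close> preserve absolute
  continuity with respect to \<open>N\<close>, so they act on densities: a positive semigroup \<open>T\<^sub>t\<close> on the
  integrable functions, uniformly bounded in the mean norm by some \<open>C \<ge> 1\<close>, with \<open>T\<^sub>t 1 = 1\<close>. As
  \<open>S\<^sub>t\<close> for \<open>t = t\<^sub>0\<close> sends every signed measure to one with a density, it suffices that the orbits
  \<open>T\<^sub>t f\<close> converge in mean (\<open>L1_converges\<close>).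

  The kernel enters through compactness. The measure \<open>N(dx) k(x, dy)\<close> at time \<open>t\<^sub>0\<close> is absolutely
  continuous with respect to \<open>N \<otimes> N\<close>, so this one operator is integration against a function
  \<open>p \<in> L\<^sup>1(N \<otimes> N)\<close> (\<open>kernel_has_density\<close>). Approximating \<open>p\<close> by combinations of rectangles shows
  that it and its transpose map bounded sequences to sequences with subsequences converging in mean
  (\<open>kernel_integral_compact\<close>).

  The semigroup need not preserve mass. Averaging the masses \<open>k\<^sub>t(x, \<Omega>)\<close> over ever finer and longer
  grids of rational times, compactness of the transpose gives a density \<open>\<phi>\<close> such that
  \<open>m = \<phi> N\<close> is preserved, \<open>\<integral> T\<^sub>q f dm = \<integral> f dm\<close> for rational \<open>q > 0\<close>, while everything supported on
  \<open>{\<phi> = 0}\<close> dies out under \<open>T\<^sub>t\<close> (\<open>exists_invariant_density\<close>). Let \<open>f\<close> be bounded and let \<open>g\<close> be a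
  limit point of \<open>T\<^sub>n f\<close>. For every constant \<open>c\<close> the distance from \<open>T\<^sub>n f\<close> to \<open>c\<close> in \<open>L\<^sup>1(m)\<close>
  decreases in \<open>n\<close>, hence \<open>T\<^sub>q g\<close> and \<open>g\<close> have the same distance from \<open>c\<close>, and positivity turns this
  into \<open>T\<^sub>q \<bar>g - c\<bar> = \<bar>T\<^sub>q g - c\<bar>\<close> almost everywhere for \<open>m\<close>. So \<open>T\<^sub>q\<close> maps the indicator of each
  level set \<open>{g > c}\<close> to that of \<open>{T\<^sub>q g > c}\<close> (\<open>T_level_set\<close>): the level sets lie in the algebra of
  the sets whose indicators remain indicators, on which the \<open>T\<^sub>q\<close> act as a measure preserving flow.

  Compactness makes this algebra totally bounded, and this is where divisibility of time rules out
  periodic behaviour (\<open>flow_trivial\<close>). A set that cannot be split into two substantial parts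
  overlaps almost entirely with itself after some \<open>n\<close> steps of length \<open>1/K!\<close>, where \<open>n \<le> K\<close>
  and \<open>K\<close> is the size of a finite net; since \<open>n\<close> divides \<open>K!\<close>, it still overlaps with itself at time
  \<open>1\<close>. If some set were moved at time \<open>1\<close>, it would have a part all of whose subsets are moved off
  themselves, and then all of these could be split, which contradicts total boundedness. So \<open>T\<^sub>1\<close> fixes
  all level sets of \<open>g\<close>, hence \<open>g\<close> itself almost everywhere for \<open>m\<close>; as what lies outside \<open>m\<close> dies
  out, \<open>T\<^sub>1 g = g\<close> and \<open>T\<^sub>n f \<rightarrow> g\<close> in mean.

  The same argument along the multiples of any \<open>s > 0\<close> gives further limits. Comparing the two
  shows that \<open>g\<close> is fixed by every \<open>T\<^sub>s\<close> (\<open>fixed_all_times\<close>), and uniform boundedness then gives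
  convergence along all real times.
\<close>

section \<open>Convergence in mean\<close>

definition norm1 :: "'a measure \<Rightarrow> ('a \<Rightarrow> real) \<Rightarrow> real" where
  "norm1 M f = (\<integral>x. \<bar>f x\<bar> \<partial>M)"

abbreviation dist1 :: "'a measure \<Rightarrow> ('a \<Rightarrow> real) \<Rightarrow> ('a \<Rightarrow> real) \<Rightarrow> real" where
  "dist1 M f g \<equiv> norm1 M (\<lambda>x. f x - g x)"

lemma norm1_nonneg [simp]: "0 \<le> norm1 M f"
  by (simp add: norm1_def)

lemma norm1_add_le:
  assumes "integrable M f" "integrable M g"
  shows "norm1 M (\<lambda>x. f x + g x) \<le> norm1 M f + norm1 M g"
proof -
  have "norm1 M (\<lambda>x. f x + g x) \<le> (\<integral>x. \<bar>f x\<bar> + \<bar>g x\<bar> \<partial>M)"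
    unfolding norm1_def using assms by (intro integral_mono) auto
  then show ?thesis using assms by (simp add: norm1_def)
qed

lemma norm1_triangle:
  assumes "integrable M f" "integrable M g" "integrable M h"
  shows "dist1 M f h \<le> dist1 M f g + dist1 M g h"
  using norm1_add_le[of M "\<lambda>x. f x - g x" "\<lambda>x. g x - h x"] assms by simp

lemma norm1_commute: "dist1 M f g = dist1 M g f"
  by (simp add: norm1_def abs_minus_commute)

lemma norm1_cong_AE:
  assumes "AE x in M. f x = g x" "f \<in> borel_measurable M" "g \<in> borel_measurable M"
  shows "norm1 M f = norm1 M g"
  unfolding norm1_def using assms by (intro integral_cong_AE) auto

lemma norm1_mono_AE:
  assumes "integrable M f" "integrable M g" "AE x in M. \<bar>f x\<bar> \<le> \<bar>g x\<bar>"
  shows "norm1 M f \<le> norm1 M g"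
  unfolding norm1_def using assms by (intro integral_mono_AE) auto

lemma norm1_eq_0_iff:
  assumes "integrable M f"
  shows "norm1 M f = 0 \<longleftrightarrow> (AE x in M. f x = 0)"
  unfolding norm1_def using assms by (subst integral_nonneg_eq_0_iff_AE) auto

lemma abs_integral_le_norm1: "\<bar>\<integral>x. f x \<partial>M\<bar> \<le> norm1 M f"
  unfolding norm1_def by (rule integral_abs_bound)

lemma norm1_limit_unique:
  assumes int: "\<And>n. integrable M (f n)" "integrable M g" "integrable M h"
    and lim: "(\<lambda>n. dist1 M (f n) g) \<longlonglongrightarrow> 0" "(\<lambda>n. dist1 M (f n) h) \<longlonglongrightarrow> 0"
  shows "AE x in M. g x = h x"
proof -
  have "dist1 M g h \<le> 0"
  proof (rule LIMSEQ_le_const)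
    show "(\<lambda>n. dist1 M (f n) g + dist1 M (f n) h) \<longlonglongrightarrow> 0"
      using tendsto_add[OF lim] by simp
    show "\<exists>N. \<forall>n\<ge>N. dist1 M g h \<le> dist1 M (f n) g + dist1 M (f n) h"
      using norm1_triangle[OF int(2) int(1) int(3)] by (simp add: norm1_commute[of M "f _" g])
  qed
  then have "dist1 M g h = 0" by (simp add: antisym)
  then show ?thesis using norm1_eq_0_iff[of M "\<lambda>x. g x - h x"] int by simp
qed

text \<open>
  Some subsequence converges almost everywhere; Fatou's lemma along it shows that its pointwise limit
  is also the limit in mean of the whole sequence.
\<close>

lemma L1_complete:
  assumes int: "\<And>n. integrable M (f n)"
    and cauchy: "\<And>e. 0 < e \<Longrightarrow> \<exists>n0. \<forall>i\<ge>n0. \<forall>j\<ge>n0. dist1 M (f i) (f j) < e"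
  shows "\<exists>g. integrable M g \<and> (\<lambda>n. dist1 M (f n) g) \<longlonglongrightarrow> 0"
proof -
  have [measurable]: "f n \<in> borel_measurable M" for n using int by auto
  obtain r where r: "strict_mono r" "AE x in M. Cauchy (\<lambda>i. f (r i) x)"
    using cauchy_L1_AE_cauchy_subseq[of M f] int cauchy unfolding norm1_def by auto
  define g where "g x = (if Cauchy (\<lambda>i. f (r i) x) then lim (\<lambda>i. f (r i) x) else 0)" for x
  have [measurable]: "g \<in> borel_measurable M"
    unfolding g_def by measurable
  have g_lim: "AE x in M. (\<lambda>i. f (r i) x) \<longlonglongrightarrow> g x"
    using r(2) by eventually_elim (simp add: g_def Cauchy_convergent convergent_LIMSEQ_iff[symmetric])
  have fatou: "(\<integral>\<^sup>+x. ennreal \<bar>f n x - g x\<bar> \<partial>M) \<le> ennreal e"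
    if "0 < e" and n0: "\<forall>i\<ge>n0. \<forall>j\<ge>n0. dist1 M (f i) (f j) < e" and "n0 \<le> n" for n n0 e
  proof -
    have "(\<integral>\<^sup>+x. ennreal \<bar>f n x - g x\<bar> \<partial>M) = (\<integral>\<^sup>+x. liminf (\<lambda>i. ennreal \<bar>f n x - f (r i) x\<bar>) \<partial>M)"
    proof (intro nn_integral_cong_AE)
      show "AE x in M. ennreal \<bar>f n x - g x\<bar> = liminf (\<lambda>i. ennreal \<bar>f n x - f (r i) x\<bar>)"
        using g_lim
      proof eventually_elim
        case (elim x)
        have "(\<lambda>i. ennreal \<bar>f n x - f (r i) x\<bar>) \<longlonglongrightarrow> ennreal \<bar>f n x - g x\<bar>"
          by (intro tendsto_ennrealI tendsto_intros elim)
        then show ?case using lim_imp_Liminf[OF sequentially_bot] by metis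
      qed
    qed
    also have "\<dots> \<le> liminf (\<lambda>i. \<integral>\<^sup>+x. ennreal \<bar>f n x - f (r i) x\<bar> \<partial>M)"
      by (intro nn_integral_liminf) auto
    also have "\<dots> \<le> liminf (\<lambda>i. ennreal e)"
    proof (rule Liminf_mono)
      show "\<forall>\<^sub>F i in sequentially. (\<integral>\<^sup>+x. ennreal \<bar>f n x - f (r i) x\<bar> \<partial>M) \<le> ennreal e"
        using eventually_ge_at_top[of n0]
      proof eventually_elim
        case (elim i)
        have "n0 \<le> r i" using elim seq_suble[OF r(1), of i] by simp
        then have "dist1 M (f n) (f (r i)) \<le> e"
          using n0 \<open>n0 \<le> n\<close> by (simp add: less_imp_le)
        moreover have "(\<integral>\<^sup>+x. ennreal \<bar>f n x - f (r i) x\<bar> \<partial>M) = ennreal (dist1 M (f n) (f (r i)))"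
          unfolding norm1_def using int by (intro nn_integral_eq_integral) auto
        ultimately show ?case by (simp add: ennreal_leI)
      qed
    qed
    finally show ?thesis by (simp add: Liminf_const)
  qed
  obtain n1 where n1: "\<forall>i\<ge>n1. \<forall>j\<ge>n1. dist1 M (f i) (f j) < 1"
    using cauchy[of 1] by auto
  have "integrable M (\<lambda>x. f n1 x - g x)"
  proof (rule integrableI_bounded)
    have "(\<integral>\<^sup>+x. ennreal (norm (f n1 x - g x)) \<partial>M) \<le> ennreal 1"
      using fatou[OF _ n1, of n1] by simp
    then show "(\<integral>\<^sup>+x. ennreal (norm (f n1 x - g x)) \<partial>M) < \<infinity>"
      by (rule order.strict_trans1) simp
  qed simp
  then have g_int: "integrable M g"
    using Bochner_Integration.integrable_diff[OF int[of n1], of "\<lambda>x. f n1 x - g x"] by simp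
  have "(\<lambda>n. dist1 M (f n) g) \<longlonglongrightarrow> 0"
  proof (rule LIMSEQ_I)
    fix e :: real assume "0 < e"
    then obtain n0 where n0: "\<forall>i\<ge>n0. \<forall>j\<ge>n0. dist1 M (f i) (f j) < e / 2"
      using cauchy[of "e / 2"] by auto
    show "\<exists>n0. \<forall>n\<ge>n0. norm (dist1 M (f n) g - 0) < e"
    proof (intro exI allI impI)
      fix n assume "n0 \<le> n"
      have "ennreal (dist1 M (f n) g) = (\<integral>\<^sup>+x. ennreal \<bar>f n x - g x\<bar> \<partial>M)"
        unfolding norm1_def
        by (rule nn_integral_eq_integral[symmetric, OF integrable_abs[OF Bochner_Integration.integrable_diff[OF int g_int]]]) simp
      also have "\<dots> \<le> ennreal (e / 2)"
        by (rule fatou[OF _ n0 \<open>n0 \<le> n\<close>]) (use \<open>0 < e\<close> in simp)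
      finally have "dist1 M (f n) g \<le> e / 2"
        using \<open>0 < e\<close> by (subst (asm) ennreal_le_iff) auto
      then show "norm (dist1 M (f n) g - 0) < e"
        using \<open>0 < e\<close> by simp
    qed
  qed
  with g_int show ?thesis by blast
qed

section \<open>Compactness of integral operators\<close>

fun step_kernel :: "(real \<times> 'a set \<times> 'a set) list \<Rightarrow> 'a \<times> 'a \<Rightarrow> real" where
  "step_kernel [] z = 0"
| "step_kernel ((c, A, B) # ts) z = c * indicator (A \<times> B) z + step_kernel ts z"

text \<open>
  In a triple \<open>(c, A, B)\<close> the set \<open>A\<close> belongs to the variable that is integrated out, \<open>B\<close> to the
  remaining one.
\<close>

definition rectangles :: "'a measure \<Rightarrow> (real \<times> 'a set \<times> 'a set) list \<Rightarrow> bool" where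
  "rectangles M ts \<longleftrightarrow> (\<forall>(c, A, B)\<in>set ts. A \<in> sets M \<and> B \<in> sets M)"

lemma step_kernel_append: "step_kernel (ts @ us) z = step_kernel ts z + step_kernel us z"
  by (induction ts z rule: step_kernel.induct) auto

lemma step_kernel_scale: "step_kernel (map (\<lambda>(c, A, B). (d * c, A, B)) ts) z = d * step_kernel ts z"
  by (induction ts z rule: step_kernel.induct) (auto simp: algebra_simps)

context finite_measure
begin

lemma integrable_step_kernel:
  "rectangles M ts \<Longrightarrow> integrable (M \<Otimes>\<^sub>M M) (step_kernel ts)"
proof (induction ts)
  case Nil
  have "step_kernel [] = (\<lambda>z :: 'a \<times> 'a. 0)" by auto
  then show ?case by simp
next
  case (Cons t ts)
  interpret P: finite_measure "M \<Otimes>\<^sub>M M"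
    by (intro finite_measure_pair_measure) unfold_locales
  show ?case
  proof (cases t)
    case (fields c A B)
    then have eq: "step_kernel (t # ts) = (\<lambda>z. c * indicator (A \<times> B) z + step_kernel ts z)"
      by auto
    have "A \<times> B \<in> sets (M \<Otimes>\<^sub>M M)" "rectangles M ts"
      using Cons(2) fields by (auto simp: rectangles_def)
    then show ?thesis
      unfolding eq using Cons(1)
      by (intro Bochner_Integration.integrable_add integrable_mult_right) (auto simp: P.emeasure_eq_measure)
  qed
qed

definition approximable :: "('a \<times> 'a \<Rightarrow> real) \<Rightarrow> bool" where
  "approximable p \<longleftrightarrow> (\<forall>e>0. \<exists>ts. rectangles M ts \<and> norm1 (M \<Otimes>\<^sub>M M) (\<lambda>z. p z - step_kernel ts z) < e)"

lemma approximable_limit: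
  assumes "\<And>n. approximable (q n)" "\<And>n. integrable (M \<Otimes>\<^sub>M M) (q n)" "integrable (M \<Otimes>\<^sub>M M) p"
    and "(\<lambda>n. norm1 (M \<Otimes>\<^sub>M M) (\<lambda>z. p z - q n z)) \<longlonglongrightarrow> 0"
  shows "approximable p"
  unfolding approximable_def
proof (intro allI impI)
  fix e :: real assume "0 < e"
  obtain n where n: "norm1 (M \<Otimes>\<^sub>M M) (\<lambda>z. p z - q n z) < e / 2"
    using order_tendstoD(2)[OF assms(4), of "e / 2"] \<open>0 < e\<close>
    by (auto dest!: eventually_happens'[OF sequentially_bot])
  obtain ts where ts: "rectangles M ts" "norm1 (M \<Otimes>\<^sub>M M) (\<lambda>z. q n z - step_kernel ts z) < e / 2"
    using assms(1)[of n] \<open>0 < e\<close> unfolding approximable_def by (meson half_gt_zero)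
  have "norm1 (M \<Otimes>\<^sub>M M) (\<lambda>z. p z - step_kernel ts z) < e"
    using norm1_triangle[OF assms(3,2) integrable_step_kernel[OF ts(1)], of n] n ts(2) by simp
  with ts(1) show "\<exists>ts. rectangles M ts \<and> norm1 (M \<Otimes>\<^sub>M M) (\<lambda>z. p z - step_kernel ts z) < e" by blast
qed

lemma approximable_add:
  assumes p: "approximable p" "integrable (M \<Otimes>\<^sub>M M) p" and q: "approximable q" "integrable (M \<Otimes>\<^sub>M M) q"
  shows "approximable (\<lambda>z. p z + q z)"
  unfolding approximable_def
proof (intro allI impI)
  fix e :: real assume "0 < e"
  obtain ts where ts: "rectangles M ts" "norm1 (M \<Otimes>\<^sub>M M) (\<lambda>z. p z - step_kernel ts z) < e / 2"
    using p(1) \<open>0 < e\<close> unfolding approximable_def by (meson half_gt_zero)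
  obtain us where us: "rectangles M us" "norm1 (M \<Otimes>\<^sub>M M) (\<lambda>z. q z - step_kernel us z) < e / 2"
    using q(1) \<open>0 < e\<close> unfolding approximable_def by (meson half_gt_zero)
  have "norm1 (M \<Otimes>\<^sub>M M) (\<lambda>z. p z + q z - step_kernel (ts @ us) z) < e"
    using norm1_add_le[of "M \<Otimes>\<^sub>M M" "\<lambda>z. p z - step_kernel ts z" "\<lambda>z. q z - step_kernel us z"]
      p(2) q(2) ts us integrable_step_kernel by (simp add: step_kernel_append algebra_simps)
  moreover have "rectangles M (ts @ us)" using ts us by (auto simp: rectangles_def)
  ultimately show "\<exists>ts. rectangles M ts \<and> norm1 (M \<Otimes>\<^sub>M M) (\<lambda>z. p z + q z - step_kernel ts z) < e" by blast
qed

lemma approximable_scale: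
  assumes p: "approximable p"
  shows "approximable (\<lambda>z. d * p z)"
  unfolding approximable_def
proof (intro allI impI)
  fix e :: real assume "0 < e"
  then have "0 < e / (\<bar>d\<bar> + 1)" by simp
  then obtain ts where ts: "rectangles M ts" "norm1 (M \<Otimes>\<^sub>M M) (\<lambda>z. p z - step_kernel ts z) < e / (\<bar>d\<bar> + 1)"
    using p unfolding approximable_def by blast
  let ?us = "map (\<lambda>(c, A, B). (d * c, A, B)) ts"
  let ?n = "norm1 (M \<Otimes>\<^sub>M M) (\<lambda>z. p z - step_kernel ts z)"
  have "norm1 (M \<Otimes>\<^sub>M M) (\<lambda>z. d * p z - step_kernel ?us z) = \<bar>d\<bar> * ?n"
    unfolding step_kernel_scale right_diff_distrib[symmetric] norm1_def abs_mult by simp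
  also have "\<dots> \<le> (\<bar>d\<bar> + 1) * ?n" by (intro mult_right_mono) auto
  also have "\<dots> < e" using ts(2) by (simp add: field_simps add_nonneg_pos)
  finally show "\<exists>ts. rectangles M ts \<and> norm1 (M \<Otimes>\<^sub>M M) (\<lambda>z. d * p z - step_kernel ts z) < e"
    using ts(1) by (intro exI[of _ ?us]) (auto simp: rectangles_def)
qed

lemma approximable_rectangle: "A \<in> sets M \<Longrightarrow> B \<in> sets M \<Longrightarrow> approximable (indicator (A \<times> B))"
  unfolding approximable_def
  by (intro allI impI exI[of _ "[(1, A, B)]"]) (auto simp: rectangles_def norm1_def)

lemma approximable_empty: "approximable (indicator {})"
proof -
  have "approximable (indicator ({} \<times> {}))" by (rule approximable_rectangle) auto
  then show ?thesis unfolding Sigma_empty1 .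
qed

text \<open>
  Rectangles form an intersection stable generator of the product \<open>\<sigma>\<close>-algebra, and the sets with an
  approximable indicator form a Dynkin system that contains them.
\<close>

lemma approximable_indicator:
  assumes "E \<in> sets (M \<Otimes>\<^sub>M M)"
  shows "approximable (indicator E)"
proof -
  interpret P: finite_measure "M \<Otimes>\<^sub>M M"
    by (intro finite_measure_pair_measure) unfold_locales
  let ?G = "{A \<times> B |A B. A \<in> sets M \<and> B \<in> sets M}"
  let ?\<Omega> = "space M \<times> space M"
  have sets: "sets (M \<Otimes>\<^sub>M M) = sigma_sets ?\<Omega> ?G"
    by (rule sets_pair_measure)
  have int: "integrable (M \<Otimes>\<^sub>M M) (indicator E :: _ \<Rightarrow> real)" if "E \<in> sigma_sets ?\<Omega> ?G" for E
    using that by (simp add: sets[symmetric] P.emeasure_eq_measure)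
  have "?G \<subseteq> Pow ?\<Omega>" using sets.sets_into_space by fast
  from Int_stable_pair_measure_generator this assms[unfolded sets] show ?thesis
  proof (induction rule: sigma_sets_induct_disjoint)
    case (basic E)
    then show ?case using approximable_rectangle by auto
  next
    case empty
    show ?case by (rule approximable_empty)
  next
    case (compl E)
    have "approximable (\<lambda>z. indicator ?\<Omega> z + (-1) * indicator E z)"
    proof (rule approximable_add)
      show "approximable (indicator ?\<Omega>)" by (rule approximable_rectangle) auto
      show "approximable (\<lambda>z. (-1) * indicator E z)" by (rule approximable_scale[OF compl(2)])
      show "integrable (M \<Otimes>\<^sub>M M) (indicator ?\<Omega> :: _ \<Rightarrow> real)"
        by (rule integrable_real_indicator) (auto simp: P.emeasure_eq_measure)
      show "integrable (M \<Otimes>\<^sub>M M) (\<lambda>z. (-1) * indicator E z :: real)"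
        by (rule integrable_mult_right[OF int[OF compl(1)]])
    qed
    also have "(\<lambda>z. indicator ?\<Omega> z + (-1) * indicator E z) = (indicator (?\<Omega> - E) :: _ \<Rightarrow> real)"
      using sigma_sets_into_sp[OF \<open>?G \<subseteq> Pow ?\<Omega>\<close> compl(1)] by (auto simp: indicator_def fun_eq_iff)
    finally show ?case .
  next
    case (union A)
    have A: "A i \<in> sets (M \<Otimes>\<^sub>M M)" for i using union(2) by (auto simp: sets)
    have part: "approximable (indicator (\<Union>i<n. A i))" for n
    proof (induction n)
      case 0
      show ?case using approximable_empty unfolding lessThan_0 UN_empty .
    next
      case (Suc n)
      have "A i \<inter> A n = {}" if "i < n" for i
        using disjoint_family_onD[OF union(1), of i n] that by simp
      then have eq: "(\<lambda>z. indicator (\<Union>i<n. A i) z + indicator (A n) z) = (indicator (\<Union>i<Suc n. A i) :: _ \<Rightarrow> real)"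
        by (auto simp: indicator_def fun_eq_iff less_Suc_eq)
      show ?case
        unfolding eq[symmetric]
      proof (rule approximable_add[OF Suc _ union(3)])
        show "integrable (M \<Otimes>\<^sub>M M) (indicator (A n) :: _ \<Rightarrow> real)"
          using A by (intro integrable_real_indicator) (auto simp: P.emeasure_eq_measure)
        show "integrable (M \<Otimes>\<^sub>M M) (indicator (\<Union>i<n. A i) :: _ \<Rightarrow> real)"
          using A by (intro integrable_real_indicator) (auto simp: P.emeasure_eq_measure)
      qed
    qed
    show ?case
    proof (rule approximable_limit[OF part])
      show "(\<lambda>n. norm1 (M \<Otimes>\<^sub>M M) (\<lambda>z. indicator (\<Union>i. A i) z - indicator (\<Union>i<n. A i) z)) \<longlonglongrightarrow> 0"
      proof -
        have "(\<lambda>n. (\<integral>z. \<bar>indicator (\<Union>i. A i) z - indicator (\<Union>i<n. A i) z\<bar> \<partial>(M \<Otimes>\<^sub>M M))) \<longlonglongrightarrow> (\<integral>z. (0::real) \<partial>(M \<Otimes>\<^sub>M M))"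
        proof (rule integral_dominated_convergence[where w="\<lambda>_. 1"])
          show "AE z in M \<Otimes>\<^sub>M M. (\<lambda>n. \<bar>indicator (\<Union>i. A i) z - indicator (\<Union>i<n. A i) z\<bar> :: real) \<longlonglongrightarrow> 0"
          proof (intro AE_I2)
            fix z
            have "(\<lambda>n. indicator (\<Union>i<n. A i) z :: real) \<longlonglongrightarrow> indicator (\<Union>i. A i) z"
              by (rule LIMSEQ_indicator_UN)
            from tendsto_rabs[OF tendsto_diff[OF tendsto_const[of "indicator (\<Union>i. A i) z"] this]]
            show "(\<lambda>n. \<bar>indicator (\<Union>i. A i) z - indicator (\<Union>i<n. A i) z\<bar> :: real) \<longlonglongrightarrow> 0" by simp
          qed
        qed (use A in \<open>auto simp: indicator_def\<close>)
        then show ?thesis by (simp add: norm1_def)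
      qed
    qed (use A in \<open>auto simp: P.emeasure_eq_measure\<close>)
  qed
qed

lemma integrable_approximable:
  assumes "integrable (M \<Otimes>\<^sub>M M) p"
  shows "approximable p"
  using assms
proof (induction rule: integrable_induct)
  case (base A c)
  then show ?case
    using approximable_scale[OF approximable_indicator, of A c] by (simp add: mult.commute)
next
  case (add f g)
  then show ?case by (intro approximable_add)
next
  case (lim f s)
  show ?case
  proof (rule approximable_limit[OF lim(5,1,4)])
    have "(\<lambda>n. (\<integral>z. \<bar>f z - s n z\<bar> \<partial>(M \<Otimes>\<^sub>M M))) \<longlonglongrightarrow> (\<integral>z. (0::real) \<partial>(M \<Otimes>\<^sub>M M))"
    proof (rule integral_dominated_convergence[where w="\<lambda>z. 3 * \<bar>f z\<bar>"])
      show "AE z in M \<Otimes>\<^sub>M M. (\<lambda>n. \<bar>f z - s n z\<bar>) \<longlonglongrightarrow> 0"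
      proof (intro AE_I2)
        fix z assume "z \<in> space (M \<Otimes>\<^sub>M M)"
        from tendsto_rabs[OF tendsto_diff[OF tendsto_const[of "f z"] lim(2)[OF this]]]
        show "(\<lambda>n. \<bar>f z - s n z\<bar>) \<longlonglongrightarrow> 0" by simp
      qed
      show "AE z in M \<Otimes>\<^sub>M M. norm \<bar>f z - s n z\<bar> \<le> 3 * \<bar>f z\<bar>" for n
        proof (intro AE_I2)
        fix z assume "z \<in> space (M \<Otimes>\<^sub>M M)"
        from lim(3)[OF this, of n] show "norm \<bar>f z - s n z\<bar> \<le> 3 * \<bar>f z\<bar>"
          unfolding real_norm_def by linarith
      qed
    qed (use lim(1,4) in auto)
    then show "(\<lambda>n. norm1 (M \<Otimes>\<^sub>M M) (\<lambda>z. f z - s n z)) \<longlonglongrightarrow> 0"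
      by (simp add: norm1_def)
  qed
qed

text \<open>
  The operator norm from \<open>L\<^sup>\<infinity>\<close> to \<open>L\<^sup>1\<close> is at most the \<open>L\<^sup>1\<close> norm of the kernel. Thus approximating the
  kernel in mean approximates the operator uniformly on bounded functions.
\<close>

lemma kernel_integral_bound:
  assumes q: "integrable (M \<Otimes>\<^sub>M M) q"
    and h [measurable]: "h \<in> borel_measurable M" and hc: "\<And>x. x \<in> space M \<Longrightarrow> \<bar>h x\<bar> \<le> c"
  shows "integrable (M \<Otimes>\<^sub>M M) (\<lambda>(x, y). q (x, y) * h x)"
    and "AE y in M. integrable M (\<lambda>x. q (x, y) * h x)"
    and "integrable M (\<lambda>y. \<integral>x. q (x, y) * h x \<partial>M)"
    and "norm1 M (\<lambda>y. \<integral>x. q (x, y) * h x \<partial>M) \<le> c * norm1 (M \<Otimes>\<^sub>M M) q"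
proof -
  interpret P: pair_sigma_finite M M by unfold_locales
  have [measurable]: "q \<in> borel_measurable (M \<Otimes>\<^sub>M M)" using q by auto
  show int: "integrable (M \<Otimes>\<^sub>M M) (\<lambda>(x, y). q (x, y) * h x)"
  proof (rule Bochner_Integration.integrable_bound[OF integrable_mult_right[OF integrable_abs[OF q], of "\<bar>c\<bar>"]])
    show "AE z in M \<Otimes>\<^sub>M M. norm (case z of (x, y) \<Rightarrow> q (x, y) * h x) \<le> norm (\<bar>c\<bar> * \<bar>q z\<bar>)"
    proof (rule AE_I2)
      fix z assume z: "z \<in> space (M \<Otimes>\<^sub>M M)"
      then have "\<bar>h (fst z)\<bar> \<le> \<bar>c\<bar>" using hc[of "fst z"] by (auto simp: space_pair_measure)
      then have "\<bar>h (fst z)\<bar> * \<bar>q z\<bar> \<le> \<bar>c\<bar> * \<bar>q z\<bar>" by (rule mult_right_mono) simp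
      then show "norm (case z of (x, y) \<Rightarrow> q (x, y) * h x) \<le> norm (\<bar>c\<bar> * \<bar>q z\<bar>)"
        by (cases z) (simp add: abs_mult mult.commute)
    qed
  qed measurable
  show "AE y in M. integrable M (\<lambda>x. q (x, y) * h x)"
    using P.AE_integrable_snd[OF int] by simp
  show int1: "integrable M (\<lambda>y. \<integral>x. q (x, y) * h x \<partial>M)"
    using P.integrable_snd[OF int] by simp
  have inta: "integrable (M \<Otimes>\<^sub>M M) (\<lambda>(x, y). \<bar>q (x, y)\<bar> * \<bar>h x\<bar>)"
    using integrable_abs[OF int] by (simp add: split_def abs_mult)
  have "norm1 M (\<lambda>y. \<integral>x. q (x, y) * h x \<partial>M) \<le> (\<integral>y. \<integral>x. \<bar>q (x, y)\<bar> * \<bar>h x\<bar> \<partial>M \<partial>M)"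
    unfolding norm1_def
  proof (rule integral_mono)
    show "\<bar>\<integral>x. q (x, y) * h x \<partial>M\<bar> \<le> (\<integral>x. \<bar>q (x, y)\<bar> * \<bar>h x\<bar> \<partial>M)" for y
      using integral_abs_bound[of M "\<lambda>x. q (x, y) * h x"] by (simp add: abs_mult)
  qed (use int1 P.integrable_snd[OF inta] in auto)
  also have "\<dots> = (\<integral>(x, y). \<bar>q (x, y)\<bar> * \<bar>h x\<bar> \<partial>(M \<Otimes>\<^sub>M M))"
    by (rule P.integral_snd[OF inta])
  also have "\<dots> \<le> (\<integral>z. c * \<bar>q z\<bar> \<partial>(M \<Otimes>\<^sub>M M))"
  proof (rule integral_mono[OF inta])
    show "integrable (M \<Otimes>\<^sub>M M) (\<lambda>z. c * \<bar>q z\<bar>)" using q by simp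
    fix z assume "z \<in> space (M \<Otimes>\<^sub>M M)"
    then have "\<bar>h (fst z)\<bar> \<le> c" using hc by (auto simp: space_pair_measure)
    then have "\<bar>h (fst z)\<bar> * \<bar>q z\<bar> \<le> c * \<bar>q z\<bar>" by (rule mult_right_mono) simp
    then show "(case z of (x, y) \<Rightarrow> \<bar>q (x, y)\<bar> * \<bar>h x\<bar>) \<le> c * \<bar>q z\<bar>"
      by (cases z) (simp add: mult.commute)
  qed
  finally show "norm1 M (\<lambda>y. \<integral>x. q (x, y) * h x \<partial>M) \<le> c * norm1 (M \<Otimes>\<^sub>M M) q"
    by (simp add: norm1_def)
qed

lemma step_kernel_integral:
  assumes "rectangles M ts" and h: "integrable M h" and y: "y \<in> space M"
  shows "integrable M (\<lambda>x. step_kernel ts (x, y) * h x)"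
    and "(\<integral>x. step_kernel ts (x, y) * h x \<partial>M) =
      (\<Sum>(c, A, B)\<leftarrow>ts. c * indicator B y * (\<integral>x. indicator A x * h x \<partial>M))"
proof -
  have "integrable M (\<lambda>x. step_kernel ts (x, y) * h x) \<and> (\<integral>x. step_kernel ts (x, y) * h x \<partial>M) =
      (\<Sum>(c, A, B)\<leftarrow>ts. c * indicator B y * (\<integral>x. indicator A x * h x \<partial>M))"
    using assms(1)
  proof (induction ts)
    case (Cons t ts)
    obtain c A B where t: "t = (c, A, B)" by (cases t)
    have A: "A \<in> sets M" and ts: "rectangles M ts"
      using Cons(2) by (auto simp: t rectangles_def)
    have intA: "integrable M (\<lambda>x. c * indicator B y * (indicator A x * h x))"
      using integrable_real_mult_indicator[OF A h] by (simp add: mult.commute)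
    have eq: "(\<lambda>x. step_kernel (t # ts) (x, y) * h x) =
        (\<lambda>x. c * indicator B y * (indicator A x * h x) + step_kernel ts (x, y) * h x)"
      by (auto simp: t indicator_times algebra_simps)
    show ?case
      unfolding eq using Cons(1)[OF ts] intA by (simp add: t)
  qed simp
  then show "integrable M (\<lambda>x. step_kernel ts (x, y) * h x)"
    and "(\<integral>x. step_kernel ts (x, y) * h x \<partial>M) =
      (\<Sum>(c, A, B)\<leftarrow>ts. c * indicator B y * (\<integral>x. indicator A x * h x \<partial>M))" by auto
qed

text \<open>
  Choose step kernels \<open>ts k\<close> approximating \<open>p\<close>. They involve only countably many sets \<open>A\<close>, so along a
  diagonal subsequence the integrals of \<open>f n\<close> over all of them converge. The images under each
  finite rank operator then form a Cauchy sequence, and by uniform approximation so do the images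
  under \<open>p\<close>.
\<close>

lemma kernel_integral_compact:
  fixes f :: "nat \<Rightarrow> 'a \<Rightarrow> real"
  assumes p: "integrable (M \<Otimes>\<^sub>M M) p"
    and f [measurable]: "\<And>n. f n \<in> borel_measurable M" and fc: "\<And>n x. x \<in> space M \<Longrightarrow> \<bar>f n x\<bar> \<le> c"
  shows "\<exists>r g. strict_mono r \<and> integrable M g \<and>
    (\<lambda>n. norm1 M (\<lambda>y. (\<integral>x. p (x, y) * f (r n) x \<partial>M) - g y)) \<longlonglongrightarrow> 0"
proof -
  have f_int: "integrable M (f n)" for n
    using fc by (intro integrable_const_bound[where B=c]) auto
  have "\<exists>us. rectangles M us \<and> norm1 (M \<Otimes>\<^sub>M M) (\<lambda>z. p z - step_kernel us z) < inverse (real (Suc k))" for k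
    using integrable_approximable[OF p] unfolding approximable_def by simp
  then obtain ts where ts: "\<And>k::nat. rectangles M (ts k)"
    "\<And>k. norm1 (M \<Otimes>\<^sub>M M) (\<lambda>z. p z - step_kernel (ts k) z) < inverse (real (Suc k))"
    by metis
  define \<A> where "\<A> = (\<Union>k. (\<lambda>(c, A, B). A) ` set (ts k))"
  have \<A>_sets: "A \<in> sets M" if "A \<in> \<A>" for A
    using that ts(1) by (fastforce simp: \<A>_def rectangles_def)
  have "countable \<A>" unfolding \<A>_def by (rule countable_UN) (auto intro!: countable_finite)
  moreover have "norm (\<integral>x. indicator A x * f n x \<partial>M) \<le> norm1 M (\<lambda>x. c)" if "A \<in> \<A>" for n A
  proof -
    have "norm (\<integral>x. indicator A x * f n x \<partial>M) \<le> norm1 M (\<lambda>x. indicator A x * f n x)"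
      using abs_integral_le_norm1 by simp
    also have "\<dots> \<le> norm1 M (\<lambda>x. c)"
    proof (rule norm1_mono_AE)
      show "AE x in M. \<bar>indicator A x * f n x\<bar> \<le> \<bar>c\<bar>"
      proof (rule AE_I2)
        fix x assume "x \<in> space M"
        from fc[OF this, of n] show "\<bar>indicator A x * f n x\<bar> \<le> \<bar>c\<bar>" by (auto simp: indicator_def)
      qed
    qed (use integrable_real_mult_indicator[OF \<A>_sets[OF that] f_int[of n]] in \<open>auto simp: mult.commute\<close>)
    finally show ?thesis .
  qed
  ultimately obtain r where r: "strict_mono (r :: nat \<Rightarrow> nat)"
    "\<And>A. A \<in> \<A> \<Longrightarrow> \<exists>l. (\<lambda>n. \<integral>x. indicator A x * f (r n) x \<partial>M) \<longlonglongrightarrow> l"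
    using function_convergent_subsequence[of \<A> "\<lambda>n A. \<integral>x. indicator A x * f n x \<partial>M" "norm1 M (\<lambda>x. c)"] by blast
  then obtain l where l: "\<And>A. A \<in> \<A> \<Longrightarrow> (\<lambda>n. \<integral>x. indicator A x * f (r n) x \<partial>M) \<longlonglongrightarrow> l A" by metis
  define F where "F n y = (\<integral>x. p (x, y) * f (r n) x \<partial>M)" for n y
  have F_int: "integrable M (F n)" for n
    unfolding F_def by (rule kernel_integral_bound(3)[OF p]) (use fc in auto)
  have "\<exists>n0. \<forall>i\<ge>n0. \<forall>j\<ge>n0. norm1 M (\<lambda>y. F i y - F j y) < e" if "0 < e" for e
  proof -
    obtain k where k: "inverse (real (Suc k)) < e / (4 * \<bar>c\<bar> + 4)"
      using reals_Archimedean[of "e / (4 * \<bar>c\<bar> + 4)"] \<open>0 < e\<close> by auto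
    define \<delta> where "\<delta> n = (\<Sum>(c, A, B)\<leftarrow>ts k. \<bar>c\<bar> * measure M B * \<bar>(\<integral>x. indicator A x * f (r n) x \<partial>M) - l A\<bar>)" for n
    have "(\<lambda>n. \<Sum>(c, A, B)\<leftarrow>us. \<bar>c\<bar> * measure M B * \<bar>(\<integral>x. indicator A x * f (r n) x \<partial>M) - l A\<bar>) \<longlonglongrightarrow> 0"
      if "set us \<subseteq> set (ts k)" for us
      using that
    proof (induction us)
      case (Cons t us)
      obtain c A B where t: "t = (c, A, B)" by (cases t)
      have "A \<in> \<A>" using Cons(2) by (force simp: t \<A>_def)
      have "(\<lambda>n. \<bar>c\<bar> * measure M B * \<bar>(\<integral>x. indicator A x * f (r n) x \<partial>M) - l A\<bar>) \<longlonglongrightarrow> \<bar>c\<bar> * measure M B * \<bar>l A - l A\<bar>"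
        by (intro tendsto_intros l \<open>A \<in> \<A>\<close>)
      from tendsto_add[OF this Cons.IH] Cons(2) show ?case by (simp add: t)
    qed simp
    then have "\<delta> \<longlonglongrightarrow> 0" unfolding \<delta>_def by blast
    then obtain n0 where n0: "\<And>n. n \<ge> n0 \<Longrightarrow> \<delta> n < e / 4"
      using order_tendstoD(2)[of \<delta> 0 sequentially "e / 4"] \<open>0 < e\<close> by (auto simp: eventually_sequentially)
    have "norm1 M (\<lambda>y. F i y - F j y) < e" if "i \<ge> n0" "j \<ge> n0" for i j
    proof -
      define d where "d x = f (r i) x - f (r j) x" for x
      have [measurable]: "d \<in> borel_measurable M" unfolding d_def by measurable
      have d_bd: "\<bar>d x\<bar> \<le> 2 * \<bar>c\<bar>" if "x \<in> space M" for x
        using fc[OF that, of "r i"] fc[OF that, of "r j"] unfolding d_def by linarith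
      have d_int: "integrable M d" unfolding d_def using f_int by simp
      let ?q = "\<lambda>z. p z - step_kernel (ts k) z"
      have sk: "integrable (M \<Otimes>\<^sub>M M) (step_kernel (ts k))" by (rule integrable_step_kernel[OF ts(1)])
      have q: "integrable (M \<Otimes>\<^sub>M M) ?q" using p sk by simp
      note qb = kernel_integral_bound[OF q, of d "2 * \<bar>c\<bar>"]
      note sb = kernel_integral_bound[OF sk, of d "2 * \<bar>c\<bar>"]
      have pb: "AE y in M. integrable M (\<lambda>x. p (x, y) * f n x)" for n
        by (rule kernel_integral_bound(2)[OF p]) (use fc in auto)
      have "norm1 M (\<lambda>y. F i y - F j y) =
          norm1 M (\<lambda>y. (\<integral>x. ?q (x, y) * d x \<partial>M) + (\<integral>x. step_kernel (ts k) (x, y) * d x \<partial>M))"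
      proof (rule norm1_cong_AE)
        have "AE y in M. integrable M (\<lambda>x. ?q (x, y) * d x)" "AE y in M. integrable M (\<lambda>x. step_kernel (ts k) (x, y) * d x)"
          using qb(2) sb(2) d_bd by auto
        with pb[of "r i"] pb[of "r j"]
        show "AE y in M. F i y - F j y = (\<integral>x. ?q (x, y) * d x \<partial>M) + (\<integral>x. step_kernel (ts k) (x, y) * d x \<partial>M)"
        proof eventually_elim
          case (elim y)
          have "F i y - F j y = (\<integral>x. p (x, y) * f (r i) x - p (x, y) * f (r j) x \<partial>M)"
            unfolding F_def using elim by simp
          also have "\<dots> = (\<integral>x. ?q (x, y) * d x + step_kernel (ts k) (x, y) * d x \<partial>M)"
            by (simp add: d_def algebra_simps)
          finally show ?case using elim by simp
        qed
      qed (use F_int qb(3) sb(3) d_bd in auto)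
      also have "\<dots> \<le> norm1 M (\<lambda>y. \<integral>x. ?q (x, y) * d x \<partial>M) + norm1 M (\<lambda>y. \<integral>x. step_kernel (ts k) (x, y) * d x \<partial>M)"
        by (rule norm1_add_le) (use qb(3) sb(3) d_bd in auto)
      also have "norm1 M (\<lambda>y. \<integral>x. ?q (x, y) * d x \<partial>M) \<le> e / 2"
      proof -
        have "norm1 M (\<lambda>y. \<integral>x. ?q (x, y) * d x \<partial>M) \<le> 2 * \<bar>c\<bar> * norm1 (M \<Otimes>\<^sub>M M) ?q"
          using qb(4) d_bd by auto
        also have "\<dots> \<le> 2 * \<bar>c\<bar> * (e / (4 * \<bar>c\<bar> + 4))"
          using ts(2)[of k] k by (intro mult_left_mono) auto
        also have "\<dots> \<le> e / 2" using \<open>0 < e\<close> by (simp add: field_simps)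
        finally show ?thesis .
      qed
      also have "norm1 M (\<lambda>y. \<integral>x. step_kernel (ts k) (x, y) * d x \<partial>M) \<le> \<delta> i + \<delta> j"
      proof -
        have "norm1 M (\<lambda>y. \<integral>x. step_kernel (ts k) (x, y) * d x \<partial>M) =
            norm1 M (\<lambda>y. \<Sum>(c, A, B)\<leftarrow>ts k. c * indicator B y * (\<integral>x. indicator A x * d x \<partial>M))"
          unfolding norm1_def using step_kernel_integral(2)[OF ts(1) d_int]
          by (intro Bochner_Integration.integral_cong) auto
        also have "\<dots> \<le> \<delta> i + \<delta> j"
        proof -
          have "integrable M (\<lambda>y. \<Sum>(c, A, B)\<leftarrow>us. c * indicator B y * (\<integral>x. indicator A x * d x \<partial>M)) \<and>
             norm1 M (\<lambda>y. \<Sum>(c, A, B)\<leftarrow>us. c * indicator B y * (\<integral>x. indicator A x * d x \<partial>M)) \<le>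
               (\<Sum>(c, A, B)\<leftarrow>us. \<bar>c\<bar> * measure M B * \<bar>(\<integral>x. indicator A x * f (r i) x \<partial>M) - l A\<bar>) +
               (\<Sum>(c, A, B)\<leftarrow>us. \<bar>c\<bar> * measure M B * \<bar>(\<integral>x. indicator A x * f (r j) x \<partial>M) - l A\<bar>)"
            if "rectangles M us" for us
            using that
          proof (induction us)
            case Nil
            then show ?case by (simp add: norm1_def)
          next
            case (Cons t us)
            obtain c A B where t: "t = (c, A, B)" by (cases t)
            have A: "A \<in> sets M" and B: "B \<in> sets M" and us: "rectangles M us"
              using Cons(2) by (auto simp: t rectangles_def)
            note IH = Cons(1)[OF us]
            define a where "a n = (\<integral>x. indicator A x * f (r n) x \<partial>M)" for n
            have iA: "integrable M (\<lambda>x. indicator A x * f n x)" for n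
              using integrable_real_mult_indicator[OF A f_int[of n]] by (simp add: mult.commute)
            have da: "(\<integral>x. indicator A x * d x \<partial>M) = a i - a j"
              unfolding a_def d_def using iA by (simp add: right_diff_distrib)
            let ?g = "\<lambda>y. c * indicator B y * (a i - a j)"
            have g: "integrable M ?g"
              using B by (intro integrable_mult_left integrable_mult_right integrable_real_indicator) (auto simp: emeasure_eq_measure)
            have "norm1 M ?g = \<bar>c\<bar> * measure M B * \<bar>a i - a j\<bar>"
              using B by (simp add: norm1_def abs_mult)
            also have "\<dots> \<le> \<bar>c\<bar> * measure M B * (\<bar>a i - l A\<bar> + \<bar>a j - l A\<bar>)"
              by (intro mult_left_mono) auto
            finally have "norm1 M ?g \<le> \<bar>c\<bar> * measure M B * \<bar>a i - l A\<bar> + \<bar>c\<bar> * measure M B * \<bar>a j - l A\<bar>"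
              by (simp add: algebra_simps)
            with IH norm1_add_le[OF g conjunct1[OF IH]] g show ?case
              by (simp add: t da) (simp add: a_def)
          qed
          from this[OF ts(1)] show ?thesis unfolding \<delta>_def by blast
        qed
        finally show ?thesis .
      qed
      also have "e / 2 + (\<delta> i + \<delta> j) < e" using n0[of i] n0[of j] that by simp
      finally show ?thesis by simp
    qed
    then show ?thesis by blast
  qed
  from L1_complete[OF F_int this] obtain g where "integrable M g" "(\<lambda>n. norm1 M (\<lambda>y. F n y - g y)) \<longlonglongrightarrow> 0"
    by blast
  then show ?thesis using r(1) unfolding F_def by blast
qed

end

section \<open>Divisible flows on totally bounded measure algebras\<close>

lemma (in finite_measure) measure_split:
  "A \<in> sets M \<Longrightarrow> B \<in> sets M \<Longrightarrow> measure M A = measure M (A \<inter> B) + measure M (A - B)"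
  using finite_measure_Union[of "A \<inter> B" "A - B"] by (simp add: Int_Diff_Un Int_Diff_disjoint)

lemma (in finite_measure) measure_sym_diff:
  assumes "A \<in> sets M" "B \<in> sets M"
  shows "measure M (sym_diff A B) = measure M A + measure M B - 2 * measure M (A \<inter> B)"
proof -
  have "measure M (sym_diff A B) = measure M (A - B) + measure M (B - A)"
    using assms by (intro finite_measure_Union) auto
  then show ?thesis
    using measure_split[OF assms] measure_split[OF assms(2,1)] by (simp add: Int_commute)
qed

text \<open>
  An algebra of measurable sets with a measure preserving action of the positive rationals, where
  equalities hold up to null sets only. They are expressed through measures of intersections, which
  avoids a quotient by null sets. The last axiom says that the algebra is totally bounded for the
  metric given by the measure of the symmetric difference.
\<close>

locale divisible_flow = finite_measure m
  for m :: "'a measure" +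
  fixes \<D> :: "'a set set" and \<theta> :: "rat \<Rightarrow> 'a set \<Rightarrow> 'a set"
  assumes alg: "algebra (space m) \<D>"
    and sub: "\<D> \<subseteq> sets m"
    and flow_in: "\<And>q A. 0 < q \<Longrightarrow> A \<in> \<D> \<Longrightarrow> \<theta> q A \<in> \<D>"
    and flow_Int: "\<And>q A B. 0 < q \<Longrightarrow> A \<in> \<D> \<Longrightarrow> B \<in> \<D> \<Longrightarrow>
      measure m (\<theta> q A \<inter> \<theta> q B) = measure m (A \<inter> B)"
    and flow_add: "\<And>p q A X. 0 < p \<Longrightarrow> 0 < q \<Longrightarrow> A \<in> \<D> \<Longrightarrow> X \<in> \<D> \<Longrightarrow>
      measure m (X \<inter> \<theta> (p + q) A) = measure m (X \<inter> \<theta> p (\<theta> q A))"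
    and close_pair: "\<And>F e. (\<And>n::nat. F n \<in> \<D>) \<Longrightarrow> 0 < e \<Longrightarrow>
      \<exists>i j. i < j \<and> measure m (sym_diff (F i) (F j)) < e"
begin

interpretation alg: algebra "space m" \<D> by (rule alg)

lemma D_meas [measurable, simp]: "A \<in> \<D> \<Longrightarrow> A \<in> sets m"
  using sub by auto

lemma measure_flow: "0 < q \<Longrightarrow> A \<in> \<D> \<Longrightarrow> measure m (\<theta> q A) = measure m A"
  using flow_Int[of q A A] by simp

text \<open>
  Without a finite net, points chosen greedily outside all earlier balls would form a sequence that
  contradicts \<open>close_pair\<close>.
\<close>

lemma finite_net:
  assumes "0 < e"
  shows "\<exists>\<F>. finite \<F> \<and> \<F> \<subseteq> \<D> \<and> (\<forall>A\<in>\<D>. \<exists>F\<in>\<F>. measure m (sym_diff A F) < e)"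
proof (rule ccontr)
  assume "\<not> ?thesis"
  then have "\<forall>\<F>. \<exists>A. finite \<F> \<and> \<F> \<subseteq> \<D> \<longrightarrow> A \<in> \<D> \<and> (\<forall>F\<in>\<F>. e \<le> measure m (sym_diff A F))"
    by (meson not_le)
  then obtain c where c: "\<And>\<F>. finite \<F> \<Longrightarrow> \<F> \<subseteq> \<D> \<Longrightarrow> c \<F> \<in> \<D>"
    and far: "\<And>\<F> F. finite \<F> \<Longrightarrow> \<F> \<subseteq> \<D> \<Longrightarrow> F \<in> \<F> \<Longrightarrow> e \<le> measure m (sym_diff (c \<F>) F)"
    by metis
  define G where "G = rec_nat {} (\<lambda>_ \<F>. insert (c \<F>) \<F>)"
  have G_Suc: "G (Suc n) = insert (c (G n)) (G n)" for n
    by (simp add: G_def)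
  have G: "finite (G n) \<and> G n \<subseteq> \<D>" for n
    by (induction n) (use c in \<open>simp_all add: G_Suc, simp_all add: G_def\<close>)
  have G_mem: "c (G i) \<in> G j" if "i < j" for i j
    using that by (induction j) (auto simp: G_Suc less_Suc_eq)
  obtain i j where "i < j" "measure m (sym_diff (c (G i)) (c (G j))) < e"
    using close_pair[of "\<lambda>n. c (G n)" e] c G assms by blast
  moreover have "e \<le> measure m (sym_diff (c (G j)) (c (G i)))"
    using far[of "G j"] G G_mem \<open>i < j\<close> by blast
  ultimately show False
    by (simp add: Un_commute)
qed

text \<open>
  If every part of \<open>B\<close> can be split in proportion at least \<open>1 : 3\<close>, then no finite family comes
  within distance \<open>measure m B / 4\<close> of every set: cut \<open>B\<close> along the family and split each cell. The
  induction over the family cuts along one member \<open>G\<close> at a time; including \<open>{}\<close> and \<open>B'\<close> in the claim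
  is what handles \<open>G\<close>, which looks empty or full on the two pieces.
\<close>

lemma splitting_far:
  assumes split: "\<And>B'. B' \<in> \<D> \<Longrightarrow> B' \<subseteq> B \<Longrightarrow> \<exists>X\<in>\<D>. X \<subseteq> B' \<and>
      measure m B' / 4 \<le> measure m X \<and> measure m B' / 4 \<le> measure m (B' - X)"
    and "finite \<F>" "\<F> \<subseteq> \<D>" "B' \<in> \<D>" "B' \<subseteq> B"
  shows "\<exists>A\<in>\<D>. A \<subseteq> B' \<and>
    (\<forall>F\<in>insert {} (insert B' \<F>). measure m B' / 4 \<le> measure m (sym_diff A F \<inter> B'))"
  using assms(2-)
proof (induction \<F> arbitrary: B' rule: finite_induct)
  case empty
  obtain X where X: "X \<in> \<D>" "X \<subseteq> B'"
    "measure m B' / 4 \<le> measure m X" "measure m B' / 4 \<le> measure m (B' - X)"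
    using split[OF empty(2,3)] by blast
  have "sym_diff X {} \<inter> B' = X" "sym_diff X B' \<inter> B' = B' - X"
    using X(2) by auto
  then show ?case
    using X by (intro bexI[of _ X]) auto
next
  case (insert G \<F>)
  have G: "G \<in> \<D>" and B': "B' \<in> \<D>" using insert by auto
  have BG: "B' \<inter> G \<in> \<D>" "B' - G \<in> \<D>"
    using G B' by auto
  obtain A1 where A1: "A1 \<in> \<D>" "A1 \<subseteq> B' \<inter> G" and A1_far: "\<And>F. F \<in> insert {} (insert (B' \<inter> G) \<F>) \<Longrightarrow>
      measure m (B' \<inter> G) / 4 \<le> measure m (sym_diff A1 F \<inter> (B' \<inter> G))"
    using insert.IH[of "B' \<inter> G"] insert.prems BG by blast
  obtain A2 where A2: "A2 \<in> \<D>" "A2 \<subseteq> B' - G" and A2_far: "\<And>F. F \<in> insert {} (insert (B' - G) \<F>) \<Longrightarrow>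
      measure m (B' - G) / 4 \<le> measure m (sym_diff A2 F \<inter> (B' - G))"
    using insert.IH[of "B' - G"] insert.prems BG by blast
  have "measure m B' / 4 \<le> measure m (sym_diff (A1 \<union> A2) F \<inter> B')"
    if F: "F \<in> insert {} (insert B' (insert G \<F>))" for F
  proof -
    \<comment> \<open>inside \<open>B' \<inter> G\<close> and \<open>B' - G\<close> the sets \<open>{}\<close>, \<open>B'\<close>, \<open>G\<close> all look empty or full\<close>
    have FD: "F \<in> \<D>" using F insert.prems G by auto
    have "\<exists>F1\<in>insert {} (insert (B' \<inter> G) \<F>). F1 \<inter> (B' \<inter> G) = F \<inter> (B' \<inter> G)"
      using F by auto
    then obtain F1 where F1: "F1 \<in> insert {} (insert (B' \<inter> G) \<F>)"
      "F1 \<inter> (B' \<inter> G) = F \<inter> (B' \<inter> G)" by blast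
    have "\<exists>F2\<in>insert {} (insert (B' - G) \<F>). F2 \<inter> (B' - G) = F \<inter> (B' - G)"
      using F by auto
    then obtain F2 where F2: "F2 \<in> insert {} (insert (B' - G) \<F>)"
      "F2 \<inter> (B' - G) = F \<inter> (B' - G)" by blast
    have e1: "sym_diff (A1 \<union> A2) F \<inter> B' \<inter> G = sym_diff A1 F1 \<inter> (B' \<inter> G)"
      using F1(2) A1(2) A2(2) by blast
    have e2: "sym_diff (A1 \<union> A2) F \<inter> B' - G = sym_diff A2 F2 \<inter> (B' - G)"
      using F2(2) A1(2) A2(2) by blast
    have "measure m B' / 4 = measure m (B' \<inter> G) / 4 + measure m (B' - G) / 4"
      using measure_split[of B' G] G B' by simp
    also have "\<dots> \<le> measure m (sym_diff (A1 \<union> A2) F \<inter> B' \<inter> G) + measure m (sym_diff (A1 \<union> A2) F \<inter> B' - G)"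
      unfolding e1 e2 by (intro add_mono A1_far A2_far F1 F2)
    also have "\<dots> = measure m (sym_diff (A1 \<union> A2) F \<inter> B')"
      by (rule measure_split[symmetric]) (use A1 A2 FD G B' in auto)
    finally show ?thesis .
  qed
  then show ?case
    using A1 A2 by (intro bexI[of _ "A1 \<union> A2"]) auto
qed

text \<open>
  Among the images of \<open>B\<close> under the first multiples of \<open>\<tau> = 1 / K!\<close>, with \<open>K\<close> the size of a net, two
  are close, so \<open>B\<close> is close to its image after a time \<open>w = n \<tau>\<close> with \<open>n \<le> K\<close>. Iterating this would
  accumulate errors, but the overlap with \<open>B\<close> is always either below one quarter or above three
  quarters, so it never leaves the upper range. Time \<open>1\<close> is a multiple of \<open>w\<close> because \<open>n\<close> divides \<open>K!\<close>.
\<close>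

lemma almost_atom_recurs:
  assumes B: "B \<in> \<D>" "0 < measure m B"
    and atom: "\<And>X. X \<in> \<D> \<Longrightarrow> X \<subseteq> B \<Longrightarrow>
      measure m X < measure m B / 4 \<or> measure m (B - X) < measure m B / 4"
  shows "measure m (B \<inter> \<theta> 1 B) > 0"
proof -
  define b where "b = measure m B"
  have b: "0 < b" using B by (simp add: b_def)
  have dich: "measure m X < b / 4 \<or> 3 * b / 4 < measure m X" if "X \<in> \<D>" "X \<subseteq> B" for X
    using atom[OF that] measure_split[of B X] that B by (auto simp: b_def Int_absorb1)
  obtain \<F> where \<F>: "finite \<F>" "\<F> \<subseteq> \<D>" "\<And>A. A \<in> \<D> \<Longrightarrow> \<exists>F\<in>\<F>. measure m (sym_diff A F) < b / 8"
    using finite_net[of "b / 8"] b by auto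
  define \<tau> :: rat where "\<tau> = 1 / of_nat (fact (card \<F>))"
  have \<tau>: "0 < \<tau>" by (simp add: \<tau>_def)
  define Z where "Z i = \<theta> (of_nat (Suc i) * \<tau>) B" for i :: nat
  have Z: "Z i \<in> \<D>" for i
    unfolding Z_def using \<tau> B by (intro flow_in) simp_all
  have "\<exists>f. \<forall>i. f i \<in> \<F> \<and> measure m (sym_diff (Z i) (f i)) < b / 8"
    using \<F>(3)[OF Z] by metis
  then obtain f where f: "\<And>i. f i \<in> \<F>" "\<And>i. measure m (sym_diff (Z i) (f i)) < b / 8"
    by blast
  have fD: "f i \<in> \<D>" for i using f(1) \<F>(2) by blast
  \<comment> \<open>by the pigeonhole principle two of \<open>Z 0, \<dots>, Z (card \<F>)\<close> are close to the same member of the net\<close>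
  have "\<not> inj_on f {..card \<F>}"
    using \<F>(1) f(1) card_inj_on_le[of f "{..card \<F>}" \<F>] by auto
  then obtain i j where ij: "i < j" "j \<le> card \<F>" "f i = f j"
    unfolding inj_on_def by (metis atMost_iff linorder_neqE_nat)
  define n where "n = j - i"
  have n: "0 < n" "n \<le> card \<F>" using ij by (auto simp: n_def)
  define w where "w = of_nat n * \<tau>"
  have w: "0 < w" using n \<tau> by (simp add: w_def)
  define V where "V = \<theta> w B"
  have V: "V \<in> \<D>" unfolding V_def using w B by (intro flow_in)
  have mV: "measure m V = b" unfolding V_def b_def by (rule measure_flow[OF w B(1)])
  have BV: "3 * b / 4 < measure m (B \<inter> V)"
  proof -
    have "measure m (sym_diff (Z i) (Z j)) \<le> measure m (sym_diff (Z i) (f i) \<union> sym_diff (Z j) (f j))"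
      using Z fD ij(3) by (intro finite_measure_mono) auto
    also have "\<dots> \<le> measure m (sym_diff (Z i) (f i)) + measure m (sym_diff (Z j) (f j))"
      using Z fD by (intro measure_Un_le) auto
    also have "\<dots> < b / 4" using f(2)[of i] f(2)[of j] by simp
    finally have "measure m (sym_diff (Z i) (Z j)) < b / 4" .
    moreover have "measure m (Z k) = b" for k
      unfolding Z_def b_def using \<tau> B by (intro measure_flow) auto
    ultimately have "3 * b / 4 < measure m (Z i \<inter> Z j)"
      using measure_sym_diff[of "Z i" "Z j"] Z b by simp
    also have "Z j = \<theta> (of_nat (Suc i) * \<tau> + w) B"
      using ij(1) unfolding Z_def w_def n_def by (simp add: algebra_simps of_nat_diff)
    also have "measure m (Z i \<inter> \<dots>) = measure m (Z i \<inter> \<theta> (of_nat (Suc i) * \<tau>) V)"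
      unfolding V_def by (rule flow_add) (use \<tau> w B Z in simp_all)
    also have "\<dots> = measure m (B \<inter> V)"
      unfolding Z_def by (rule flow_Int) (use \<tau> B V in simp_all)
    finally show ?thesis .
  qed
  have "measure m (V - B) < b / 4"
    using BV measure_split[of V B] mV V B by (simp add: Int_commute)
  have iter: "3 * b / 4 < measure m (B \<inter> \<theta> (of_nat (Suc k) * w) B)" for k
  proof (induction k)
    case 0
    then show ?case using BV by (simp add: V_def)
  next
    case (Suc k)
    define Y where "Y = \<theta> (of_nat (Suc k) * w) B"
    define Y' where "Y' = \<theta> (of_nat (Suc (Suc k)) * w) B"
    have kw: "0 < of_nat (Suc k) * w" "0 < of_nat (Suc (Suc k)) * w" using w by simp_all
    have Y: "Y \<in> \<D>" "Y' \<in> \<D>" using kw B unfolding Y_def Y'_def by (auto intro: flow_in)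
    have Y'_eq: "Y' = \<theta> (w + of_nat (Suc k) * w) B"
      unfolding Y'_def by (simp add: algebra_simps)
    have "3 * b / 4 < measure m (B \<inter> Y)" using Suc by (simp add: Y_def)
    also have "\<dots> = measure m (V \<inter> \<theta> w Y)"
      unfolding V_def by (rule flow_Int[symmetric]) (use w B Y in auto)
    also have "\<dots> = measure m (V \<inter> Y')"
      unfolding Y'_eq Y_def by (rule flow_add[symmetric]) (use w kw B V in auto)
    also have "\<dots> \<le> measure m ((B \<inter> Y') \<union> (V - B))"
      using B V Y by (intro finite_measure_mono) auto
    also have "\<dots> \<le> measure m (B \<inter> Y') + measure m (V - B)"
      using B V Y by (intro measure_Un_le) auto
    finally have "b / 4 < measure m (B \<inter> Y')"
      using \<open>measure m (V - B) < b / 4\<close> b by simp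
    then show ?case
      using dich[of "B \<inter> Y'"] B Y unfolding Y'_def by auto
  qed
  have "n dvd fact (card \<F>)" using n by (intro dvd_fact) auto
  then obtain k where k: "fact (card \<F>) = n * k" by (auto simp: dvd_def)
  then have "k \<noteq> 0" by (metis fact_nonzero mult_0_right)
  then obtain k' where k': "k = Suc k'" by (cases k) auto
  have "of_nat k * w = 1"
    unfolding w_def \<tau>_def k using \<open>k \<noteq> 0\<close> n by (simp add: field_simps)
  then show ?thesis using iter[of k'] b k' by simp
qed

text \<open>
  Let \<open>B\<close> be the part of \<open>A\<close> outside its image. Every part of \<open>B\<close> is moved off itself, so by
  \<open>almost_atom_recurs\<close> it can be split, and \<open>splitting_far\<close> contradicts the existence of a finite net.
\<close>

theorem flow_trivial:
  assumes A: "A \<in> \<D>"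
  shows "measure m (sym_diff A (\<theta> 1 A)) = 0"
proof -
  have A1: "\<theta> 1 A \<in> \<D>" using flow_in A by simp
  define B where "B = A - \<theta> 1 A"
  have B: "B \<in> \<D>" "B \<subseteq> A" using A A1 by (auto simp: B_def)
  have moved: "measure m (B' \<inter> \<theta> 1 B') = 0" if B': "B' \<in> \<D>" "B' \<subseteq> B" for B'
  proof -
    have t: "\<theta> 1 B' \<in> \<D>" using flow_in B' by simp
    have "measure m (\<theta> 1 B' \<inter> \<theta> 1 A) = measure m (B' \<inter> A)"
      using flow_Int[of 1 B' A] B' A by simp
    also have "B' \<inter> A = B'" using B' B by auto
    also have "measure m B' = measure m (\<theta> 1 B')"
      using measure_flow[of 1 B'] B' by simp
    finally have "measure m (\<theta> 1 B' - \<theta> 1 A) = 0"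
      using measure_split[of "\<theta> 1 B'" "\<theta> 1 A"] t A1 by simp
    moreover have "measure m (B' \<inter> \<theta> 1 B') \<le> measure m (\<theta> 1 B' - \<theta> 1 A)"
      using t A1 B' by (intro finite_measure_mono) (auto simp: B_def)
    ultimately show ?thesis by (simp add: measure_le_0_iff)
  qed
  have split: "\<exists>X\<in>\<D>. X \<subseteq> B' \<and>
      measure m B' / 4 \<le> measure m X \<and> measure m B' / 4 \<le> measure m (B' - X)"
    if B': "B' \<in> \<D>" "B' \<subseteq> B" for B'
  proof (cases "measure m B' = 0")
    case True
    then show ?thesis by (intro bexI[of _ "{}"]) auto
  next
    case False
    then have "0 < measure m B'" by (simp add: zero_less_measure_iff)
    then show ?thesis
      using almost_atom_recurs[of B'] moved[OF B'] B'(1) by (metis less_irrefl not_le)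
  qed
  have "measure m B = 0"
  proof (rule ccontr)
    assume "measure m B \<noteq> 0"
    then have "0 < measure m B / 4" by (simp add: zero_less_measure_iff)
    from finite_net[OF this] obtain \<F> where \<F>: "finite \<F>" "\<F> \<subseteq> \<D>"
      "\<And>A. A \<in> \<D> \<Longrightarrow> \<exists>F\<in>\<F>. measure m (sym_diff A F) < measure m B / 4"
      by blast
    obtain X where X: "X \<in> \<D>" "\<And>F. F \<in> \<F> \<Longrightarrow> measure m B / 4 \<le> measure m (sym_diff X F \<inter> B)"
      using splitting_far[OF split \<F>(1,2) B(1) order_refl] by blast
    obtain F where F: "F \<in> \<F>" "measure m (sym_diff X F) < measure m B / 4"
      using \<F>(3)[OF X(1)] by blast
    have "measure m (sym_diff X F \<inter> B) \<le> measure m (sym_diff X F)"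
      using X(1) F(1) \<F>(2) by (intro finite_measure_mono) auto
    then show False using X(2)[OF F(1)] F(2) by simp
  qed
  then show ?thesis
    using measure_split[of A "\<theta> 1 A"] measure_sym_diff[of A "\<theta> 1 A"] measure_flow[of 1 A] A A1
    by (simp add: B_def)
qed

end

section \<open>Positive semigroups with a kernel on the space of integrable functions\<close>

definition clip :: "real \<Rightarrow> real \<Rightarrow> real" where
  "clip c x = max (- c) (min c x)"

lemma clip_bound: "0 \<le> c \<Longrightarrow> \<bar>clip c x\<bar> \<le> c"
  by (auto simp: clip_def)

lemma clip_id: "\<bar>x\<bar> \<le> c \<Longrightarrow> clip c x = x"
  by (auto simp: clip_def)

lemma clip_closer: "\<bar>y\<bar> \<le> c \<Longrightarrow> \<bar>y - clip c x\<bar> \<le> \<bar>y - x\<bar>"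
  by (auto simp: clip_def)

lemma clip_abs_le: "0 \<le> c \<Longrightarrow> \<bar>clip c x\<bar> \<le> \<bar>x\<bar>"
  by (auto simp: clip_def)

lemma clip_measurable [measurable]: "clip c \<in> borel_measurable borel"
  unfolding clip_def by measurable

text \<open>
  All but \<open>2 l\<close> terms of the two sums cancel.
\<close>

lemma sum_shift_bound:
  fixes a :: "nat \<Rightarrow> real"
  assumes "\<And>j. \<bar>a j\<bar> \<le> K"
  shows "\<bar>(\<Sum>j<J. a (j + l)) - (\<Sum>j<J. a j)\<bar> \<le> 2 * real l * K"
proof -
  have "(\<Sum>j<J. a (j + l)) = (\<Sum>j\<in>{l..<J + l}. a j)"
    using sum.shift_bounds_nat_ivl[of a 0 l J] by (simp add: lessThan_atLeast0)
  also have "\<dots> = (\<Sum>j\<in>{0..<J + l}. a j) - (\<Sum>j\<in>{0..<l}. a j)"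
    using sum.atLeastLessThan_concat[of 0 l "J + l" a] by simp
  also have "(\<Sum>j\<in>{0..<J + l}. a j) = (\<Sum>j<J. a j) + (\<Sum>j\<in>{J..<J + l}. a j)"
    using sum.atLeastLessThan_concat[of 0 J "J + l" a] by (simp add: lessThan_atLeast0)
  finally have "\<bar>(\<Sum>j<J. a (j + l)) - (\<Sum>j<J. a j)\<bar> \<le> \<bar>\<Sum>j\<in>{J..<J + l}. a j\<bar> + \<bar>\<Sum>j\<in>{0..<l}. a j\<bar>"
    by simp
  also have "\<bar>\<Sum>j\<in>{J..<J + l}. a j\<bar> \<le> real l * K"
    using order_trans[OF sum_abs[of a "{J..<J + l}"] sum_bounded_above[of "{J..<J + l}" "\<lambda>j. \<bar>a j\<bar>" K]] assms by simp
  also have "\<bar>\<Sum>j\<in>{0..<l}. a j\<bar> \<le> real l * K"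
    using order_trans[OF sum_abs[of a "{0..<l}"] sum_bounded_above[of "{0..<l}" "\<lambda>j. \<bar>a j\<bar>" K]] assms by simp
  finally show ?thesis by (simp add: algebra_simps)
qed

lemma (in finite_measure) integrable_bdd:
  fixes f :: "'a \<Rightarrow> real"
  assumes "f \<in> borel_measurable M" "AE x in M. \<bar>f x\<bar> \<le> c"
  shows "integrable M f"
  using assms by (intro integrable_const_bound[where B=c]) simp_all

text \<open>
  Here \<open>M\<close> is the invariant measure, so that the constant function \<open>1\<close> is fixed. The function \<open>w t\<close> is
  the adjoint of \<open>T t\<close> applied to \<open>1\<close>, for a kernel semigroup the mass \<open>k\<^sub>t(x, \<Omega>)\<close>; the bound \<open>w t \<le> C\<close>
  makes the operators uniformly bounded in mean. Only the operator at time \<open>t\<^sub>0\<close> is assumed to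
  be given by a kernel.
  The semigroup law holds exactly, the other properties almost everywhere.
\<close>

locale L1_semigroup = finite_measure M
  for M :: "'a measure" +
  fixes T :: "real \<Rightarrow> ('a \<Rightarrow> real) \<Rightarrow> 'a \<Rightarrow> real"
    and w :: "real \<Rightarrow> 'a \<Rightarrow> real" and p :: "'a \<times> 'a \<Rightarrow> real" and C t\<^sub>0 :: real
  assumes T_int: "\<And>t f. 0 < t \<Longrightarrow> integrable M f \<Longrightarrow> integrable M (T t f)"
    and T_lin: "\<And>t f g a b. 0 < t \<Longrightarrow> integrable M f \<Longrightarrow> integrable M g \<Longrightarrow>
      AE x in M. T t (\<lambda>x. a * f x + b * g x) x = a * T t f x + b * T t g x"
    and T_pos: "\<And>t f. 0 < t \<Longrightarrow> integrable M f \<Longrightarrow> AE x in M. 0 \<le> f x \<Longrightarrow> AE x in M. 0 \<le> T t f x"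
    and T_one: "\<And>t. 0 < t \<Longrightarrow> AE x in M. T t (\<lambda>_. 1) x = 1"
    and T_semigroup: "\<And>s t f. 0 < s \<Longrightarrow> 0 < t \<Longrightarrow> integrable M f \<Longrightarrow> T s (T t f) = T (s + t) f"
    and w_meas: "\<And>t. 0 < t \<Longrightarrow> w t \<in> borel_measurable M"
    and w_bound: "\<And>t x. 0 < t \<Longrightarrow> 0 \<le> w t x \<and> w t x \<le> C"
    and T_mass: "\<And>t f. 0 < t \<Longrightarrow> integrable M f \<Longrightarrow> (\<integral>x. T t f x \<partial>M) = (\<integral>x. f x * w t x \<partial>M)"
    and C_ge: "1 \<le> C"
    and t0_pos: "0 < t\<^sub>0"
    and p_int: "integrable (M \<Otimes>\<^sub>M M) p"
    and T_kernel: "\<And>f. f \<in> borel_measurable M \<Longrightarrow> (\<And>x. \<bar>f x\<bar> \<le> 1) \<Longrightarrow>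
      AE y in M. T t\<^sub>0 f y = (\<integral>x. p (x, y) * f x \<partial>M)"
begin

lemma T_diff:
  assumes "0 < t" "integrable M f" "integrable M g"
  shows "AE x in M. T t (\<lambda>x. f x - g x) x = T t f x - T t g x"
  using T_lin[OF assms, of 1 "-1"] by simp

lemma T_scale:
  assumes "0 < t" "integrable M f"
  shows "AE x in M. T t (\<lambda>x. a * f x) x = a * T t f x"
  using T_lin[OF assms assms(2), of a 0] by simp

lemma T_mono:
  assumes t: "0 < t" and f: "integrable M f" "integrable M g" and le: "AE x in M. f x \<le> g x"
  shows "AE x in M. T t f x \<le> T t g x"
proof -
  have "AE x in M. 0 \<le> T t (\<lambda>x. g x - f x) x"
    using f le by (intro T_pos t) auto
  with T_diff[OF t f(2,1)] show ?thesis by eventually_elim simp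
qed

lemma T_cong:
  assumes t: "0 < t" and f: "integrable M f" "integrable M g" and eq: "AE x in M. f x = g x"
  shows "AE x in M. T t f x = T t g x"
proof -
  have "AE x in M. f x \<le> g x" "AE x in M. g x \<le> f x" using eq by auto
  from T_mono[OF t f this(1)] T_mono[OF t f(2,1) this(2)] show ?thesis by eventually_elim simp
qed

lemma T_abs:
  assumes t: "0 < t" and f: "integrable M f"
  shows "AE x in M. \<bar>T t f x\<bar> \<le> T t (\<lambda>x. \<bar>f x\<bar>) x"
proof -
  have "AE x in M. T t f x \<le> T t (\<lambda>x. \<bar>f x\<bar>) x"
    using f by (intro T_mono t) auto
  moreover have "AE x in M. T t (\<lambda>x. - 1 * f x) x \<le> T t (\<lambda>x. \<bar>f x\<bar>) x"
    using f by (intro T_mono t) auto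
  ultimately show ?thesis
    using T_scale[OF t f, of "-1"] by eventually_elim auto
qed

lemma const_int: "integrable M (\<lambda>_. c :: real)"
  by simp

lemma T_const: "0 < t \<Longrightarrow> AE x in M. T t (\<lambda>_. c) x = c"
  using T_scale[OF _ const_int, of t c 1] T_one[of t] by auto

lemma T_bound:
  assumes t: "0 < t" and f: "integrable M f" and c: "AE x in M. \<bar>f x\<bar> \<le> c"
  shows "AE x in M. \<bar>T t f x\<bar> \<le> c"
proof -
  have "AE x in M. T t (\<lambda>x. \<bar>f x\<bar>) x \<le> T t (\<lambda>_. c) x"
    using f c by (intro T_mono t) auto
  with T_abs[OF t f] T_const[OF t, of c] show ?thesis by eventually_elim simp
qed

lemma norm1_T:
  assumes t: "0 < t" and f: "integrable M f"
  shows "norm1 M (T t f) \<le> C * norm1 M f"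
proof -
  have [measurable]: "w t \<in> borel_measurable M" by (rule w_meas[OF t])
  have [measurable]: "f \<in> borel_measurable M" using f by simp
  have "norm1 M (T t f) \<le> (\<integral>x. T t (\<lambda>x. \<bar>f x\<bar>) x \<partial>M)"
    unfolding norm1_def by (rule integral_mono_AE[OF _ _ T_abs[OF t f]]) (simp_all add: f T_int[OF t])
  also have "\<dots> = (\<integral>x. \<bar>f x\<bar> * w t x \<partial>M)"
    using f by (intro T_mass t) simp
  also have "\<dots> \<le> (\<integral>x. \<bar>f x\<bar> * C \<partial>M)"
  proof (rule integral_mono)
    show "integrable M (\<lambda>x. \<bar>f x\<bar> * w t x)"
      using f w_bound[OF t] by (intro Bochner_Integration.integrable_bound[OF integrable_mult_left[OF integrable_abs[OF f], of C]])
        (use C_ge in \<open>auto intro!: mult_left_mono AE_I2 simp: abs_mult\<close>)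
  qed (use f w_bound[OF t] in \<open>auto intro: mult_left_mono\<close>)
  finally show ?thesis by (simp add: norm1_def mult.commute)
qed

lemma norm1_T_diff:
  assumes t: "0 < t" and f: "integrable M f" "integrable M g"
  shows "dist1 M (T t f) (T t g) \<le> C * dist1 M f g"
proof -
  have "dist1 M (T t f) (T t g) = norm1 M (T t (\<lambda>x. f x - g x))"
  proof (rule norm1_cong_AE)
    show "AE x in M. T t f x - T t g x = T t (\<lambda>x. f x - g x) x"
      using T_diff[OF t f] by eventually_elim simp
  qed (simp_all add: T_int[OF t] f borel_measurable_integrable)
  also have "\<dots> \<le> C * dist1 M f g"
    using f by (intro norm1_T t) simp
  finally show ?thesis .
qed

lemma T_tendsto:
  assumes t: "0 < t" and f: "\<And>n. integrable M (f n)" "integrable M g"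
    and lim: "((\<lambda>n. dist1 M (f n) g) \<longlongrightarrow> 0) F"
  shows "((\<lambda>n. dist1 M (T t (f n)) (T t g)) \<longlongrightarrow> 0) F"
proof (rule tendsto_sandwich[OF _ _ tendsto_const])
  show "((\<lambda>n. C * dist1 M (f n) g) \<longlongrightarrow> 0) F"
    using tendsto_mult_right_zero[OF lim] by simp
  show "\<forall>\<^sub>F n in F. dist1 M (T t (f n)) (T t g) \<le> C * dist1 M (f n) g"
    by (intro always_eventually allI norm1_T_diff t f)
qed simp

text \<open>
  For later times factor \<open>T t\<close> as the compact operator at time \<open>t\<^sub>0\<close> after a contraction for the
  supremum norm.
\<close>

lemma T_compact:
  assumes t: "t\<^sub>0 < t" and f: "\<And>n. f n \<in> borel_measurable M" "\<And>n. AE x in M. \<bar>f n x\<bar> \<le> 1"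
  shows "\<exists>r g. strict_mono (r :: nat \<Rightarrow> nat) \<and> integrable M g \<and>
    (\<lambda>n. dist1 M (T t (f (r n))) g) \<longlonglongrightarrow> 0"
proof -
  have f_int: "integrable M (f n)" for n
    by (rule integrable_bdd[OF f])
  have t': "0 < t - t\<^sub>0" using t by simp
  \<comment> \<open>the kernel formula needs functions bounded everywhere, not just almost everywhere\<close>
  define f' where "f' n x = clip 1 (T (t - t\<^sub>0) (f n) x)" for n x
  have g_int: "integrable M (T (t - t\<^sub>0) (f n))" for n by (rule T_int[OF t' f_int])
  then have [measurable]: "T (t - t\<^sub>0) (f n) \<in> borel_measurable M" for n by auto
  have f'_meas [measurable]: "f' n \<in> borel_measurable M" for n unfolding f'_def by measurable
  have f'_bd: "\<bar>f' n x\<bar> \<le> 1" for n x unfolding f'_def by (simp add: clip_bound)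
  have f'_int: "integrable M (f' n)" for n
    by (rule integrable_bdd[where c=1]) (simp_all add: f'_bd)
  have "\<exists>r g. strict_mono r \<and> integrable M g \<and>
      (\<lambda>n. norm1 M (\<lambda>y. (\<integral>x. p (x, y) * f' (r n) x \<partial>M) - g y)) \<longlonglongrightarrow> 0"
    by (rule kernel_integral_compact[OF p_int f'_meas f'_bd])
  then obtain r g where rg: "strict_mono (r :: nat \<Rightarrow> nat)" "integrable M g"
    "(\<lambda>n. norm1 M (\<lambda>y. (\<integral>x. p (x, y) * f' (r n) x \<partial>M) - g y)) \<longlonglongrightarrow> 0"
    by (elim exE conjE)
  have "norm1 M (\<lambda>y. (\<integral>x. p (x, y) * f' n x \<partial>M) - g y) = dist1 M (T t (f n)) g" for n
  proof (rule norm1_cong_AE)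
    have "AE x in M. f' n x = T (t - t\<^sub>0) (f n) x"
      using T_bound[OF t' f_int f(2), of n] unfolding f'_def by eventually_elim (rule clip_id)
    from T_cong[OF t0_pos f'_int g_int this]
    have "AE x in M. T t\<^sub>0 (f' n) x = T t (f n) x"
      using T_semigroup[OF t0_pos t' f_int] by simp
    with T_kernel[OF f'_meas[of n] f'_bd[of n]]
    show "AE y in M. (\<integral>x. p (x, y) * f' n x \<partial>M) - g y = T t (f n) y - g y"
      by eventually_elim simp
    have "integrable M (\<lambda>y. \<integral>x. p (x, y) * f' n x \<partial>M)"
      by (rule kernel_integral_bound(3)[OF p_int]) (use f'_bd in auto)
    then show "(\<lambda>y. (\<integral>x. p (x, y) * f' n x \<partial>M) - g y) \<in> borel_measurable M"
      using rg(2) by simp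
    show "(\<lambda>x. T t (f n) x - g x) \<in> borel_measurable M"
      using T_int[OF _ f_int, of t] t0_pos t rg(2) by simp
  qed
  with rg show ?thesis by auto
qed

end

section \<open>An invariant density\<close>

context L1_semigroup
begin

text \<open>
  The mean mass of \<open>f\<close> over the times \<open>t\<^sub>0 + j / n!\<close> with \<open>1 \<le> j \<le> n n!\<close>. The grid becomes longer so that the
  means become invariant, and finer so that every rational shift eventually respects it.
\<close>

definition grid_mean :: "nat \<Rightarrow> ('a \<Rightarrow> real) \<Rightarrow> real" where
  "grid_mean n f = (\<Sum>j<n * fact n. \<integral>x. T (real (Suc j) / fact n + t\<^sub>0) f x \<partial>M) / (n * fact n)"

lemma time_pos: "0 < real (Suc j) / fact n"
  by simp

lemma grid_mean_time_pos: "0 < real (Suc j) / fact n + t\<^sub>0"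
  using t0_pos by (intro add_pos_pos) auto

lemma grid_mean_cong:
  assumes "integrable M f" "integrable M g" "AE x in M. f x = g x"
  shows "grid_mean n f = grid_mean n g"
proof -
  have "(\<integral>x. T (real (Suc j) / fact n + t\<^sub>0) f x \<partial>M) = (\<integral>x. T (real (Suc j) / fact n + t\<^sub>0) g x \<partial>M)" for j
    by (rule integral_cong_AE[OF _ _ T_cong[OF grid_mean_time_pos assms]])
      (intro borel_measurable_integrable T_int grid_mean_time_pos assms)+
  then show ?thesis by (simp add: grid_mean_def)
qed

lemma integral_T_bound:
  assumes t: "0 < t" and f: "integrable M f"
  shows "\<bar>\<integral>x. T t f x \<partial>M\<bar> \<le> C * norm1 M f"
  using abs_integral_le_norm1 norm1_T[OF t f] by (rule order_trans)

lemma grid_mean_bound: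
  assumes "integrable M f"
  shows "\<bar>grid_mean n f\<bar> \<le> C * norm1 M f"
proof (cases "n = 0")
  case True
  then show ?thesis using C_ge by (simp add: grid_mean_def)
next
  case False
  let ?a = "\<lambda>j. \<integral>x. T (real (Suc j) / fact n + t\<^sub>0) f x \<partial>M"
  have "\<bar>\<Sum>j<n * fact n. ?a j\<bar> \<le> (\<Sum>j<n * fact n. \<bar>?a j\<bar>)" by (rule sum_abs)
  also have "\<dots> \<le> real (n * fact n) * (C * norm1 M f)"
    using sum_bounded_above[of "{..<n * fact n}" "\<lambda>j. \<bar>?a j\<bar>" "C * norm1 M f"]
      integral_T_bound[OF grid_mean_time_pos assms] by simp
  finally show ?thesis
    using False by (simp add: grid_mean_def field_simps)
qed

lemma grid_mean_nonneg:
  assumes "integrable M f" "AE x in M. 0 \<le> f x"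
  shows "0 \<le> grid_mean n f"
  unfolding grid_mean_def
  using T_pos[OF grid_mean_time_pos assms] by (intro divide_nonneg_nonneg sum_nonneg integral_nonneg_AE) auto

text \<open>
  For \<open>n \<ge> b\<close> the time \<open>q = a / b\<close> is \<open>q n!\<close> steps of the grid, a fraction \<open>q / n\<close> of its length.
\<close>

lemma grid_mean_shift:
  assumes q: "0 < q" "q = of_nat a / of_nat b" "0 < b" and f: "integrable M f"
  shows "(\<lambda>n. grid_mean n (T q f) - grid_mean n f) \<longlonglongrightarrow> 0"
proof -
  have "\<bar>grid_mean n (T q f) - grid_mean n f\<bar> \<le> 2 * q * (C * norm1 M f) * inverse (real n)" if n: "n \<ge> b" for n
  proof -
    define J where "J = n * fact n"
    define l where "l = a * (fact n div b)"
    have "b dvd fact n" using q n by (intro dvd_fact) auto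
    then have l: "real l = q * fact n"
      using q unfolding l_def by (simp add: real_of_nat_div)
    have J: "0 < J" using q(3) n by (simp add: J_def)
    define A where "A j = (\<integral>x. T (real (Suc j) / fact n + t\<^sub>0) f x \<partial>M)" for j
    have "T (real (Suc j) / fact n + t\<^sub>0) (T q f) = T (real (Suc (j + l)) / fact n + t\<^sub>0) f" for j
    proof -
      have "real (Suc j) / fact n + t\<^sub>0 + q = real (Suc (j + l)) / fact n + t\<^sub>0"
        using l by (simp add: add_divide_distrib)
      then show ?thesis by (simp only: T_semigroup[OF grid_mean_time_pos q(1) f])
    qed
    then have "grid_mean n (T q f) - grid_mean n f = ((\<Sum>j<J. A (j + l)) - (\<Sum>j<J. A j)) / J"
      by (simp add: grid_mean_def A_def J_def diff_divide_distrib)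
    then have "\<bar>grid_mean n (T q f) - grid_mean n f\<bar> = \<bar>(\<Sum>j<J. A (j + l)) - (\<Sum>j<J. A j)\<bar> / J"
      by simp
    also have "\<dots> \<le> 2 * real l * (C * norm1 M f) / J"
      using sum_shift_bound[where a=A and K="C * norm1 M f" and J=J and l=l] integral_T_bound[OF grid_mean_time_pos f]
      by (intro divide_right_mono) (auto simp: A_def)
    also have "\<dots> = 2 * q * (C * norm1 M f) * inverse (real n)"
      using l by (simp add: J_def field_simps)
    finally show ?thesis .
  qed
  then have "\<forall>\<^sub>F n in sequentially. norm (grid_mean n (T q f) - grid_mean n f) \<le> 2 * q * (C * norm1 M f) * inverse (real n)"
    by (auto simp: eventually_sequentially)
  moreover have "(\<lambda>n. 2 * q * (C * norm1 M f) * inverse (real n)) \<longlonglongrightarrow> 0"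
    by (intro tendsto_mult_right_zero LIMSEQ_inverse_real_of_nat[THEN LIMSEQ_imp_Suc])
  ultimately show ?thesis
    by (rule Lim_null_comparison)
qed

text \<open>
  By Fubini the functional \<open>grid_mean n\<close> has as density the transposed kernel applied to the mean
  \<open>h n\<close> of the functions \<open>w\<close>. As \<open>h n\<close> is bounded by \<open>C\<close>, these densities have a subsequence
  converging in mean.
\<close>

lemma exists_grid_mean_density:
  "\<exists>r \<phi>. strict_mono (r :: nat \<Rightarrow> nat) \<and> integrable M \<phi> \<and>
    (\<forall>f. f \<in> borel_measurable M \<longrightarrow> (\<forall>x. \<bar>f x\<bar> \<le> 1) \<longrightarrow> (\<lambda>n. grid_mean (r n) f) \<longlonglongrightarrow> (\<integral>x. f x * \<phi> x \<partial>M))"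
proof -
  interpret P: pair_sigma_finite M M by unfold_locales
  define p' where "p' = (\<lambda>(y, x). p (x, y))"
  have p': "integrable (M \<Otimes>\<^sub>M M) p'"
    using P.integrable_product_swap[OF p_int] by (simp add: p'_def)
  define h where "h n x = (\<Sum>j<n * fact n. w (real (Suc j) / fact n) x) / (n * fact n)" for n x
  have [measurable]: "w (real (Suc j) / fact n) \<in> borel_measurable M" for j n
    by (rule w_meas[OF time_pos])
  have h_meas [measurable]: "h n \<in> borel_measurable M" for n unfolding h_def by measurable
  have h_bd: "\<bar>h n x\<bar> \<le> C" for n x
  proof (cases "n = 0")
    case False
    have "0 \<le> (\<Sum>j<n * fact n. w (real (Suc j) / fact n) x)"
      by (rule sum_nonneg) (use w_bound[OF time_pos] in auto)
    moreover have "(\<Sum>j<n * fact n. w (real (Suc j) / fact n) x) \<le> real (n * fact n) * C"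
      using sum_bounded_above[of "{..<n * fact n}" "\<lambda>j. w (real (Suc j) / fact n) x" C] w_bound[OF time_pos] by simp
    ultimately show ?thesis using False by (simp add: h_def field_simps)
  qed (use C_ge in \<open>simp add: h_def\<close>)
  have "\<exists>r \<phi>. strict_mono r \<and> integrable M \<phi> \<and>
      (\<lambda>n. norm1 M (\<lambda>x. (\<integral>y. p' (y, x) * h (r n) y \<partial>M) - \<phi> x)) \<longlonglongrightarrow> 0"
    by (rule kernel_integral_compact[OF p' h_meas h_bd])
  then obtain r \<phi> where r: "strict_mono (r :: nat \<Rightarrow> nat)" and \<phi>: "integrable M \<phi>"
    and lim: "(\<lambda>n. norm1 M (\<lambda>x. (\<integral>y. p' (y, x) * h (r n) y \<partial>M) - \<phi> x)) \<longlonglongrightarrow> 0"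
    by (elim exE conjE)
  have "(\<lambda>n. grid_mean (r n) f) \<longlonglongrightarrow> (\<integral>x. f x * \<phi> x \<partial>M)"
    if f [measurable]: "f \<in> borel_measurable M" and f_bd: "\<And>x. \<bar>f x\<bar> \<le> 1" for f
  proof -
    have f_int: "integrable M f" by (rule integrable_bdd[where c=1]) (simp_all add: f_bd)
    have fu: "integrable M (\<lambda>x. f x * u x)" if "integrable M u" for u
      using f_bd that by (intro Bochner_Integration.integrable_bound[OF that])
        (auto intro!: AE_I2 simp: abs_mult intro: mult_left_le_one_le)
    have wT: "integrable M (\<lambda>y. T t\<^sub>0 f y * w (real (Suc j) / fact n) y)" for j n
    proof (rule Bochner_Integration.integrable_bound[OF integrable_mult_left[OF T_int[OF t0_pos f_int], of C]])
      have [measurable]: "T t\<^sub>0 f \<in> borel_measurable M"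
        by (intro borel_measurable_integrable T_int t0_pos f_int)
      show "(\<lambda>y. T t\<^sub>0 f y * w (real (Suc j) / fact n) y) \<in> borel_measurable M" by measurable
      show "AE y in M. norm (T t\<^sub>0 f y * w (real (Suc j) / fact n) y) \<le> norm (T t\<^sub>0 f y * C)"
        using w_bound[OF time_pos, of j n] C_ge
        by (auto intro!: mult_left_mono simp: abs_mult simp del: of_nat_Suc)
    qed
    have ph: "integrable M (\<lambda>x. \<integral>y. p' (y, x) * h n y \<partial>M)" for n
      by (rule kernel_integral_bound(3)[OF p']) (use h_bd in auto)
    have grid_mean_eq: "grid_mean n f = (\<integral>x. f x * (\<integral>y. p' (y, x) * h n y \<partial>M) \<partial>M)" for n
    proof -
      have "(\<integral>x. T (real (Suc j) / fact n + t\<^sub>0) f x \<partial>M) = (\<integral>y. T t\<^sub>0 f y * w (real (Suc j) / fact n) y \<partial>M)" for j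
        using T_mass[OF time_pos T_int[OF t0_pos f_int], of j n] T_semigroup[OF time_pos t0_pos f_int, of j n]
        by (simp del: of_nat_Suc)
      then have "grid_mean n f = (\<Sum>j<n * fact n. \<integral>y. T t\<^sub>0 f y * w (real (Suc j) / fact n) y \<partial>M) / (n * fact n)"
        by (simp add: grid_mean_def)
      also have "\<dots> = (\<integral>y. T t\<^sub>0 f y * h n y \<partial>M)"
      proof -
        have "(\<integral>y. T t\<^sub>0 f y * h n y \<partial>M) =
            (\<integral>y. (\<Sum>j<n * fact n. T t\<^sub>0 f y * w (real (Suc j) / fact n) y) / (n * fact n) \<partial>M)"
          unfolding h_def times_divide_eq_right sum_distrib_left ..
        also have "\<dots> = (\<Sum>j<n * fact n. \<integral>y. T t\<^sub>0 f y * w (real (Suc j) / fact n) y \<partial>M) / (n * fact n)"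
          unfolding integral_divide_zero by (subst Bochner_Integration.integral_sum[OF wT]) (rule refl)
        finally show ?thesis ..
      qed
      also have "\<dots> = (\<integral>y. (\<integral>x. p (x, y) * f x \<partial>M) * h n y \<partial>M)"
      proof (rule integral_cong_AE)
        show "AE y in M. T t\<^sub>0 f y * h n y = (\<integral>x. p (x, y) * f x \<partial>M) * h n y"
          using T_kernel[OF f f_bd] by eventually_elim simp
        have "integrable M (\<lambda>y. \<integral>x. p (x, y) * f x \<partial>M)"
          by (rule kernel_integral_bound(3)[OF p_int f]) (use f_bd in auto)
        then show "(\<lambda>y. (\<integral>x. p (x, y) * f x \<partial>M) * h n y) \<in> borel_measurable M" by simp
        show "(\<lambda>y. T t\<^sub>0 f y * h n y) \<in> borel_measurable M"
          using T_int[OF t0_pos f_int] by simp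
      qed
      also have "\<dots> = (\<integral>y. \<integral>x. p (x, y) * f x * h n y \<partial>M \<partial>M)"
        by simp
      also have "\<dots> = (\<integral>x. \<integral>y. p (x, y) * f x * h n y \<partial>M \<partial>M)"
      proof (rule P.Fubini_integral)
        have [measurable]: "p \<in> borel_measurable (M \<Otimes>\<^sub>M M)" using p_int by auto
        show "integrable (M \<Otimes>\<^sub>M M) (\<lambda>(x, y). p (x, y) * f x * h n y)"
        proof (rule Bochner_Integration.integrable_bound[OF integrable_mult_left[OF p_int, of C]])
          have "\<bar>f x\<bar> * \<bar>h n y\<bar> \<le> 1 * C" for x y
            using f_bd h_bd by (intro mult_mono) auto
          then have "\<bar>p (x, y)\<bar> * (\<bar>f x\<bar> * \<bar>h n y\<bar>) \<le> \<bar>p (x, y)\<bar> * \<bar>C\<bar>" for x y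
            using C_ge by (intro mult_left_mono) auto
          then show "AE z in M \<Otimes>\<^sub>M M. norm (case z of (x, y) \<Rightarrow> p (x, y) * f x * h n y) \<le> norm (p z * C)"
            by (auto simp: abs_mult mult.assoc)
        qed measurable
      qed
      also have "\<dots> = (\<integral>x. f x * (\<integral>y. p' (y, x) * h n y \<partial>M) \<partial>M)"
        by (simp add: p'_def mult_ac flip: integral_mult_right_zero)
      finally show ?thesis .
    qed
    show ?thesis
    proof (rule LIM_zero_cancel, rule Lim_null_comparison[OF _ lim], rule always_eventually, rule allI)
      fix n
      have "grid_mean (r n) f - (\<integral>x. f x * \<phi> x \<partial>M) = (\<integral>x. f x * ((\<integral>y. p' (y, x) * h (r n) y \<partial>M) - \<phi> x) \<partial>M)"
        unfolding grid_mean_eq using fu[OF ph] fu[OF \<phi>] by (simp add: right_diff_distrib)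
      also have "norm \<dots> \<le> norm1 M (\<lambda>x. f x * ((\<integral>y. p' (y, x) * h (r n) y \<partial>M) - \<phi> x))"
        using abs_integral_le_norm1 by simp
      also have "\<dots> \<le> norm1 M (\<lambda>x. (\<integral>y. p' (y, x) * h (r n) y \<partial>M) - \<phi> x)"
        using f_bd ph \<phi> by (intro norm1_mono_AE fu) (auto intro!: AE_I2 simp: abs_mult mult_left_le_one_le)
      finally show "norm (grid_mean (r n) f - (\<integral>x. f x * \<phi> x \<partial>M)) \<le> \<dots>" .
    qed
  qed
  with r \<phi> show ?thesis by blast
qed

text \<open>
  The limit of the functionals \<open>grid_mean\<close> is invariant under rational shifts. On the set \<open>A\<close> where its
  density vanishes the means of the masses of \<open>T t (indicator A)\<close> tend to \<open>0\<close>, so the mass is small at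
  some time, and by uniform boundedness at all later times.
\<close>

lemma exists_invariant_density:
  "\<exists>\<phi>. \<phi> \<in> borel_measurable M \<and> (\<forall>x. 0 \<le> \<phi> x \<and> \<phi> x \<le> C) \<and>
    (\<forall>q\<in>\<rat>. 0 < q \<longrightarrow> (\<forall>f. integrable M f \<longrightarrow> (AE x in M. \<bar>f x\<bar> \<le> 1) \<longrightarrow>
      (\<integral>x. T q f x * \<phi> x \<partial>M) = (\<integral>x. f x * \<phi> x \<partial>M))) \<and>
    (\<forall>e>0. \<exists>t\<^sub>1. \<forall>t>t\<^sub>1. norm1 M (T t (indicator {x \<in> space M. \<phi> x = 0})) < e)"
proof -
  obtain r \<phi>0 where r: "strict_mono (r :: nat \<Rightarrow> nat)" and \<phi>0: "integrable M \<phi>0"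
    and lim0: "\<And>f. f \<in> borel_measurable M \<Longrightarrow> (\<And>x. \<bar>f x\<bar> \<le> 1) \<Longrightarrow> (\<lambda>n. grid_mean (r n) f) \<longlonglongrightarrow> (\<integral>x. f x * \<phi>0 x \<partial>M)"
    using exists_grid_mean_density by blast
  have r_top: "filterlim r sequentially sequentially" using r by (rule filterlim_subseq)
  define \<phi> where "\<phi> x = max 0 (min C (\<phi>0 x))" for x
  have [measurable]: "\<phi>0 \<in> borel_measurable M" using \<phi>0 by simp
  have \<phi>_meas [measurable]: "\<phi> \<in> borel_measurable M" unfolding \<phi>_def by measurable
  have \<phi>_bd: "0 \<le> \<phi> x \<and> \<phi> x \<le> C" for x using C_ge by (auto simp: \<phi>_def)
  have ind_int: "integrable M (indicator A :: _ \<Rightarrow> real)" if "A \<in> sets M" for A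
    using that by (intro integrable_real_indicator) (auto simp: emeasure_eq_measure)
  have ind_lim: "(\<lambda>n. grid_mean (r n) (indicator A)) \<longlonglongrightarrow> (\<integral>x. indicator A x * \<phi>0 x \<partial>M)" if "A \<in> sets M" for A
    using that by (intro lim0) (auto simp: indicator_def)
  have "AE x in M. 0 \<le> \<phi>0 x"
  proof (rule density_nonneg[OF \<phi>0])
    fix A assume A: "A \<in> sets M"
    have "0 \<le> (\<integral>x. indicator A x * \<phi>0 x \<partial>M)"
      by (rule LIMSEQ_le_const[OF ind_lim[OF A]]) (use grid_mean_nonneg[OF ind_int[OF A]] in auto)
    then show "0 \<le> set_lebesgue_integral M A \<phi>0" by (simp add: set_lebesgue_integral_def)
  qed
  moreover have "AE x in M. 0 \<le> C - \<phi>0 x"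
  proof (rule density_nonneg)
    show "integrable M (\<lambda>x. C - \<phi>0 x)" using \<phi>0 by simp
    fix A assume A: "A \<in> sets M"
    have "grid_mean (r n) (indicator A) \<le> C * measure M A" for n
      using grid_mean_bound[OF ind_int[OF A], of "r n"] A by (simp add: norm1_def)
    then have "(\<integral>x. indicator A x * \<phi>0 x \<partial>M) \<le> C * measure M A"
      by (intro LIMSEQ_le_const2[OF ind_lim[OF A]]) auto
    moreover have "set_lebesgue_integral M A (\<lambda>x. C - \<phi>0 x) = (\<integral>x. indicator A x * C - indicator A x * \<phi>0 x \<partial>M)"
      by (simp add: set_lebesgue_integral_def right_diff_distrib)
    moreover have "\<dots> = C * measure M A - (\<integral>x. indicator A x * \<phi>0 x \<partial>M)"
      using A integrable_real_mult_indicator[OF A \<phi>0] ind_int[OF A]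
      by (subst Bochner_Integration.integral_diff) (auto simp: mult.commute)
    ultimately show "0 \<le> set_lebesgue_integral M A (\<lambda>x. C - \<phi>0 x)" by simp
  qed
  ultimately have \<phi>_eq: "AE x in M. \<phi>0 x = \<phi> x"
    by eventually_elim (simp add: \<phi>_def)
  have lim: "(\<lambda>n. grid_mean (r n) f) \<longlonglongrightarrow> (\<integral>x. f x * \<phi> x \<partial>M)"
    if f: "integrable M f" and f_bd: "AE x in M. \<bar>f x\<bar> \<le> 1" for f
  proof -
    have [measurable]: "f \<in> borel_measurable M" using f by simp
    define f' where "f' x = clip 1 (f x)" for x
    have [measurable]: "f' \<in> borel_measurable M" unfolding f'_def by measurable
    have f'_bd: "\<bar>f' x\<bar> \<le> 1" for x by (simp add: f'_def clip_bound)
    have f'_int: "integrable M f'" by (rule integrable_bdd[where c=1]) (simp_all add: f'_bd)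
    have eq: "AE x in M. f' x = f x" using f_bd unfolding f'_def by eventually_elim (rule clip_id)
    have "grid_mean n f' = grid_mean n f" for n by (rule grid_mean_cong[OF f'_int f eq])
    moreover have "(\<integral>x. f' x * \<phi>0 x \<partial>M) = (\<integral>x. f x * \<phi> x \<partial>M)"
      using eq \<phi>_eq by (intro integral_cong_AE) auto
    ultimately show ?thesis using lim0[of f'] f'_bd by simp
  qed
  have inv: "(\<integral>x. T q f x * \<phi> x \<partial>M) = (\<integral>x. f x * \<phi> x \<partial>M)"
    if q: "q \<in> \<rat>" "0 < q" and f: "integrable M f" "AE x in M. \<bar>f x\<bar> \<le> 1" for q f
  proof -
    obtain a b :: nat where ab: "b \<noteq> 0" "\<bar>q\<bar> = real a / real b"
      by (rule Rats_abs_nat_div_natE[OF q(1)]) auto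
    have "(\<lambda>n. grid_mean n (T q f) - grid_mean n f) \<longlonglongrightarrow> 0"
      using ab q by (intro grid_mean_shift[of q a b] f) auto
    from filterlim_compose[OF this r_top]
    have "(\<lambda>n. grid_mean (r n) (T q f) - grid_mean (r n) f) \<longlonglongrightarrow> 0" .
    moreover have "(\<lambda>n. grid_mean (r n) (T q f) - grid_mean (r n) f) \<longlonglongrightarrow> (\<integral>x. T q f x * \<phi> x \<partial>M) - (\<integral>x. f x * \<phi> x \<partial>M)"
      by (intro tendsto_diff lim f T_int T_bound q)
    ultimately show ?thesis using LIMSEQ_unique by fastforce
  qed
  have zero: "\<exists>t\<^sub>1. \<forall>t>t\<^sub>1. norm1 M (T t (indicator {x \<in> space M. \<phi> x = 0})) < e" if "0 < e" for e
  proof -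
    define A where "A = {x \<in> space M. \<phi> x = 0}"
    have A [measurable]: "A \<in> sets M" unfolding A_def by measurable
    have "(\<integral>x. indicator A x * \<phi> x \<partial>M) = (\<integral>x. 0 \<partial>M)"
      by (intro Bochner_Integration.integral_cong) (auto simp: A_def indicator_def)
    then have "(\<lambda>n. grid_mean (r n) (indicator A)) \<longlonglongrightarrow> 0"
      using lim[of "indicator A", OF ind_int[OF A]] by (simp add: indicator_def)
    moreover have "0 < e / (2 * C)" using \<open>0 < e\<close> C_ge by simp
    ultimately have "\<forall>\<^sub>F n in sequentially. grid_mean (r n) (indicator A) < e / (2 * C) \<and> 0 < n"
      using order_tendstoD(2) eventually_gt_at_top[of 0] eventually_conj by metis
    then obtain n where n: "grid_mean (r n) (indicator A) < e / (2 * C)" "0 < n"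
      by (auto dest!: eventually_happens'[OF sequentially_bot])
    define k where "k = r n"
    have k: "0 < k" using seq_suble[OF r, of n] n(2) by (simp add: k_def)
    let ?a = "\<lambda>j. \<integral>x. T (real (Suc j) / fact k + t\<^sub>0) (indicator A) x \<partial>M"
    have "\<exists>j<k * fact k. ?a j < e / (2 * C)"
    proof (rule ccontr)
      assume "\<not> ?thesis"
      then have "of_nat (card {..<k * fact k}) * (e / (2 * C)) \<le> (\<Sum>j<k * fact k. ?a j)"
        by (intro sum_bounded_below) (meson lessThan_iff not_less)
      then have "e / (2 * C) \<le> grid_mean k (indicator A)"
        using k unfolding grid_mean_def by (simp add: field_simps)
      then show False using n(1) by (simp add: k_def)
    qed
    then obtain j where j: "?a j < e / (2 * C)" by blast
    define u where "u = real (Suc j) / fact k + t\<^sub>0"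
    have u: "0 < u" unfolding u_def by (rule grid_mean_time_pos)
    have "norm1 M (T u (indicator A)) = (\<integral>x. T u (indicator A) x \<partial>M)"
      unfolding norm1_def
      by (rule integral_cong_AE, intro borel_measurable_abs borel_measurable_integrable T_int u ind_int A,
          intro borel_measurable_integrable T_int u ind_int A)
         (use T_pos[OF u ind_int[OF A]] in auto)
    then have small: "norm1 M (T u (indicator A)) < e / (2 * C)" using j by (simp add: u_def)
    have "norm1 M (T t (indicator A)) < e" if t: "t > u" for t
    proof -
      have tu: "0 < t - u" using t by simp
      have "norm1 M (T t (indicator A)) = norm1 M (T (t - u) (T u (indicator A)))"
        using T_semigroup[OF tu u ind_int[OF A]] by simp
      also have "\<dots> \<le> C * norm1 M (T u (indicator A))"
        by (intro norm1_T tu T_int u ind_int A)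
      also have "\<dots> \<le> C * (e / (2 * C))"
        using small C_ge by (intro mult_left_mono) auto
      also have "\<dots> < e" using C_ge \<open>0 < e\<close> by simp
      finally show ?thesis .
    qed
    then show ?thesis unfolding A_def by blast
  qed
  show ?thesis
    by (rule exI[of _ \<phi>]) (use \<phi>_meas \<phi>_bd inv zero in blast)
qed

end

section \<open>Limit points of orbits\<close>

text \<open>
  The piecewise linear function that rises from \<open>0\<close> at \<open>c\<close> to \<open>1\<close> at \<open>c + 1 / (k + 1)\<close>, written as a
  combination of the distances of \<open>y\<close> from the two corners and a constant: these are the functions that
  the operators are shown to respect.
\<close>

definition ramp :: "nat \<Rightarrow> real \<Rightarrow> real \<Rightarrow> real" where
  "ramp k c y = real (Suc k) / 2 * (\<bar>y - c\<bar> - \<bar>y - (c + 1 / real (Suc k))\<bar>) + 1 / 2"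

lemma ramp_measurable [measurable]: "ramp k c \<in> borel_measurable borel"
  unfolding ramp_def by measurable

lemma ramp_le: "y \<le> c \<Longrightarrow> ramp k c y = 0"
proof -
  assume "y \<le> c"
  moreover have "0 \<le> 1 / real (Suc k)" by simp
  ultimately have "\<bar>y - c\<bar> - \<bar>y - (c + 1 / real (Suc k))\<bar> = - (1 / real (Suc k))" by linarith
  then show ?thesis by (simp add: ramp_def del: of_nat_Suc)
qed

lemma ramp_ge: "c + 1 / real (Suc k) \<le> y \<Longrightarrow> ramp k c y = 1"
proof -
  assume "c + 1 / real (Suc k) \<le> y"
  moreover have "0 \<le> 1 / real (Suc k)" by simp
  ultimately have "\<bar>y - c\<bar> - \<bar>y - (c + 1 / real (Suc k))\<bar> = 1 / real (Suc k)" by linarith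
  then show ?thesis by (simp add: ramp_def del: of_nat_Suc)
qed

lemma ramp_bound: "\<bar>ramp k c y\<bar> \<le> 1"
proof -
  have "\<bar>\<bar>y - c\<bar> - \<bar>y - (c + 1 / real (Suc k))\<bar>\<bar> \<le> 1 / real (Suc k)"
  proof -
    have "0 \<le> 1 / real (Suc k)" by simp
    then show ?thesis by linarith
  qed
  then have "real (Suc k) / 2 * \<bar>\<bar>y - c\<bar> - \<bar>y - (c + 1 / real (Suc k))\<bar>\<bar> \<le> real (Suc k) / 2 * (1 / real (Suc k))"
    by (rule mult_left_mono) simp
  then have "\<bar>real (Suc k) / 2 * (\<bar>y - c\<bar> - \<bar>y - (c + 1 / real (Suc k))\<bar>)\<bar> \<le> 1 / 2"
    by (simp add: abs_mult del: of_nat_Suc)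
  then show ?thesis unfolding ramp_def by linarith
qed

lemma (in finite_measure) ramp_tendsto:
  assumes [measurable]: "u \<in> borel_measurable M"
  shows "(\<lambda>k. norm1 M (\<lambda>x. ramp k c (u x) - indicator {x \<in> space M. c < u x} x)) \<longlonglongrightarrow> 0"
proof -
  let ?d = "\<lambda>k x. \<bar>ramp k c (u x) - indicator {x \<in> space M. c < u x} x\<bar>"
  have "(\<lambda>k. (\<integral>x. ?d k x \<partial>M)) \<longlonglongrightarrow> (\<integral>x. (0::real) \<partial>M)"
  proof (rule integral_dominated_convergence[where w="\<lambda>_. 2"])
    show "AE x in M. (\<lambda>k. ?d k x) \<longlonglongrightarrow> 0"
    proof (rule AE_I2)
      fix x assume x: "x \<in> space M"
      have "\<forall>\<^sub>F k in sequentially. ?d k x = 0"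
      proof (cases "c < u x")
        case True
        have "(\<lambda>k. c + 1 / real (Suc k)) \<longlonglongrightarrow> c + 0"
          by (intro tendsto_add tendsto_const lim_inverse_n'[THEN LIMSEQ_Suc])
        then have "\<forall>\<^sub>F k in sequentially. c + 1 / real (Suc k) < u x"
          using True by (intro order_tendstoD(2)) auto
        then show ?thesis
        proof eventually_elim
          case (elim k)
          then show ?case using ramp_ge[of c k "u x"] True x by simp
        qed
      qed (simp add: ramp_le)
      then show "(\<lambda>k. ?d k x) \<longlonglongrightarrow> 0" by (rule tendsto_eventually)
    qed
    show "AE x in M. norm (?d k x) \<le> 2" for k
    proof (rule AE_I2)
      fix x
      show "norm (?d k x) \<le> 2" using ramp_bound[of k c "u x"] by (auto simp: indicator_def)
    qed
  qed auto
  then show ?thesis by (simp add: norm1_def)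
qed

context L1_semigroup
begin

text \<open>
  Measurability is included: these are the representatives of elements of \<open>L\<^sup>\<infinity>\<close>.
\<close>

definition ess_bounded :: "('a \<Rightarrow> real) \<Rightarrow> bool" where
  "ess_bounded f \<longleftrightarrow> f \<in> borel_measurable M \<and> (\<exists>c. AE x in M. \<bar>f x\<bar> \<le> c)"

lemma ess_boundedI: "f \<in> borel_measurable M \<Longrightarrow> (\<And>x. x \<in> space M \<Longrightarrow> \<bar>f x\<bar> \<le> c) \<Longrightarrow> ess_bounded f"
  unfolding ess_bounded_def by (auto intro!: AE_I2)

lemma ess_bounded_meas: "ess_bounded f \<Longrightarrow> f \<in> borel_measurable M"
  by (simp add: ess_bounded_def)

lemma ess_bounded_int: "ess_bounded f \<Longrightarrow> integrable M f"
  unfolding ess_bounded_def using integrable_bdd by blast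

lemma ess_bounded_T: "0 < t \<Longrightarrow> ess_bounded f \<Longrightarrow> ess_bounded (T t f)"
  using T_bound[of t f] T_int[of t f] ess_bounded_int[of f] unfolding ess_bounded_def
  by (blast intro: borel_measurable_integrable)

lemma ess_bounded_lin:
  assumes "ess_bounded f" "ess_bounded g"
  shows "ess_bounded (\<lambda>x. a * f x + b * g x)"
proof -
  obtain c d where c: "AE x in M. \<bar>f x\<bar> \<le> c" and d: "AE x in M. \<bar>g x\<bar> \<le> d"
    using assms unfolding ess_bounded_def by blast
  have "AE x in M. \<bar>a * f x + b * g x\<bar> \<le> \<bar>a\<bar> * c + \<bar>b\<bar> * d"
    using c d
  proof eventually_elim
    case (elim x)
    have "\<bar>a * f x + b * g x\<bar> \<le> \<bar>a\<bar> * \<bar>f x\<bar> + \<bar>b\<bar> * \<bar>g x\<bar>"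
      unfolding abs_mult[symmetric] by (rule abs_triangle_ineq)
    also have "\<dots> \<le> \<bar>a\<bar> * c + \<bar>b\<bar> * d"
      using elim by (intro add_mono mult_left_mono) auto
    finally show ?case .
  qed
  moreover have "(\<lambda>x. a * f x + b * g x) \<in> borel_measurable M"
    using assms unfolding ess_bounded_def by auto
  ultimately show ?thesis unfolding ess_bounded_def by blast
qed

lemma ess_bounded_diff: "ess_bounded f \<Longrightarrow> ess_bounded g \<Longrightarrow> ess_bounded (\<lambda>x. f x - g x)"
  using ess_bounded_lin[of f g 1 "-1"] by simp

lemma ess_bounded_abs: "ess_bounded f \<Longrightarrow> ess_bounded (\<lambda>x. \<bar>f x\<bar>)"
  unfolding ess_bounded_def by auto

lemma ess_bounded_const: "ess_bounded (\<lambda>_. c)"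
  by (rule ess_boundedI[where c="\<bar>c\<bar>"]) auto

lemma ess_bounded_ind: "A \<in> sets M \<Longrightarrow> ess_bounded (indicator A)"
  by (rule ess_boundedI[where c=1]) (auto simp: indicator_def)

end

locale L1_semigroup_invariant = L1_semigroup +
  fixes \<phi> :: "'a \<Rightarrow> real"
  assumes \<phi>_meas [measurable]: "\<phi> \<in> borel_measurable M"
    and \<phi>_nonneg: "\<And>x. 0 \<le> \<phi> x" and \<phi>_le: "\<And>x. \<phi> x \<le> C"
    and \<phi>_inv: "\<And>q f. q \<in> \<rat> \<Longrightarrow> 0 < q \<Longrightarrow> integrable M f \<Longrightarrow> AE x in M. \<bar>f x\<bar> \<le> 1 \<Longrightarrow>
      (\<integral>x. T q f x * \<phi> x \<partial>M) = (\<integral>x. f x * \<phi> x \<partial>M)"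
    and \<phi>_zero: "\<And>e. 0 < e \<Longrightarrow> \<exists>t\<^sub>1. \<forall>t>t\<^sub>1. norm1 M (T t (indicator {x \<in> space M. \<phi> x = 0})) < e"
begin

definition m :: "'a measure" where
  "m = density M (\<lambda>x. ennreal (\<phi> x))"

lemma sets_m [simp, measurable_cong]: "sets m = sets M" and space_m [simp]: "space m = space M"
  by (simp_all add: m_def)

lemma borel_m [simp]: "borel_measurable m = borel_measurable M"
  by (rule measurable_cong_sets) simp_all

lemma AE_m: "(AE x in m. P x) \<longleftrightarrow> (AE x in M. 0 < \<phi> x \<longrightarrow> P x)"
  unfolding m_def by (subst AE_density) auto

lemma AE_mI: "AE x in M. P x \<Longrightarrow> AE x in m. P x"
  unfolding AE_m by auto

lemma integral_m: "f \<in> borel_measurable M \<Longrightarrow> (\<integral>x. f x \<partial>m) = (\<integral>x. f x * \<phi> x \<partial>M)"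
  unfolding m_def by (subst integral_real_density) (auto simp: \<phi>_nonneg mult.commute)

lemma integrable_times_\<phi>:
  fixes f :: "'a \<Rightarrow> real"
  assumes "integrable M f"
  shows "integrable M (\<lambda>x. f x * \<phi> x)"
proof (rule Bochner_Integration.integrable_bound)
  show "integrable M (\<lambda>x. f x * C)" using assms by simp
  show "(\<lambda>x. f x * \<phi> x) \<in> borel_measurable M" using assms by simp
  show "AE x in M. norm (f x * \<phi> x) \<le> norm (f x * C)"
    using \<phi>_nonneg \<phi>_le C_ge by (auto simp: abs_mult intro!: mult_left_mono)
qed

lemma integrable_m:
  fixes f :: "'a \<Rightarrow> real"
  shows "integrable M f \<Longrightarrow> integrable m f"
  unfolding m_def using integrable_times_\<phi>[of f]
  by (subst integrable_real_density) (auto simp: \<phi>_nonneg mult.commute)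

lemma norm1_m_le:
  assumes "integrable M f"
  shows "norm1 m f \<le> C * norm1 M f"
proof -
  have "norm1 m f = (\<integral>x. \<bar>f x\<bar> * \<phi> x \<partial>M)"
    unfolding norm1_def using assms by (intro integral_m) simp
  also have "\<dots> \<le> (\<integral>x. \<bar>f x\<bar> * C \<partial>M)"
    by (rule integral_mono[OF integrable_times_\<phi>]) (use assms \<phi>_le in \<open>auto intro: mult_left_mono\<close>)
  finally show ?thesis by (simp add: norm1_def mult.commute)
qed

lemma finite_m: "finite_measure m"
proof
  have "integrable m (\<lambda>_. 1 :: real)" by (rule integrable_m) simp
  then show "emeasure m (space m) \<noteq> \<infinity>"
    by (simp add: integrable_iff_bounded)
qed

sublocale m: finite_measure m by (rule finite_m)

text \<open>
  Extends \<open>\<phi>_inv\<close> from the unit ball to all bounded functions by scaling.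
\<close>

lemma m_inv:
  assumes q: "q \<in> \<rat>" "0 < q" and f: "ess_bounded f"
  shows "(\<integral>x. T q f x \<partial>m) = (\<integral>x. f x \<partial>m)"
proof -
  obtain c where c: "AE x in M. \<bar>f x\<bar> \<le> c" using f unfolding ess_bounded_def by blast
  define d where "d = \<bar>c\<bar> + 1"
  have d: "0 < d" by (simp add: d_def)
  define f' where "f' = (\<lambda>x. inverse d * f x)"
  have f_int: "integrable M f" by (rule ess_bounded_int[OF f])
  then have f'_int: "integrable M f'" unfolding f'_def by simp
  have f'_bd: "AE x in M. \<bar>f' x\<bar> \<le> 1"
    using c
  proof eventually_elim
    case (elim x)
    then have "\<bar>f x\<bar> \<le> d" by (simp add: d_def)
    then show ?case using d by (simp add: f'_def abs_mult field_simps)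
  qed
  have eq: "f = (\<lambda>x. d * f' x)" using d by (simp add: f'_def fun_eq_iff)
  have Tf: "AE x in M. T q f x = d * T q f' x" unfolding eq by (rule T_scale[OF q(2) f'_int])
  have meas: "T q f \<in> borel_measurable M" "T q f' \<in> borel_measurable M"
    by (intro borel_measurable_integrable T_int q f_int f'_int)+
  have "(\<integral>x. T q f x \<partial>m) = (\<integral>x. T q f x * \<phi> x \<partial>M)" using meas by (intro integral_m)
  also have "\<dots> = (\<integral>x. d * (T q f' x * \<phi> x) \<partial>M)"
    by (rule integral_cong_AE) (use meas Tf in \<open>auto simp: mult.assoc\<close>)
  also have "\<dots> = d * (\<integral>x. f' x * \<phi> x \<partial>M)"
    using \<phi>_inv[OF q f'_int f'_bd] by simp
  also have "\<dots> = (\<integral>x. f x * \<phi> x \<partial>M)"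
    unfolding eq by (simp add: mult.assoc)
  also have "\<dots> = (\<integral>x. f x \<partial>m)" using f_int by (intro integral_m[symmetric]) simp
  finally show ?thesis .
qed

text \<open>
  A positive operator that preserves the integral for \<open>m\<close> is a contraction in mean. In particular it
  respects equality almost everywhere for \<open>m\<close>, which is weaker than for \<open>M\<close>.
\<close>

lemma T_contract:
  assumes q: "q \<in> \<rat>" "0 < q" and f: "ess_bounded f"
  shows "norm1 m (T q f) \<le> norm1 m f"
proof -
  have "norm1 m (T q f) \<le> (\<integral>x. T q (\<lambda>x. \<bar>f x\<bar>) x \<partial>m)"
    unfolding norm1_def
    by (rule integral_mono_AE[OF _ _ AE_mI[OF T_abs[OF q(2) ess_bounded_int[OF f]]]])
      (intro integrable_m integrable_abs T_int q ess_bounded_int f ess_bounded_abs)+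
  also have "\<dots> = norm1 m f"
    unfolding norm1_def by (rule m_inv[OF q ess_bounded_abs[OF f]])
  finally show ?thesis .
qed

lemma T_contract_diff:
  assumes q: "q \<in> \<rat>" "0 < q" and f: "ess_bounded f" "ess_bounded g"
  shows "dist1 m (T q f) (T q g) \<le> dist1 m f g"
proof -
  have int: "integrable M (T q f)" "integrable M (T q g)" "integrable M (T q (\<lambda>x. f x - g x))"
    by (intro T_int q ess_bounded_int f ess_bounded_diff)+
  have "dist1 m (T q f) (T q g) = norm1 m (T q (\<lambda>x. f x - g x))"
  proof (rule norm1_cong_AE)
    show "AE x in m. T q f x - T q g x = T q (\<lambda>x. f x - g x) x"
      by (rule AE_mI) (use T_diff[OF q(2) ess_bounded_int[OF f(1)] ess_bounded_int[OF f(2)]] in auto)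
  qed (use int in simp_all)
  also have "\<dots> \<le> dist1 m f g"
    by (intro T_contract q ess_bounded_diff f)
  finally show ?thesis .
qed

lemma norm1_m_eq_0_iff: "integrable M f \<Longrightarrow> norm1 m f = 0 \<longleftrightarrow> (AE x in m. f x = 0)"
  by (rule norm1_eq_0_iff[OF integrable_m])

lemma T_cong_m:
  assumes q: "q \<in> \<rat>" "0 < q" and f: "ess_bounded f" "ess_bounded g" and eq: "AE x in m. f x = g x"
  shows "AE x in m. T q f x = T q g x"
proof -
  have "AE x in m. f x - g x = 0" using eq by auto
  then have "dist1 m f g = 0"
    using f by (subst norm1_m_eq_0_iff) (auto intro: ess_bounded_int ess_bounded_diff)
  with T_contract_diff[OF q f] have "dist1 m (T q f) (T q g) = 0"
    by (simp add: antisym)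
  then have "AE x in m. T q f x - T q g x = 0"
    by (subst (asm) norm1_m_eq_0_iff) (intro ess_bounded_int ess_bounded_diff ess_bounded_T q f)
  then show ?thesis by auto
qed

text \<open>
  On sets whose indicator is mapped to an indicator, \<open>\<theta> q A\<close> is the set with the image as its
  indicator; the threshold \<open>1/2\<close> selects a representative.
\<close>

definition \<theta> :: "rat \<Rightarrow> 'a set \<Rightarrow> 'a set" where
  "\<theta> q A = {x \<in> space M. T (of_rat q) (indicator A) x > 1 / 2}"

definition \<D> :: "'a set set" where
  "\<D> = {A \<in> sets M. \<forall>q>0. AE x in m. T (of_rat q) (indicator A) x = indicator (\<theta> q A) x}"

lemma \<theta>_sets: "0 < q \<Longrightarrow> A \<in> sets M \<Longrightarrow> \<theta> q A \<in> sets M"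
proof -
  assume "0 < q" "A \<in> sets M"
  then have [measurable]: "T (of_rat q) (indicator A) \<in> borel_measurable M"
    by (intro borel_measurable_integrable T_int ess_bounded_int ess_bounded_ind) simp_all
  show ?thesis unfolding \<theta>_def by measurable
qed

lemma \<D>_sets: "A \<in> \<D> \<Longrightarrow> A \<in> sets M"
  by (simp add: \<D>_def)

lemma \<D>_AE: "A \<in> \<D> \<Longrightarrow> 0 < q \<Longrightarrow> AE x in m. T (of_rat q) (indicator A) x = indicator (\<theta> q A) x"
  by (simp add: \<D>_def)

lemma \<theta>_unique:
  assumes "B \<subseteq> space M" "AE x in m. T (of_rat q) (indicator A) x = indicator B x"
  shows "AE x in m. T (of_rat q) (indicator A) x = indicator (\<theta> q A) x"
  using assms(2) AE_space by eventually_elim (simp add: \<theta>_def indicator_def)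

lemma \<D>I:
  assumes "A \<in> sets M"
    and "\<And>q. 0 < q \<Longrightarrow> \<exists>B\<subseteq>space M. AE x in m. T (of_rat q) (indicator A) x = indicator B x"
  shows "A \<in> \<D>"
  unfolding \<D>_def using assms \<theta>_unique by blast

lemma \<theta>_subset: "\<theta> q A \<subseteq> space M"
  by (auto simp: \<theta>_def)

text \<open>
  By positivity \<open>T (indicator (A \<union> B))\<close> lies above the maximum of the two images and below both their
  sum and \<open>1\<close>; for indicators these bounds agree.
\<close>

lemma T_indicator_Un:
  assumes q: "0 < q" and A: "A \<in> \<D>" and B: "B \<in> \<D>"
  shows "AE x in m. T (of_rat q) (indicator (A \<union> B)) x = indicator (\<theta> q A \<union> \<theta> q B) x"
proof -
  let ?q = "of_rat q :: real"
  have q': "0 < ?q" using q by simp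
  have sets: "A \<in> sets M" "B \<in> sets M" "A \<union> B \<in> sets M" using \<D>_sets A B by auto
  note int = ess_bounded_int[OF ess_bounded_ind[OF sets(1)]] ess_bounded_int[OF ess_bounded_ind[OF sets(2)]] ess_bounded_int[OF ess_bounded_ind[OF sets(3)]]
  have 1: "AE x in M. T ?q (indicator A) x \<le> T ?q (indicator (A \<union> B)) x"
    by (rule T_mono[OF q' int(1,3)]) (auto simp: indicator_def)
  have 2: "AE x in M. T ?q (indicator B) x \<le> T ?q (indicator (A \<union> B)) x"
    by (rule T_mono[OF q' int(2,3)]) (auto simp: indicator_def)
  have 3: "AE x in M. T ?q (indicator (A \<union> B)) x \<le> T ?q (\<lambda>x. 1 * indicator A x + 1 * indicator B x) x"
    by (rule T_mono[OF q' int(3)]) (use ess_bounded_int[OF ess_bounded_lin[OF ess_bounded_ind[OF sets(1)] ess_bounded_ind[OF sets(2)], of 1 1]] in \<open>auto simp: indicator_def\<close>)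
  have 4: "AE x in M. T ?q (\<lambda>x. 1 * indicator A x + 1 * indicator B x) x = 1 * T ?q (indicator A) x + 1 * T ?q (indicator B) x"
    by (rule T_lin[OF q' int(1,2)])
  have 5: "AE x in M. \<bar>T ?q (indicator (A \<union> B)) x\<bar> \<le> 1"
    by (rule T_bound[OF q' int(3)]) (auto simp: indicator_def)
  show ?thesis
    using AE_mI[OF 1] AE_mI[OF 2] AE_mI[OF 3] AE_mI[OF 4] AE_mI[OF 5] \<D>_AE[OF A q] \<D>_AE[OF B q]
    by eventually_elim (auto simp: indicator_def split: if_splits)
qed

lemma \<D>_algebra: "algebra (space m) \<D>"
  unfolding algebra_iff_Un
proof (intro conjI ballI)
  show "\<D> \<subseteq> Pow (space m)" using \<D>_sets sets.sets_into_space by fastforce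
  show "{} \<in> \<D>"
  proof (rule \<D>I)
    fix q :: rat assume "0 < q"
    then have "AE x in M. T (of_rat q) (\<lambda>_. 0) x = 0" by (intro T_const) simp
    then have "AE x in m. T (of_rat q) (indicator {}) x = indicator {} x"
      unfolding indicator_def by (intro AE_mI) simp
    then show "\<exists>B\<subseteq>space M. AE x in m. T (of_rat q) (indicator {}) x = indicator B x" by blast
  qed simp
  show "space m - A \<in> \<D>" if A: "A \<in> \<D>" for A
  proof (rule \<D>I)
    show "space m - A \<in> sets M" using \<D>_sets[OF A] by simp
    fix q :: rat assume q: "0 < q"
    then have q': "0 < (of_rat q :: real)" by simp
    have A': "A \<in> sets M" by (rule \<D>_sets[OF A])
    have c1: "AE x in M. T (of_rat q) (indicator (space m - A)) x = T (of_rat q) (\<lambda>x. 1 - indicator A x) x"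
    proof (rule T_cong[OF q'])
      show "integrable M (indicator (space m - A) :: _ \<Rightarrow> real)" using A' by (intro ess_bounded_int ess_bounded_ind) simp
      show "integrable M (\<lambda>x. 1 - indicator A x :: real)" using A' by (intro ess_bounded_int ess_bounded_diff ess_bounded_const ess_bounded_ind)
    qed (auto simp: indicator_def)
    have c2: "AE x in M. T (of_rat q) (\<lambda>x. 1 - indicator A x) x = T (of_rat q) (\<lambda>_. 1) x - T (of_rat q) (indicator A) x"
      by (rule T_diff[OF q' ess_bounded_int[OF ess_bounded_const] ess_bounded_int[OF ess_bounded_ind[OF A']]])
    have "AE x in m. T (of_rat q) (indicator (space m - A)) x = indicator (space M - \<theta> q A) x"
      using AE_mI[OF c1] AE_mI[OF c2] AE_mI[OF T_one[OF q']] \<D>_AE[OF A q] AE_space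
      by eventually_elim (auto simp: indicator_def)
    then show "\<exists>B\<subseteq>space M. AE x in m. T (of_rat q) (indicator (space m - A)) x = indicator B x"
      by (intro exI[of _ "space M - \<theta> q A"] conjI Diff_subset)
  qed
  show "A \<union> B \<in> \<D>" if "A \<in> \<D>" "B \<in> \<D>" for A B
  proof (rule \<D>I)
    show "A \<union> B \<in> sets M" using that \<D>_sets by auto
    fix q :: rat assume "0 < q"
    from T_indicator_Un[OF this that]
    show "\<exists>C\<subseteq>space M. AE x in m. T (of_rat q) (indicator (A \<union> B)) x = indicator C x"
      by (intro exI[of _ "\<theta> q A \<union> \<theta> q B"] conjI Un_least \<theta>_subset)
  qed
qed

lemma rat_time: "(of_rat q :: real) \<in> \<rat>" "0 < q \<Longrightarrow> 0 < (of_rat q :: real)"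
  by auto

lemma \<theta>_compose:
  fixes s q :: rat
  assumes s: "0 < s" and q: "0 < q" and A: "A \<in> \<D>"
  shows "AE x in m. T (of_rat s) (indicator (\<theta> q A)) x = T (of_rat (s + q)) (indicator A) x"
proof -
  have "AE x in m. T (of_rat s) (indicator (\<theta> q A)) x = T (of_rat s) (T (of_rat q) (indicator A)) x"
  proof (rule T_cong_m[OF rat_time(1) rat_time(2)[OF s]])
    show "ess_bounded (indicator (\<theta> q A))" by (intro ess_bounded_ind \<theta>_sets q \<D>_sets A)
    show "ess_bounded (T (of_rat q) (indicator A))" by (intro ess_bounded_T rat_time q ess_bounded_ind \<D>_sets A)
    show "AE x in m. indicator (\<theta> q A) x = T (of_rat q) (indicator A) x" using \<D>_AE[OF A q] by auto
  qed
  then show ?thesis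
    using T_semigroup[OF rat_time(2)[OF s] rat_time(2)[OF q] ess_bounded_int[OF ess_bounded_ind[OF \<D>_sets[OF A]]]]
    by (simp add: of_rat_add)
qed

lemma measure_eqI_indicator:
  assumes "A \<in> sets M" "B \<in> sets M" "AE x in m. indicator A x = (indicator B x :: real)"
  shows "measure m A = measure m B"
  using assms by (intro m.finite_measure_eq_AE) (auto simp: indicator_def split: if_splits)

lemma measure_\<theta>:
  assumes A: "A \<in> sets M" and B: "B \<in> sets M" and q: "0 < q"
    and eq: "AE x in m. T (of_rat q) (indicator A) x = indicator B x"
  shows "measure m B = measure m A"
proof -
  have "measure m B = (\<integral>x. indicator B x \<partial>m)" using B by simp
  also have "\<dots> = (\<integral>x. T (of_rat q) (indicator A) x \<partial>m)"
  proof (rule integral_cong_AE)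
    show "T (of_rat q) (indicator A) \<in> borel_measurable m"
      using ess_bounded_T[OF rat_time(2)[OF q] ess_bounded_ind[OF A]] by (simp add: ess_bounded_def)
  qed (use B eq in auto)
  also have "\<dots> = (\<integral>x. indicator A x \<partial>m)" by (rule m_inv[OF rat_time(1) rat_time(2)[OF q] ess_bounded_ind[OF A]])
  also have "\<dots> = measure m A" using A by simp
  finally show ?thesis .
qed

lemma norm1_m_indicator_diff:
  assumes "A \<in> sets M" "B \<in> sets M"
  shows "dist1 m (indicator A) (indicator B) = measure m (sym_diff A B)"
proof -
  have "(\<lambda>x. \<bar>indicator A x - indicator B x :: real\<bar>) = indicator (sym_diff A B)"
    by (auto simp: indicator_def fun_eq_iff)
  then show ?thesis using assms unfolding norm1_def by simp
qed

text \<open>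
  The flow is measure preserving because \<open>m\<close> is invariant, and the union formula transfers this to
  intersections. Total boundedness comes from compactness: the flow is isometric, and at a
  time beyond \<open>t\<^sub>0\<close> the images of the indicators have a subsequence converging in mean.
\<close>

lemma flow: "divisible_flow m \<D> \<theta>"
proof (intro divisible_flow.intro divisible_flow_axioms.intro)
  show "finite_measure m" by (rule finite_m)
  show "algebra (space m) \<D>" by (rule \<D>_algebra)
  show "\<D> \<subseteq> sets m" using \<D>_sets by auto
  interpret alg: algebra "space m" \<D> by (rule \<D>_algebra)
  show \<theta>_\<D>: "\<theta> q A \<in> \<D>" if q: "0 < q" and A: "A \<in> \<D>" for q A
  proof (rule \<D>I)
    show "\<theta> q A \<in> sets M" by (intro \<theta>_sets q \<D>_sets A)
    fix p :: rat assume p: "0 < p"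
    have "AE x in m. T (of_rat p) (indicator (\<theta> q A)) x = indicator (\<theta> (p + q) A) x"
      using \<theta>_compose[OF p q A] \<D>_AE[OF A, of "p + q"] p q by auto
    then show "\<exists>B\<subseteq>space M. AE x in m. T (of_rat p) (indicator (\<theta> q A)) x = indicator B x"
      by (intro exI[of _ "\<theta> (p + q) A"] conjI \<theta>_subset)
  qed
  show \<theta>_Int: "measure m (\<theta> q A \<inter> \<theta> q B) = measure m (A \<inter> B)"
    if q: "0 < q" and A: "A \<in> \<D>" and B: "B \<in> \<D>" for q A B
  proof -
    have s: "A \<in> sets M" "B \<in> sets M" "\<theta> q A \<in> sets M" "\<theta> q B \<in> sets M"
      using A B q by (auto intro: \<D>_sets \<theta>_sets)
    have "measure m (\<theta> q A \<union> \<theta> q B) = measure m (A \<union> B)"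
      by (rule measure_\<theta>[OF _ _ q T_indicator_Un[OF q A B]]) (use s in auto)
    moreover have "measure m (\<theta> q A) = measure m A" "measure m (\<theta> q B) = measure m B"
      by (rule measure_\<theta>[OF _ _ q \<D>_AE[OF _ q]]; use s A B in auto)+
    ultimately show ?thesis
      using measure_Un3[of A m B] measure_Un3[of "\<theta> q A" m "\<theta> q B"] s
      by (simp add: m.fmeasurable_eq_sets)
  qed
  show "measure m (X \<inter> \<theta> (p + q) A) = measure m (X \<inter> \<theta> p (\<theta> q A))"
    if p: "0 < p" and q: "0 < q" and A: "A \<in> \<D>" and X: "X \<in> \<D>" for p q A X
  proof (rule measure_eqI_indicator)
    show "X \<inter> \<theta> (p + q) A \<in> sets M" "X \<inter> \<theta> p (\<theta> q A) \<in> sets M"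
      using p q A X by (auto intro!: sets.Int \<D>_sets \<theta>_\<D>)
    have pq: "0 < p + q" using p q by simp
    show "AE x in m. indicator (X \<inter> \<theta> (p + q) A) x = (indicator (X \<inter> \<theta> p (\<theta> q A)) x :: real)"
      using \<theta>_compose[OF p q A] \<D>_AE[OF A pq] \<D>_AE[OF \<theta>_\<D>[OF q A] p]
      by eventually_elim (simp add: indicator_inter_arith)
  qed
  show "\<exists>i j. i < j \<and> measure m (sym_diff (F i) (F j)) < e"
    if F: "\<And>n::nat. F n \<in> \<D>" and e: "0 < e" for F e
  proof -
    obtain k :: nat where k: "t\<^sub>0 < real k" using reals_Archimedean2 by blast
    define q :: rat where "q = of_nat k"
    have q: "0 < q" "t\<^sub>0 < of_rat q" using k t0_pos by (auto simp: q_def)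
    have s: "F n \<in> sets M" "\<theta> q (F n) \<in> sets M" for n using F q by (auto intro: \<D>_sets \<theta>_sets)
    have ind_bd: "indicator (F n) \<in> borel_measurable M" "AE x in M. \<bar>indicator (F n) x :: real\<bar> \<le> 1" for n
      using s by (auto simp: indicator_def)
    have "\<exists>r g. strict_mono r \<and> integrable M g \<and>
        (\<lambda>n. dist1 M (T (of_rat q) (indicator (F (r n)))) g) \<longlonglongrightarrow> 0"
      by (rule T_compact[OF q(2) ind_bd])
    then obtain r g where r: "strict_mono (r :: nat \<Rightarrow> nat)" and g: "integrable M g"
      and lim: "(\<lambda>n. dist1 M (T (of_rat q) (indicator (F (r n)))) g) \<longlonglongrightarrow> 0"
      by (elim exE conjE)
    define e' where "e' = e / (2 * C)"
    have "0 < e'" using e C_ge by (simp add: e'_def)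
    then obtain n where n: "\<And>i. i \<ge> n \<Longrightarrow> dist1 M (T (of_rat q) (indicator (F (r i)))) g < e'"
      using order_tendstoD(2)[OF lim] unfolding eventually_sequentially by blast
    define i where "i = r n"
    define j where "j = r (Suc n)"
    have ij: "i < j" using r by (simp add: i_def j_def strict_mono_def)
    have int: "integrable M (T (of_rat q) (indicator (F k)))" for k
      by (intro T_int rat_time q ess_bounded_int ess_bounded_ind s)
    let ?D = "\<lambda>x. T (of_rat q) (indicator (F i)) x - T (of_rat q) (indicator (F j)) x"
    have "norm1 M ?D \<le> dist1 M (T (of_rat q) (indicator (F i))) g + dist1 M g (T (of_rat q) (indicator (F j)))"
      by (rule norm1_triangle[OF int g int])
    also have "\<dots> < e' + e'"
      using n[of n] n[of "Suc n"] unfolding norm1_commute[of M g] i_def j_def by (intro add_strict_mono) auto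
    finally have *: "norm1 M ?D < 2 * e'" by simp
    have "measure m (sym_diff (F i) (F j)) = measure m (sym_diff (\<theta> q (F i)) (\<theta> q (F j)))"
    proof -
      have "measure m (sym_diff A B) = measure m A + measure m B - 2 * measure m (A \<inter> B)"
        if "A \<in> sets M" "B \<in> sets M" for A B
        using m.measure_sym_diff[of A B] that by simp
      then show ?thesis
        using \<theta>_Int[OF q(1) F F, of i j] \<theta>_Int[OF q(1) F F, of i i] \<theta>_Int[OF q(1) F F, of j j] s by simp
    qed
    also have "\<dots> = dist1 m (indicator (\<theta> q (F i))) (indicator (\<theta> q (F j)))"
      using s by (intro norm1_m_indicator_diff[symmetric])
    also have "\<dots> = norm1 m ?D"
    proof (rule norm1_cong_AE)
      show "AE x in m. indicator (\<theta> q (F i)) x - indicator (\<theta> q (F j)) x = ?D x"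
        using \<D>_AE[OF F q(1), of i] \<D>_AE[OF F q(1), of j] by eventually_elim simp
    qed (use s int in simp_all)
    also have "\<dots> \<le> C * norm1 M ?D" by (intro norm1_m_le Bochner_Integration.integrable_diff int)
    also have "\<dots> < C * (2 * e')" using * C_ge by (intro mult_strict_left_mono) auto
    also have "\<dots> = e" using C_ge by (simp add: e'_def)
    finally show ?thesis using ij by blast
  qed
qed

lemma T_contract_const:
  assumes q: "q \<in> \<rat>" "0 < q" and f: "ess_bounded f"
  shows "norm1 m (\<lambda>x. T q f x - c) \<le> norm1 m (\<lambda>x. f x - c)"
proof -
  have "norm1 m (\<lambda>x. T q f x - c) = dist1 m (T q f) (T q (\<lambda>_. c))"
  proof (rule norm1_cong_AE)
    have "AE x in m. T q (\<lambda>_. c) x = c" by (rule AE_mI[OF T_const[OF q(2)]])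
    then show "AE x in m. T q f x - c = T q f x - T q (\<lambda>_. c) x"
    proof eventually_elim
      case (elim x)
      show ?case unfolding elim ..
    qed
    have [measurable]: "T q f \<in> borel_measurable M" "T q (\<lambda>_. c) \<in> borel_measurable M"
      by (intro ess_bounded_meas ess_bounded_T q f ess_bounded_const)+
    show "(\<lambda>x. T q f x - c) \<in> borel_measurable m" "(\<lambda>x. T q f x - T q (\<lambda>_. c) x) \<in> borel_measurable m"
      unfolding borel_m by measurable
  qed
  also have "\<dots> \<le> norm1 m (\<lambda>x. f x - c)"
    by (rule T_contract_diff[OF q f ess_bounded_const])
  finally show ?thesis .
qed

lemma norm1_m_tendsto:
  assumes u: "\<And>n. integrable M (u n)" "integrable M g"
    and lim: "(\<lambda>n. dist1 M (u n) g) \<longlonglongrightarrow> 0"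
  shows "(\<lambda>n. norm1 m (\<lambda>x. u n x - c)) \<longlonglongrightarrow> norm1 m (\<lambda>x. g x - c)"
proof (rule LIM_zero_cancel, rule Lim_null_comparison)
  have ui: "integrable m (u n)" "integrable m g" "integrable m (\<lambda>_. c)" for n
    by (intro integrable_m u const_int)+
  show "\<forall>\<^sub>F n in sequentially. norm (norm1 m (\<lambda>x. u n x - c) - norm1 m (\<lambda>x. g x - c)) \<le> C * dist1 M (u n) g"
  proof (intro always_eventually allI)
    fix n
    have "dist1 m (u n) g \<le> C * dist1 M (u n) g"
      by (intro norm1_m_le Bochner_Integration.integrable_diff u)
    then show "norm (norm1 m (\<lambda>x. u n x - c) - norm1 m (\<lambda>x. g x - c)) \<le> C * dist1 M (u n) g"
      using norm1_triangle[OF ui(1,2,3), of n] norm1_triangle[OF ui(2,1,3), of n] norm1_commute[of m g "u n"]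
      unfolding real_norm_def by linarith
  qed
  show "(\<lambda>n. C * dist1 M (u n) g) \<longlonglongrightarrow> 0"
    by (rule tendsto_mult_right_zero[OF lim])
qed

text \<open>
  The distances from \<open>T n f\<close> to \<open>c\<close> decrease, to the distance of any limit point. Since \<open>T q (T n f)\<close> is
  followed by a later member of the integer orbit, its distance to \<open>c\<close> is bounded below by that limit.
\<close>

lemma limit_isometric:
  assumes f: "ess_bounded f" and g: "ess_bounded g" and r: "strict_mono r"
    and lim: "(\<lambda>n. dist1 M (T (real (Suc (r n))) f) g) \<longlonglongrightarrow> 0"
    and q: "q \<in> \<rat>" "0 < q"
  shows "norm1 m (\<lambda>x. g x - c) \<le> norm1 m (\<lambda>x. T q g x - c)"
proof -
  define a where "a n = T (real (Suc n)) f" for n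
  have a: "ess_bounded (a n)" for n unfolding a_def by (rule ess_bounded_T[OF _ f]) simp
  have a_shift: "T t (a n) = T (t + real (Suc n)) f" if "0 < t" for t n
    unfolding a_def by (rule T_semigroup[OF that _ ess_bounded_int[OF f]]) simp
  define I where "I n = norm1 m (\<lambda>x. a n x - c)" for n
  have lim_a: "(\<lambda>n. dist1 M (a (r n)) g) \<longlonglongrightarrow> 0" using lim by (simp add: a_def)
  have "I (Suc n) \<le> I n" for n
  proof -
    have "a (Suc n) = T 1 (a n)" by (simp add: a_shift) (simp add: a_def add.commute)
    then show ?thesis unfolding I_def using T_contract_const[OF _ _ a, of 1] by simp
  qed
  then have dec: "decseq I" by (rule decseq_SucI)
  have I_lim: "(\<lambda>n. I (r n)) \<longlonglongrightarrow> norm1 m (\<lambda>x. g x - c)"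
    unfolding I_def by (rule norm1_m_tendsto[OF ess_bounded_int[OF a] ess_bounded_int[OF g] lim_a])
  have L: "norm1 m (\<lambda>x. g x - c) \<le> I n" for n
  proof (rule LIMSEQ_le_const2[OF I_lim])
    have "I (r k) \<le> I n" if "k \<ge> n" for k
      using decseqD[OF dec, of n "r k"] seq_suble[OF r, of k] that by simp
    then show "\<exists>N. \<forall>k\<ge>N. I (r k) \<le> I n" by blast
  qed
  obtain k :: nat where k: "q < real k" using reals_Archimedean2 by blast
  have kq: "real k - q \<in> \<rat>" "0 < real k - q" using k q(1) by auto
  have "norm1 m (\<lambda>x. g x - c) \<le> norm1 m (\<lambda>x. T q (a (r n)) x - c)" for n
  proof -
    have "T (real k - q) (T q (a (r n))) = a (r n + k)"
      using T_semigroup[OF kq(2) q(2) ess_bounded_int[OF a], of "r n"] a_shift[of "real k" "r n"] k q(2)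
      by (simp add: a_def add_ac)
    then have "I (r n + k) \<le> norm1 m (\<lambda>x. T q (a (r n)) x - c)"
      unfolding I_def using T_contract_const[OF kq ess_bounded_T[OF q(2) a[of "r n"]], where c=c] by simp
    with L[of "r n + k"] show ?thesis by simp
  qed
  then show ?thesis
    by (intro LIMSEQ_le_const[OF norm1_m_tendsto[OF T_int[OF q(2) ess_bounded_int[OF a]] T_int[OF q(2) ess_bounded_int[OF g]]
            T_tendsto[OF q(2) ess_bounded_int[OF a] ess_bounded_int[OF g] lim_a]]]) blast
qed

text \<open>
  \<open>\<bar>T g - c\<bar> \<le> T \<bar>g - c\<bar>\<close> by positivity and \<open>T c = c\<close>, and the two sides have the same integral.
\<close>

lemma T_abs_eq:
  assumes g: "ess_bounded g" and q: "q \<in> \<rat>" "0 < q"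
    and iso: "norm1 m (\<lambda>x. g x - c) \<le> norm1 m (\<lambda>x. T q g x - c)"
  shows "AE x in m. T q (\<lambda>x. \<bar>g x - c\<bar>) x = \<bar>T q g x - c\<bar>"
proof -
  have gc: "ess_bounded (\<lambda>x. g x - c)" "ess_bounded (\<lambda>x. \<bar>g x - c\<bar>)" by (intro ess_bounded_abs ess_bounded_diff g ess_bounded_const)+
  have int: "integrable M (T q (\<lambda>x. \<bar>g x - c\<bar>))" "integrable M (\<lambda>x. T q g x - c)"
    by (intro ess_bounded_int ess_bounded_T q gc ess_bounded_diff g ess_bounded_const)+
  have le: "AE x in m. 0 \<le> T q (\<lambda>x. \<bar>g x - c\<bar>) x - \<bar>T q g x - c\<bar>"
    using AE_mI[OF T_abs[OF q(2) ess_bounded_int[OF gc(1)]]] AE_mI[OF T_diff[OF q(2) ess_bounded_int[OF g] const_int, of c]]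
      AE_mI[OF T_const[OF q(2), of c]]
    by eventually_elim simp
  have int_m: "integrable m (\<lambda>x. T q (\<lambda>x. \<bar>g x - c\<bar>) x - \<bar>T q g x - c\<bar>)"
    by (intro integrable_m Bochner_Integration.integrable_diff integrable_abs int)
  have "(\<integral>x. T q (\<lambda>x. \<bar>g x - c\<bar>) x \<partial>m) = norm1 m (\<lambda>x. g x - c)"
    unfolding norm1_def by (rule m_inv[OF q gc(2)])
  then have "(\<integral>x. T q (\<lambda>x. \<bar>g x - c\<bar>) x - \<bar>T q g x - c\<bar> \<partial>m) \<le> 0"
    using iso integrable_m[OF int(1)] integrable_m[OF integrable_abs[OF int(2)]]
    by (simp add: norm1_def)
  moreover have "0 \<le> (\<integral>x. T q (\<lambda>x. \<bar>g x - c\<bar>) x - \<bar>T q g x - c\<bar> \<partial>m)"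
    by (rule integral_nonneg_AE[OF le])
  ultimately have "(\<integral>x. T q (\<lambda>x. \<bar>g x - c\<bar>) x - \<bar>T q g x - c\<bar> \<partial>m) = 0" by simp
  then have "AE x in m. T q (\<lambda>x. \<bar>g x - c\<bar>) x - \<bar>T q g x - c\<bar> = 0"
    using integral_nonneg_eq_0_iff_AE[OF int_m le] by simp
  then show ?thesis by auto
qed

text \<open>
  By \<open>T_abs_eq\<close> the operator commutes with all ramps; let their slopes tend to infinity.
\<close>

lemma T_level_set:
  assumes g: "ess_bounded g" and q: "q \<in> \<rat>" "0 < q"
    and iso: "\<And>c. norm1 m (\<lambda>x. g x - c) \<le> norm1 m (\<lambda>x. T q g x - c)"
  shows "AE x in m. T q (indicator {x \<in> space M. c < g x}) x = indicator {x \<in> space M. c < T q g x} x"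
proof -
  have Tg: "ess_bounded (T q g)" by (rule ess_bounded_T[OF q(2) g])
  have [measurable]: "g \<in> borel_measurable M" "T q g \<in> borel_measurable M"
    using g Tg by (auto simp: ess_bounded_def)
  define A where "A = {x \<in> space M. c < g x}"
  define B where "B = {x \<in> space M. c < T q g x}"
  have A: "A \<in> sets M" and B: "B \<in> sets M" unfolding A_def B_def by measurable
  have ramp_bdd: "ess_bounded (\<lambda>x. ramp k c (u x))" if "u \<in> borel_measurable M" for k u
    using that by (intro ess_boundedI[where c=1]) (auto simp: ramp_bound)
  have Tramp: "AE x in m. T q (\<lambda>x. ramp k c (g x)) x = ramp k c (T q g x)" for k
  proof -
    define d where "d = c + 1 / real (Suc k)"
    let ?K = "real (Suc k) / 2"
    let ?v = "\<lambda>x. ?K * \<bar>g x - c\<bar> + (- ?K) * \<bar>g x - d\<bar>"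
    have b: "ess_bounded (\<lambda>x. \<bar>g x - c\<bar>)" "ess_bounded (\<lambda>x. \<bar>g x - d\<bar>)" by (intro ess_bounded_abs ess_bounded_diff g ess_bounded_const)+
    have eq: "(\<lambda>x. ramp k c (g x)) = (\<lambda>x. 1 * ?v x + (1 / 2) * 1)"
      by (simp add: ramp_def d_def algebra_simps)
    have 1: "AE x in M. T q (\<lambda>x. ramp k c (g x)) x = 1 * T q ?v x + (1 / 2) * T q (\<lambda>_. 1) x"
      unfolding eq by (rule T_lin[OF q(2) ess_bounded_int[OF ess_bounded_lin[OF b]] const_int])
    have 2: "AE x in M. T q ?v x = ?K * T q (\<lambda>x. \<bar>g x - c\<bar>) x + (- ?K) * T q (\<lambda>x. \<bar>g x - d\<bar>) x"
      by (rule T_lin[OF q(2) ess_bounded_int[OF b(1)] ess_bounded_int[OF b(2)]])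
    show ?thesis
      using AE_mI[OF 1] AE_mI[OF 2] AE_mI[OF T_one[OF q(2)]] T_abs_eq[OF g q iso[of c]] T_abs_eq[OF g q iso[of d]]
      by eventually_elim (simp add: ramp_def d_def algebra_simps)
  qed
  have lim1: "(\<lambda>k. dist1 m (T q (\<lambda>x. ramp k c (g x))) (T q (indicator A))) \<longlonglongrightarrow> 0"
  proof (rule Lim_null_comparison)
    have int: "integrable M (T q (\<lambda>x. ramp k c (g x)))" "integrable M (T q (indicator A))" for k
      by (intro ess_bounded_int ess_bounded_T q ramp_bdd ess_bounded_ind A; simp)+
    show "\<forall>\<^sub>F k in sequentially. norm (dist1 m (T q (\<lambda>x. ramp k c (g x))) (T q (indicator A)))
        \<le> C * dist1 M (T q (\<lambda>x. ramp k c (g x))) (T q (indicator A))"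
      using norm1_m_le[OF Bochner_Integration.integrable_diff[OF int]] by simp
    show "(\<lambda>k. C * dist1 M (T q (\<lambda>x. ramp k c (g x))) (T q (indicator A))) \<longlonglongrightarrow> 0"
      by (intro tendsto_mult_right_zero T_tendsto q ess_bounded_int ramp_bdd ess_bounded_ind A)
        (use ramp_tendsto[of g c] in \<open>simp_all add: A_def\<close>)
  qed
  have lim2: "(\<lambda>k. dist1 m (T q (\<lambda>x. ramp k c (g x))) (indicator B)) \<longlonglongrightarrow> 0"
  proof -
    have "dist1 m (T q (\<lambda>x. ramp k c (g x))) (indicator B) = norm1 m (\<lambda>x. ramp k c (T q g x) - indicator B x)" for k
    proof (rule norm1_cong_AE)
      show "AE x in m. T q (\<lambda>x. ramp k c (g x)) x - indicator B x = ramp k c (T q g x) - indicator B x"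
        using Tramp[of k] by eventually_elim simp
      show "(\<lambda>x. T q (\<lambda>x. ramp k c (g x)) x - indicator B x) \<in> borel_measurable m"
        using ess_bounded_meas[OF ess_bounded_T[OF q(2) ramp_bdd[of g k]]] B by simp
    qed (use B in simp)
    then show ?thesis using m.ramp_tendsto[of "T q g" c] by (simp add: B_def)
  qed
  have "AE x in m. T q (indicator A) x = indicator B x"
    by (rule norm1_limit_unique[OF _ _ _ lim1 lim2])
      (intro integrable_m ess_bounded_int ess_bounded_T q ramp_bdd ess_bounded_ind A B; simp)+
  then show ?thesis by (simp add: A_def B_def)
qed

text \<open>
  The level sets of \<open>g\<close> belong to the algebra, so the flow fixes them, and a function is determined by
  its rational level sets.
\<close>

lemma limit_fixed_m:
  assumes f: "ess_bounded f" and g: "ess_bounded g" and r: "strict_mono r"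
    and lim: "(\<lambda>n. dist1 M (T (real (Suc (r n))) f) g) \<longlonglongrightarrow> 0"
  shows "AE x in m. T 1 g x = g x"
proof -
  interpret flow: divisible_flow m \<D> \<theta> by (rule flow)
  have [measurable]: "g \<in> borel_measurable M" using g by (simp add: ess_bounded_def)
  have level: "AE x in m. T (of_rat q) (indicator {x \<in> space M. c < g x}) x = indicator {x \<in> space M. c < T (of_rat q) g x} x"
    if "0 < q" for q c
    by (rule T_level_set[OF g rat_time(1) rat_time(2)[OF that]])
      (rule limit_isometric[OF f g r lim rat_time(1) rat_time(2)[OF that]])
  have "AE x in m. c < g x \<longleftrightarrow> c < T 1 g x" for c
  proof -
    define A where "A = {x \<in> space M. c < g x}"
    have A: "A \<in> \<D>"
      unfolding A_def
    proof (rule \<D>I)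
      show "{x \<in> space M. c < g x} \<in> sets M" by measurable
      fix q :: rat assume "0 < q"
      from level[OF this, of c]
      show "\<exists>B\<subseteq>space M. AE x in m. T (of_rat q) (indicator {x \<in> space M. c < g x}) x = indicator B x"
        by (intro exI[of _ "{x \<in> space M. c < T (of_rat q) g x}"]) simp
    qed
    have A': "A \<in> sets M" "\<theta> 1 A \<in> sets M" using A by (auto intro: \<D>_sets \<theta>_sets)
    have "emeasure m (sym_diff A (\<theta> 1 A)) = 0"
      using flow.flow_trivial[OF A] by (simp add: m.emeasure_eq_measure)
    then have "AE x in m. x \<notin> sym_diff A (\<theta> 1 A)"
      using A' by (intro AE_not_in) (auto simp: null_sets_def)
    moreover have "AE x in m. T 1 (indicator A) x = indicator {x \<in> space M. c < T 1 g x} x"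
      using level[of 1 c] by (simp add: A_def)
    moreover have "AE x in m. T 1 (indicator A) x = indicator (\<theta> 1 A) x"
      using \<D>_AE[OF A, of 1] by simp
    moreover have "AE x in m. x \<in> space M" using AE_space[of m] by simp
    ultimately show ?thesis
      by eventually_elim (auto simp: A_def indicator_def split: if_splits)
  qed
  then have "AE x in m. \<forall>c::rat. of_rat c < g x \<longleftrightarrow> of_rat c < T 1 g x"
    unfolding AE_all_countable by blast
  then show ?thesis
  proof eventually_elim
    case (elim x)
    then show ?case
      using of_rat_dense[of "g x" "T 1 g x"] of_rat_dense[of "T 1 g x" "g x"]
      by (metis less_asym linorder_neqE_linordered_idom)
  qed
qed

end

section \<open>Convergence of orbits\<close>

context L1_semigroup
begin

lemma T_fixed_multiples:
  assumes s: "0 < s" and g: "integrable M g" and fixed: "AE x in M. T s g x = g x"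
  shows "AE x in M. T (real (Suc n) * s) g x = g x"
proof (induction n)
  case 0
  then show ?case using fixed by simp
next
  case (Suc n)
  have pos: "0 < real (Suc n) * s" using s by simp
  have "real (Suc n) * s + s = real (Suc (Suc n)) * s" by (simp add: algebra_simps)
  then have "T (real (Suc n) * s) (T s g) = T (real (Suc (Suc n)) * s) g"
    using T_semigroup[OF pos s g] by simp
  moreover have "AE x in M. T (real (Suc n) * s) (T s g) x = T (real (Suc n) * s) g x"
    by (rule T_cong[OF pos T_int[OF s g] g fixed])
  ultimately show ?case using Suc by auto
qed

lemma norm1_T_diff_fixed:
  assumes t: "0 < t" and f: "integrable M f" and g: "integrable M g" and fixed: "AE x in M. T t g x = g x"
  shows "dist1 M (T t f) g \<le> C * dist1 M f g"
proof -
  have [measurable]: "T t f \<in> borel_measurable M" "T t g \<in> borel_measurable M" "g \<in> borel_measurable M"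
    by (intro borel_measurable_integrable T_int t f g)+
  have "dist1 M (T t f) g = dist1 M (T t f) (T t g)"
    by (rule norm1_cong_AE) (use fixed in auto)
  also have "\<dots> \<le> C * dist1 M f g" by (rule norm1_T_diff[OF t f g])
  finally show ?thesis .
qed

lemma fixed_if_orbit_slow:
  assumes s: "0 < s" and a: "\<And>n. integrable M (a n)" and g: "integrable M g"
    and lim: "(\<lambda>n. dist1 M (a n) g) \<longlonglongrightarrow> 0"
    and slow: "(\<lambda>n. dist1 M (T s (a n)) (a n)) \<longlonglongrightarrow> 0"
  shows "AE x in M. T s g x = g x"
proof (rule norm1_limit_unique)
  show "integrable M (T s (a n))" for n by (rule T_int[OF s a])
  show "integrable M (T s g)" "integrable M g" by (intro T_int s g)+
  show "(\<lambda>n. dist1 M (T s (a n)) (T s g)) \<longlonglongrightarrow> 0"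
    by (rule T_tendsto[OF s a g lim])
  show "(\<lambda>n. dist1 M (T s (a n)) g) \<longlonglongrightarrow> 0"
  proof (rule Lim_null_comparison)
    show "\<forall>\<^sub>F n in sequentially. norm (dist1 M (T s (a n)) g) \<le>
        dist1 M (T s (a n)) (a n) + dist1 M (a n) g"
      using norm1_triangle[OF T_int[OF s a] a g] by (intro always_eventually allI) simp
    show "(\<lambda>n. dist1 M (T s (a n)) (a n) + dist1 M (a n) g) \<longlonglongrightarrow> 0"
      using tendsto_add[OF slow lim] by simp
  qed
qed

text \<open>
  Let \<open>g\<close> be a limit point of the orbit. The function \<open>h = T 1 g - g\<close> is known to vanish where \<open>\<phi> > 0\<close>,
  so \<open>T t h\<close> tends to \<open>0\<close>. Since consecutive members of the orbit near \<open>g\<close> differ by about \<open>h\<close>, the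
  increments of the orbit tend to \<open>0\<close>; hence \<open>T 1 g = g\<close>, and a fixed limit point is the limit.
\<close>

lemma converges_along_integers:
  assumes f: "integrable M f" and f_bd: "AE x in M. \<bar>f x\<bar> \<le> 1"
  shows "\<exists>g. integrable M g \<and> (AE x in M. \<bar>g x\<bar> \<le> 1) \<and> (AE x in M. T 1 g x = g x) \<and>
    (\<lambda>n. dist1 M (T (real (Suc n)) f) g) \<longlonglongrightarrow> 0"
proof -
  define a where "a n = T (real (Suc n)) f" for n
  have a: "integrable M (a n)" for n unfolding a_def by (rule T_int[OF _ f]) simp
  have [measurable]: "a n \<in> borel_measurable M" for n by (rule borel_measurable_integrable[OF a])
  have a_bd: "AE x in M. \<bar>a n x\<bar> \<le> 1" for n unfolding a_def by (rule T_bound[OF _ f f_bd]) simp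
  have a_shift: "T t (a n) = T (t + real (Suc n)) f" if "0 < t" for t n
    unfolding a_def by (rule T_semigroup[OF that _ f]) simp
  have ess_bounded_f: "ess_bounded f" unfolding ess_bounded_def using f f_bd by auto
  obtain k :: nat where k: "t\<^sub>0 < real k" using reals_Archimedean2 by blast
  have "\<exists>r g. strict_mono r \<and> integrable M g \<and> (\<lambda>n. dist1 M (T (real k) (a (r n))) g) \<longlonglongrightarrow> 0"
    by (rule T_compact[OF k _ a_bd]) simp
  then obtain r g0 where r: "strict_mono (r :: nat \<Rightarrow> nat)" and g0: "integrable M g0"
    and lim0: "(\<lambda>n. dist1 M (T (real k) (a (r n))) g0) \<longlonglongrightarrow> 0"
    by (elim exE conjE)
  \<comment> \<open>compactness was applied after the extra time \<open>k > t\<^sub>0\<close>, which is absorbed in the index\<close>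
  define r' where "r' n = r n + k" for n
  have r': "strict_mono r'" using r by (simp add: r'_def strict_mono_def)
  have ak: "T (real k) (a (r n)) = a (r' n)" for n
    using a_shift[of "real k" "r n"] k t0_pos by (simp add: r'_def a_def add_ac)
  define g where "g x = clip 1 (g0 x)" for x
  have [measurable]: "g0 \<in> borel_measurable M" using g0 by simp
  have g_meas [measurable]: "g \<in> borel_measurable M" unfolding g_def by measurable
  have g_bd: "\<bar>g x\<bar> \<le> 1" for x by (simp add: g_def clip_bound)
  have ess_bounded_g: "ess_bounded g" using g_bd by (intro ess_boundedI[where c=1]) auto
  have g: "integrable M g" by (rule ess_bounded_int[OF ess_bounded_g])
  have lim: "(\<lambda>n. dist1 M (a (r' n)) g) \<longlonglongrightarrow> 0"
  proof (rule Lim_null_comparison[OF _ lim0], intro always_eventually allI)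
    fix n
    have "AE x in M. \<bar>a (r' n) x - g x\<bar> \<le> \<bar>a (r' n) x - g0 x\<bar>"
      using a_bd[of "r' n"] by eventually_elim (simp add: g_def clip_closer)
    then have "dist1 M (a (r' n)) g \<le> dist1 M (a (r' n)) g0"
      by (intro norm1_mono_AE Bochner_Integration.integrable_diff a g g0)
    then show "norm (dist1 M (a (r' n)) g) \<le> dist1 M (T (real k) (a (r n))) g0"
      by (simp add: ak)
  qed
  obtain \<phi> where \<phi>: "\<phi> \<in> borel_measurable M" "\<forall>x. 0 \<le> \<phi> x \<and> \<phi> x \<le> C"
    "\<forall>q\<in>\<rat>. 0 < q \<longrightarrow> (\<forall>f. integrable M f \<longrightarrow> (AE x in M. \<bar>f x\<bar> \<le> 1) \<longrightarrow>
      (\<integral>x. T q f x * \<phi> x \<partial>M) = (\<integral>x. f x * \<phi> x \<partial>M))"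
    "\<forall>e>0. \<exists>t\<^sub>1. \<forall>t>t\<^sub>1. norm1 M (T t (indicator {x \<in> space M. \<phi> x = 0})) < e"
    using exists_invariant_density by (elim exE conjE)
  interpret inv: L1_semigroup_invariant M T w p C t\<^sub>0 \<phi>
    by unfold_locales (use \<phi> in auto)
  define h where "h x = T 1 g x - g x" for x
  have T1g: "integrable M (T 1 g)" by (rule T_int[OF _ g]) simp
  have h: "integrable M h" unfolding h_def using g T1g by simp
  define A where "A = {x \<in> space M. \<phi> x = 0}"
  have A: "A \<in> sets M" unfolding A_def by measurable
  have ind: "integrable M (indicator A :: _ \<Rightarrow> real)" by (rule ess_bounded_int[OF ess_bounded_ind[OF A]])
  have h_le: "AE x in M. \<bar>h x\<bar> \<le> 2 * indicator A x"
  proof -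
    have "AE x in inv.m. T 1 g x = g x"
      by (rule inv.limit_fixed_m[OF ess_bounded_f ess_bounded_g r']) (use lim in \<open>simp add: a_def\<close>)
    then have 1: "AE x in M. 0 < \<phi> x \<longrightarrow> T 1 g x = g x" unfolding inv.AE_m .
    have 2: "AE x in M. \<bar>T 1 g x\<bar> \<le> 1" by (rule T_bound[OF _ g]) (use g_bd in auto)
    show ?thesis using 1 2 AE_space
    proof eventually_elim
      case (elim x)
      show ?case
      proof (cases "\<phi> x = 0")
        case True
        then show ?thesis using elim g_bd[of x] unfolding h_def A_def by (auto simp: indicator_def)
      next
        case False
        then have "0 < \<phi> x" using \<phi>(2) by (simp add: less_le)
        then show ?thesis using elim by (simp add: h_def)
      qed
    qed
  qed
  have Th: "norm1 M (T t h) \<le> 2 * norm1 M (T t (indicator A))" if t: "0 < t" for t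
  proof -
    have "AE x in M. T t (\<lambda>x. \<bar>h x\<bar>) x \<le> T t (\<lambda>x. 2 * indicator A x) x"
      by (rule T_mono[OF t _ _ h_le]) (use h ind in simp_all)
    then have le: "AE x in M. \<bar>T t h x\<bar> \<le> \<bar>2 * T t (indicator A) x\<bar>"
      using T_abs[OF t h] T_scale[OF t ind, of 2] by eventually_elim linarith
    have "norm1 M (T t h) \<le> norm1 M (\<lambda>x. 2 * T t (indicator A) x)"
      by (rule norm1_mono_AE[OF T_int[OF t h] _ le]) (intro integrable_mult_right T_int t ind)
    then show ?thesis by (simp add: norm1_def abs_mult)
  qed
  have slow: "(\<lambda>n. dist1 M (a (Suc n)) (a n)) \<longlonglongrightarrow> 0"
  proof (rule LIMSEQ_I)
    fix e :: real assume e: "0 < e"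
    define e' where "e' = e / (2 * (C * (C + 1)))"
    have "0 < e'" using e C_ge by (simp add: e'_def)
    then obtain j where "dist1 M (a (r' j)) g < e'"
      using order_tendstoD(2)[OF lim] unfolding eventually_sequentially by blast
    moreover define i where "i = r' j"
    ultimately have i: "dist1 M (a i) g < e'" by simp
    have "0 < e / 4" using e by simp
    then obtain t1 where t1: "\<And>t. t > t1 \<Longrightarrow> norm1 M (T t (indicator A)) < e / 4"
      using inv.\<phi>_zero unfolding A_def by blast
    obtain n1 :: nat where n1: "t1 < real n1" using reals_Archimedean2 by blast
    have "dist1 M (a (Suc n)) (a n) < e" if n: "n \<ge> n1 + i + 1" for n
    proof -
      define t where "t = real (n - i)"
      have t: "0 < t" "t1 < t" using n n1 by (auto simp: t_def)
      have T1a: "integrable M (T 1 (a i))" by (rule T_int[OF _ a]) simp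
      have "1 + real (Suc i) + t = real (Suc (Suc n))" using n by (simp add: t_def)
      then have "a (Suc n) = T t (T 1 (a i))"
        using T_semigroup[OF t(1) _ a, of 1 i] a_shift[of "t + 1" i] t by (simp add: a_def algebra_simps)
      moreover have "a n = T t (a i)"
      proof -
        have "t + real (Suc i) = real (Suc n)" using n by (simp add: t_def)
        then show ?thesis using a_shift[OF t(1), of i] by (simp only: a_def)
      qed
      ultimately have "dist1 M (a (Suc n)) (a n) = dist1 M (T t (T 1 (a i))) (T t (a i))"
        by simp
      also have "\<dots> = norm1 M (T t (\<lambda>x. T 1 (a i) x - a i x))"
      proof (rule norm1_cong_AE)
        show "AE x in M. T t (T 1 (a i)) x - T t (a i) x = T t (\<lambda>x. T 1 (a i) x - a i x) x"
          using T_diff[OF t(1) T1a a[of i]] by eventually_elim simp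
        show "(\<lambda>x. T t (T 1 (a i)) x - T t (a i) x) \<in> borel_measurable M"
          by (intro borel_measurable_integrable Bochner_Integration.integrable_diff T_int t T1a a)
        show "T t (\<lambda>x. T 1 (a i) x - a i x) \<in> borel_measurable M"
          by (intro borel_measurable_integrable Bochner_Integration.integrable_diff T_int t T1a a)
      qed
      also have "\<dots> \<le> dist1 M (T t (\<lambda>x. T 1 (a i) x - a i x)) (T t h) + norm1 M (T t h)"
      proof -
        have b: "integrable M (T t (\<lambda>x. T 1 (a i) x - a i x))" "integrable M (T t h)"
          by (intro T_int t Bochner_Integration.integrable_diff T1a a h)+
        show ?thesis using norm1_triangle[OF b const_int[of 0]] by simp
      qed
      also have "dist1 M (T t (\<lambda>x. T 1 (a i) x - a i x)) (T t h) \<le> e / 2"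
      proof -
        have "dist1 M (T t (\<lambda>x. T 1 (a i) x - a i x)) (T t h) \<le> C * norm1 M (\<lambda>x. (T 1 (a i) x - a i x) - h x)"
          by (rule norm1_T_diff[OF t(1) Bochner_Integration.integrable_diff[OF T1a a] h])
        also have "norm1 M (\<lambda>x. (T 1 (a i) x - a i x) - h x) = norm1 M (\<lambda>x. (T 1 (a i) x - T 1 g x) + (g x - a i x))"
          by (simp add: h_def algebra_simps)
        also have "\<dots> \<le> dist1 M (T 1 (a i)) (T 1 g) + dist1 M g (a i)"
          by (intro norm1_add_le Bochner_Integration.integrable_diff T1a T1g g a)
        also have "\<dots> \<le> C * dist1 M (a i) g + dist1 M (a i) g"
          using norm1_T_diff[OF _ a[of i] g, of 1] norm1_commute[of M g "a i"] by simp
        also have "\<dots> = (C + 1) * dist1 M (a i) g" by (simp add: algebra_simps)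
        also have "\<dots> \<le> (C + 1) * e'" using i C_ge by (intro mult_left_mono) auto
        also have "C * ((C + 1) * e') = e / 2" using C_ge by (simp add: e'_def)
        finally show ?thesis using C_ge by simp
      qed
      also have "norm1 M (T t h) < e / 2" using Th[OF t(1)] t1[OF t(2)] by linarith
      finally show ?thesis by simp
    qed
    then show "\<exists>n0. \<forall>n\<ge>n0. norm (dist1 M (a (Suc n)) (a n) - 0) < e" by auto
  qed
  have fixed: "AE x in M. T 1 g x = g x"
  proof (rule fixed_if_orbit_slow[OF _ a g lim])
    have "T 1 (a (r' n)) = a (Suc (r' n))" for n
      by (simp add: a_shift) (simp add: a_def add.commute)
    then show "(\<lambda>n. dist1 M (T 1 (a (r' n))) (a (r' n))) \<longlonglongrightarrow> 0"
      using filterlim_compose[OF slow filterlim_subseq[OF r']] by simp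
  qed simp
  have "(\<lambda>n. dist1 M (a n) g) \<longlonglongrightarrow> 0"
  proof (rule LIMSEQ_I)
    fix e :: real assume e: "0 < e"
    then have "0 < e / C" using C_ge by simp
    then obtain j where "dist1 M (a (r' j)) g < e / C"
      using order_tendstoD(2)[OF lim] unfolding eventually_sequentially by blast
    moreover define i where "i = r' j"
    ultimately have i: "dist1 M (a i) g < e / C" by simp
    have "dist1 M (a n) g < e" if n: "n \<ge> Suc i" for n
    proof -
      obtain l where l: "n = Suc l + i" using n by (metis le_Suc_ex add.commute add_Suc_shift)
      have "dist1 M (T (real (Suc l)) (a i)) g \<le> C * dist1 M (a i) g"
        using T_fixed_multiples[OF _ g fixed, of l] by (intro norm1_T_diff_fixed a g) simp_all
      also have "T (real (Suc l)) (a i) = a n"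
        using a_shift[of "real (Suc l)" i] by (simp add: a_def l add_ac)
      also have "C * dist1 M (a i) g < C * (e / C)"
        using i C_ge by (intro mult_strict_left_mono) auto
      finally show ?thesis using C_ge by simp
    qed
    then show "\<exists>n0. \<forall>n\<ge>n0. norm (dist1 M (a n) g - 0) < e" by auto
  qed
  with g g_bd fixed show ?thesis unfolding a_def by (intro exI[of _ g]) auto
qed

lemma rescale:
  assumes s: "0 < s"
  shows "L1_semigroup M (\<lambda>t. T (t * s)) (\<lambda>t. w (t * s)) p C (t\<^sub>0 / s)"
proof unfold_locales
  fix t :: real and f g :: "'a \<Rightarrow> real" and a b :: real
  assume "0 < t"
  then have t: "0 < t * s" using s by simp
  show "w (t * s) \<in> borel_measurable M" by (rule w_meas[OF t])
  show "AE x in M. T (t * s) (\<lambda>_. 1) x = 1" by (rule T_one[OF t])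
  show "0 \<le> w (t * s) x \<and> w (t * s) x \<le> C" for x by (rule w_bound[OF t])
  assume f: "integrable M f"
  show "integrable M (T (t * s) f)" by (rule T_int[OF t f])
  show "(\<integral>x. T (t * s) f x \<partial>M) = (\<integral>x. f x * w (t * s) x \<partial>M)" by (rule T_mass[OF t f])
  show "AE x in M. 0 \<le> T (t * s) f x" if "AE x in M. 0 \<le> f x" by (rule T_pos[OF t f that])
  show "T (u * s) (T (t * s) f) = T ((u + t) * s) f" if "0 < u" for u
    using T_semigroup[OF _ t f, of "u * s"] that s by (simp add: distrib_right)
  assume g: "integrable M g"
  show "AE x in M. T (t * s) (\<lambda>x. a * f x + b * g x) x = a * T (t * s) f x + b * T (t * s) g x"
    by (rule T_lin[OF t f g])
qed (use C_ge t0_pos p_int T_kernel s in simp_all)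

lemma converges_along_multiples:
  assumes s: "0 < s" and f: "integrable M f" and f_bd: "AE x in M. \<bar>f x\<bar> \<le> 1"
  shows "\<exists>g. integrable M g \<and> (AE x in M. \<bar>g x\<bar> \<le> 1) \<and> (AE x in M. T s g x = g x) \<and>
    (\<lambda>n. dist1 M (T (real (Suc n) * s) f) g) \<longlonglongrightarrow> 0"
proof -
  interpret S: L1_semigroup M "\<lambda>t. T (t * s)" "\<lambda>t. w (t * s)" p C "t\<^sub>0 / s"
    by (rule rescale[OF s])
  show ?thesis using S.converges_along_integers[OF f f_bd] by simp
qed

text \<open>
  Let \<open>h\<close> be the limit of \<open>T (n s) g\<close> and let \<open>r > s\<close> be an integer. Running for the complementary times
  \<open>n (r - s)\<close> returns \<open>T (n s) g\<close> to \<open>T (n r) g = g\<close> and fixes \<open>h\<close>, so by boundedness \<open>g\<close> is as close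
  to \<open>h\<close> as \<open>T (n s) g\<close> is.
\<close>

lemma fixed_all_times:
  assumes g: "integrable M g" and g_bd: "AE x in M. \<bar>g x\<bar> \<le> 1" and fixed: "AE x in M. T 1 g x = g x"
    and s: "0 < s"
  shows "AE x in M. T s g x = g x"
proof -
  define b where "b n = T (real (Suc n) * s) g" for n
  have ns: "0 < real (Suc n) * s" for n using s by simp
  have b: "integrable M (b n)" for n unfolding b_def by (rule T_int[OF ns g])
  obtain h where h: "integrable M h" and h_fixed: "AE x in M. T s h x = h x"
    and lim: "(\<lambda>n. dist1 M (b n) h) \<longlonglongrightarrow> 0"
    unfolding b_def using converges_along_multiples[OF s g g_bd] by (elim exE conjE)
  obtain k :: nat where "s < real k" using reals_Archimedean2 by blast
  then obtain l where l: "s < real (Suc l)" using s by (cases k) auto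
  define r where "r = real (Suc l)"
  have r: "0 < r" "0 < r - s" using l by (auto simp: r_def)
  have Tr_g: "AE x in M. T r g x = g x"
    using T_fixed_multiples[OF _ g fixed, of l] by (simp add: r_def)
  have Tr_h: "AE x in M. T r h x = h x"
  proof (rule fixed_if_orbit_slow[OF r(1) b h lim])
    have "dist1 M (T r (b n)) (b n) = 0" for n
    proof -
      have "T r (b n) = T (real (Suc n) * s) (T r g)"
        unfolding b_def T_semigroup[OF r(1) ns g] T_semigroup[OF ns r(1) g] by (simp add: add.commute)
      then have "AE x in M. T r (b n) x - b n x = 0"
        using T_cong[OF ns T_int[OF r(1) g] g Tr_g, of n] by (simp add: b_def)
      then show ?thesis
        by (subst norm1_eq_0_iff) (intro Bochner_Integration.integrable_diff T_int r b)
    qed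
    then show "(\<lambda>n. dist1 M (T r (b n)) (b n)) \<longlonglongrightarrow> 0" by simp
  qed
  have Tu_h: "AE x in M. T (r - s) h x = h x"
  proof -
    have "AE x in M. T (r - s) (T s h) x = T (r - s) h x"
      by (rule T_cong[OF r(2) T_int[OF s h] h h_fixed])
    moreover have "T (r - s) (T s h) = T r h" using T_semigroup[OF r(2) s h] by simp
    ultimately show ?thesis using Tr_h by auto
  qed
  have "dist1 M g h \<le> C * dist1 M (b n) h" for n
  proof -
    have pos: "0 < real (Suc n) * (r - s)" "0 < real (Suc n) * r" using r by simp_all
    have "T (real (Suc n) * (r - s)) (b n) = T (real (Suc n) * r) g"
      unfolding b_def T_semigroup[OF pos(1) ns g] by (simp add: algebra_simps)
    then have "AE x in M. T (real (Suc n) * (r - s)) (b n) x = g x"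
      using T_fixed_multiples[OF r(1) g Tr_g, of n] by simp
    then have "dist1 M g h = dist1 M (T (real (Suc n) * (r - s)) (b n)) h"
    proof (intro norm1_cong_AE)
      show "(\<lambda>x. T (real (Suc n) * (r - s)) (b n) x - h x) \<in> borel_measurable M"
        by (intro borel_measurable_integrable Bochner_Integration.integrable_diff T_int pos b h)
    qed (use g h in auto)
    also have "\<dots> \<le> C * dist1 M (b n) h"
      by (rule norm1_T_diff_fixed[OF pos(1) b h T_fixed_multiples[OF r(2) h Tu_h]])
    finally show ?thesis .
  qed
  then have "dist1 M g h \<le> 0"
    by (intro LIMSEQ_le_const[OF tendsto_mult_right_zero[OF lim, of C]]) auto
  then have "dist1 M g h = 0" by (simp add: antisym)
  then have "AE x in M. g x - h x = 0"
    by (subst (asm) norm1_eq_0_iff) (intro Bochner_Integration.integrable_diff g h)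
  then have eq: "AE x in M. g x = h x" by auto
  from T_cong[OF s g h this] eq h_fixed show ?thesis by eventually_elim simp
qed

text \<open>
  The limit along the integers is fixed at all times, so by boundedness the distance to it
  cannot grow by more than the factor \<open>C\<close> after any integer time.
\<close>

lemma bounded_converges:
  assumes f: "integrable M f" and f_bd: "AE x in M. \<bar>f x\<bar> \<le> 1"
  shows "\<exists>g. integrable M g \<and> ((\<lambda>t. dist1 M (T t f) g) \<longlongrightarrow> 0) at_top"
proof -
  obtain g where g: "integrable M g" "AE x in M. \<bar>g x\<bar> \<le> 1" "AE x in M. T 1 g x = g x"
    and lim: "(\<lambda>n. dist1 M (T (real (Suc n)) f) g) \<longlonglongrightarrow> 0"
    using converges_along_integers[OF f f_bd] by (elim exE conjE)
  have "((\<lambda>t. dist1 M (T t f) g) \<longlongrightarrow> 0) at_top"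
  proof (rule tendstoI)
    fix e :: real assume e: "0 < e"
    then have "0 < e / C" using C_ge by simp
    then obtain n where n: "dist1 M (T (real (Suc n)) f) g < e / C"
      using order_tendstoD(2)[OF lim] unfolding eventually_sequentially by blast
    show "\<forall>\<^sub>F t in at_top. dist (dist1 M (T t f) g) 0 < e"
      using eventually_gt_at_top[of "real (Suc n)"]
    proof eventually_elim
      case (elim t)
      define u where "u = t - real (Suc n)"
      have u: "0 < u" using elim by (simp add: u_def)
      have n': "0 < real (Suc n)" by simp
      have "T t f = T u (T (real (Suc n)) f)"
        using T_semigroup[OF u n' f] by (simp add: u_def)
      then have "dist1 M (T t f) g \<le> C * dist1 M (T (real (Suc n)) f) g"
        using norm1_T_diff_fixed[OF u T_int[OF n' f] g(1) fixed_all_times[OF g u]] by simp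
      also have "\<dots> < C * (e / C)"
        using n C_ge by (intro mult_strict_left_mono) auto
      finally show ?case using C_ge by simp
    qed
  qed
  with g show ?thesis by blast
qed

text \<open>
  Bounded functions are dense in mean and the operators are uniformly bounded, so the limits \<open>G n\<close> for
  the truncations of \<open>f\<close> form a Cauchy sequence.
\<close>

theorem L1_converges:
  assumes f: "integrable M f"
  shows "\<exists>g. integrable M g \<and> ((\<lambda>t. dist1 M (T t f) g) \<longlongrightarrow> 0) at_top"
proof -
  have f_meas [measurable]: "f \<in> borel_measurable M" using f by simp
  define F where "F n x = clip (real (Suc n)) (f x)" for n x
  have F_meas [measurable]: "F n \<in> borel_measurable M" for n unfolding F_def by measurable
  have F_bd: "\<bar>F n x\<bar> \<le> real (Suc n)" for n x unfolding F_def by (rule clip_bound) simp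
  have F: "integrable M (F n)" for n
    by (rule integrable_bdd[where c="real (Suc n)"]) (use F_bd in \<open>simp_all del: of_nat_Suc\<close>)
  have F_lim: "(\<lambda>n. dist1 M (F n) f) \<longlonglongrightarrow> 0"
  proof -
    have "(\<lambda>n. (\<integral>x. \<bar>F n x - f x\<bar> \<partial>M)) \<longlonglongrightarrow> (\<integral>x. (0::real) \<partial>M)"
    proof (rule integral_dominated_convergence[where w="\<lambda>x. 2 * \<bar>f x\<bar>"])
      show "AE x in M. (\<lambda>n. \<bar>F n x - f x\<bar>) \<longlonglongrightarrow> 0"
      proof (rule AE_I2)
        fix x
        obtain k :: nat where k: "\<bar>f x\<bar> < real k" using reals_Archimedean2 by blast
        have "\<forall>\<^sub>F n in sequentially. \<bar>F n x - f x\<bar> = 0"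
          using eventually_ge_at_top[of k]
        proof eventually_elim
          case (elim n)
          then have "\<bar>f x\<bar> \<le> real (Suc n)" using k by simp
          then show ?case unfolding F_def by (simp add: clip_id del: of_nat_Suc)
        qed
        then show "(\<lambda>n. \<bar>F n x - f x\<bar>) \<longlonglongrightarrow> 0" by (rule tendsto_eventually)
      qed
      show "AE x in M. norm \<bar>F n x - f x\<bar> \<le> 2 * \<bar>f x\<bar>" for n
      proof (rule AE_I2)
        fix x
        have "\<bar>F n x\<bar> \<le> \<bar>f x\<bar>" unfolding F_def by (rule clip_abs_le) simp
        then show "norm \<bar>F n x - f x\<bar> \<le> 2 * \<bar>f x\<bar>" unfolding real_norm_def by linarith
      qed
    qed (use f in simp_all)
    then show ?thesis by (simp add: norm1_def)
  qed
  have "\<exists>g. integrable M g \<and> ((\<lambda>t. dist1 M (T t (F n)) g) \<longlongrightarrow> 0) at_top" for n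
  proof -
    define c where "c = real (Suc n)"
    have c: "0 < c" by (simp add: c_def)
    let ?u = "\<lambda>x. inverse c * F n x"
    have u: "integrable M ?u" using F by simp
    have u_bd: "\<bar>?u x\<bar> \<le> 1" for x
      using F_bd[of n x] c unfolding c_def[symmetric] by (simp add: abs_mult field_simps)
    obtain g where g: "integrable M g" and lim: "((\<lambda>t. dist1 M (T t ?u) g) \<longlongrightarrow> 0) at_top"
      using bounded_converges[OF u AE_I2[OF u_bd]] by (elim exE conjE)
    have "\<forall>\<^sub>F t in at_top. c * dist1 M (T t ?u) g = norm1 M (\<lambda>x. T t (F n) x - c * g x)"
      using eventually_gt_at_top[of 0]
    proof eventually_elim
      case (elim t)
      have eq: "(\<lambda>x. c * ?u x) = F n" using c by (simp add: fun_eq_iff)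
      have int: "integrable M (T t ?u)" "integrable M (T t (F n))" by (intro T_int elim u F)+
      have "norm1 M (\<lambda>x. T t (F n) x - c * g x) = norm1 M (\<lambda>x. c * (T t ?u x - g x))"
      proof (rule norm1_cong_AE)
        show "AE x in M. T t (F n) x - c * g x = c * (T t ?u x - g x)"
          using T_scale[OF elim u, of c] unfolding eq by eventually_elim (simp add: algebra_simps)
      qed (use int g in simp_all)
      also have "\<dots> = c * dist1 M (T t ?u) g"
        using c by (simp add: norm1_def abs_mult)
      finally show ?case ..
    qed
    then have "((\<lambda>t. norm1 M (\<lambda>x. T t (F n) x - c * g x)) \<longlongrightarrow> 0) at_top"
      using tendsto_mult_right_zero[OF lim, of c] by (rule Lim_transform_eventually[rotated])
    moreover have "integrable M (\<lambda>x. c * g x)" using g by simp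
    ultimately show ?thesis by blast
  qed
  then obtain G where G: "\<And>n. integrable M (G n)"
    and G_lim: "\<And>n. ((\<lambda>t. dist1 M (T t (F n)) (G n)) \<longlongrightarrow> 0) at_top"
    by metis
  have G_diff: "dist1 M (G i) (G j) \<le> C * dist1 M (F i) (F j)" for i j
  proof (rule tendsto_lowerbound)
    show "((\<lambda>t. dist1 M (T t (F i)) (G i) + C * dist1 M (F i) (F j) + dist1 M (T t (F j)) (G j))
        \<longlongrightarrow> C * dist1 M (F i) (F j)) at_top"
      using tendsto_add[OF tendsto_add[OF G_lim tendsto_const] G_lim] by fastforce
    show "\<forall>\<^sub>F t in at_top. dist1 M (G i) (G j) \<le>
        dist1 M (T t (F i)) (G i) + C * dist1 M (F i) (F j) + dist1 M (T t (F j)) (G j)"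
      using eventually_gt_at_top[of 0]
    proof eventually_elim
      case (elim t)
      have TF: "integrable M (T t (F n))" for n by (rule T_int[OF elim F])
      show ?case
        using norm1_triangle[OF G[of i] TF[of i] G[of j]] norm1_triangle[OF TF[of i] TF[of j] G[of j]]
          norm1_T_diff[OF elim F[of i] F[of j]] norm1_commute[of M "G i" "T t (F i)"] by linarith
    qed
  qed simp
  have "\<exists>n0. \<forall>i\<ge>n0. \<forall>j\<ge>n0. dist1 M (G i) (G j) < e" if e: "0 < e" for e
  proof -
    have "0 < e / (2 * C)" using e C_ge by simp
    then obtain n0 where n0: "\<And>n. n \<ge> n0 \<Longrightarrow> dist1 M (F n) f < e / (2 * C)"
      using order_tendstoD(2)[OF F_lim] unfolding eventually_sequentially by blast
    have "dist1 M (G i) (G j) < e" if "i \<ge> n0" "j \<ge> n0" for i j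
    proof -
      have "dist1 M (F i) (F j) < e / (2 * C) + e / (2 * C)"
        using norm1_triangle[OF F[of i] f F[of j]] norm1_commute[of M f "F j"] n0[OF that(1)] n0[OF that(2)] by linarith
      then have "C * dist1 M (F i) (F j) < C * (e / (2 * C) + e / (2 * C))"
        using C_ge by (intro mult_strict_left_mono) auto
      also have "\<dots> = e" using C_ge by (simp add: field_simps)
      finally show ?thesis using G_diff[of i j] by linarith
    qed
    then show ?thesis by blast
  qed
  then have "\<exists>g. integrable M g \<and> (\<lambda>n. dist1 M (G n) g) \<longlonglongrightarrow> 0"
    by (rule L1_complete[OF G])
  then obtain g where g: "integrable M g" and g_lim: "(\<lambda>n. dist1 M (G n) g) \<longlonglongrightarrow> 0"
    by (elim exE conjE)
  have "((\<lambda>t. dist1 M (T t f) g) \<longlongrightarrow> 0) at_top"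
  proof (rule tendstoI)
    fix e :: real assume e: "0 < e"
    then have "0 < e / (3 * C)" using C_ge by simp
    then have "\<forall>\<^sub>F n in sequentially. dist1 M (F n) f < e / (3 * C)"
      by (rule order_tendstoD(2)[OF F_lim])
    moreover have "\<forall>\<^sub>F n in sequentially. dist1 M (G n) g < e / 3"
      using e by (intro order_tendstoD(2)[OF g_lim]) simp
    ultimately have "\<forall>\<^sub>F n in sequentially. dist1 M (F n) f < e / (3 * C) \<and> dist1 M (G n) g < e / 3"
      by (rule eventually_conj)
    then obtain n where n: "dist1 M (F n) f < e / (3 * C)" "dist1 M (G n) g < e / 3"
      by (auto dest!: eventually_happens'[OF sequentially_bot])
    have "\<forall>\<^sub>F t in at_top. dist1 M (T t (F n)) (G n) < e / 3"
      using e by (intro order_tendstoD(2)[OF G_lim]) simp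
    then show "\<forall>\<^sub>F t in at_top. dist (dist1 M (T t f) g) 0 < e"
      using eventually_gt_at_top[of 0]
    proof eventually_elim
      case (elim t)
      have TF: "integrable M (T t (F n))" "integrable M (T t f)" by (intro T_int elim F f)+
      have "dist1 M (T t f) (T t (F n)) \<le> C * dist1 M (F n) f"
        using norm1_T_diff[OF elim(2) f F[of n]] norm1_commute[of M f "F n"] by simp
      also have "\<dots> < C * (e / (3 * C))" using n(1) C_ge by (intro mult_strict_left_mono) auto
      also have "\<dots> = e / 3" using C_ge by simp
      finally have "dist1 M (T t f) (T t (F n)) < e / 3" .
      then have "dist1 M (T t f) g < e"
        using norm1_triangle[OF TF(2,1) g] norm1_triangle[OF TF(1) G[of n] g] elim(1) n(2) by linarith
      then show ?case by simp
    qed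
  qed
  with g show ?thesis by blast
qed

end

section \<open>Signed measures and their densities\<close>

lemma signed_measures_empty: "\<nu> \<in> signed_measures M \<Longrightarrow> \<nu> {} = 0"
  by (simp add: signed_measures_def)

lemma signed_measures_outside: "\<nu> \<in> signed_measures M \<Longrightarrow> A \<notin> sets M \<Longrightarrow> \<nu> A = 0"
  by (simp add: signed_measures_def)

lemma signed_measures_Diff:
  assumes "\<nu> \<in> signed_measures M" "A \<in> sets M" "B \<in> sets M" "B \<subseteq> A"
  shows "\<nu> (A - B) = \<nu> A - \<nu> B"
proof -
  have "\<nu> (B \<union> (A - B)) = \<nu> B + \<nu> (A - B)"
    using assms by (intro signed_measures_Un) auto
  moreover have "B \<union> (A - B) = A" using assms by auto
  ultimately show ?thesis by simp
qed

text \<open>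
  A set with subsets of unbounded measure has a subset of the same kind such that the difference has
  measure at least \<open>1\<close> in absolute value. Iterating gives disjoint sets along which countable additivity
  fails.
\<close>

lemma signed_measures_bounded:
  assumes \<nu>: "\<nu> \<in> signed_measures M"
  shows "\<exists>K. \<forall>A\<in>sets M. \<bar>\<nu> A\<bar> \<le> K"
proof (rule ccontr)
  assume contr: "\<not> ?thesis"
  define bad where "bad A \<longleftrightarrow> A \<in> sets M \<and> (\<forall>K. \<exists>B\<in>sets M. B \<subseteq> A \<and> K < \<bar>\<nu> B\<bar>)" for A
  have "bad (space M)"
  proof (rule ccontr)
    assume "\<not> bad (space M)"
    then obtain K where "\<forall>B\<in>sets M. B \<subseteq> space M \<longrightarrow> \<bar>\<nu> B\<bar> \<le> K"
      unfolding bad_def by (auto simp: not_less)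
    then have "\<forall>B\<in>sets M. \<bar>\<nu> B\<bar> \<le> K" by (simp add: sets.sets_into_space)
    with contr show False by blast
  qed
  have shrink: "\<exists>B. bad B \<and> B \<subseteq> A \<and> 1 \<le> \<bar>\<nu> (A - B)\<bar>" if "bad A" for A
  proof -
    have A: "A \<in> sets M" using \<open>bad A\<close> by (simp add: bad_def)
    obtain B where B: "B \<in> sets M" "B \<subseteq> A" "\<bar>\<nu> A\<bar> + 1 < \<bar>\<nu> B\<bar>"
      using \<open>bad A\<close> unfolding bad_def by blast
    have diff: "\<nu> (A - B) = \<nu> A - \<nu> B" using \<nu> A B by (intro signed_measures_Diff)
    have AB: "A - (A - B) = B" using B by auto
    have "bad B \<or> bad (A - B)"
    proof (rule ccontr)
      assume "\<not> (bad B \<or> bad (A - B))"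
      then have nb: "\<not> bad B" "\<not> bad (A - B)" by blast+
      have "A - B \<in> sets M" using A B by auto
      have "\<exists>K. \<forall>C\<in>sets M. C \<subseteq> B \<longrightarrow> \<bar>\<nu> C\<bar> \<le> K"
        using nb(1) B(1) by (simp add: bad_def not_less)
      then obtain K1 where K1: "\<And>C. C \<in> sets M \<Longrightarrow> C \<subseteq> B \<Longrightarrow> \<bar>\<nu> C\<bar> \<le> K1" by auto
      have "\<exists>K. \<forall>C\<in>sets M. C \<subseteq> A - B \<longrightarrow> \<bar>\<nu> C\<bar> \<le> K"
        using nb(2) \<open>A - B \<in> sets M\<close> by (simp add: bad_def not_less)
      then obtain K2 where K2: "\<And>C. C \<in> sets M \<Longrightarrow> C \<subseteq> A - B \<Longrightarrow> \<bar>\<nu> C\<bar> \<le> K2" by auto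
      have "\<bar>\<nu> C\<bar> \<le> K1 + K2" if C: "C \<in> sets M" "C \<subseteq> A" for C
      proof -
        have "\<nu> (C \<inter> B \<union> (C - B)) = \<nu> (C \<inter> B) + \<nu> (C - B)"
          using C B by (intro signed_measures_Un[OF \<nu>]) auto
        moreover have "C \<inter> B \<union> (C - B) = C" by auto
        moreover have "\<bar>\<nu> (C \<inter> B)\<bar> \<le> K1" using C B by (intro K1) auto
        moreover have "\<bar>\<nu> (C - B)\<bar> \<le> K2" using C B by (intro K2) auto
        ultimately show ?thesis by simp
      qed
      moreover obtain C where "C \<in> sets M" "C \<subseteq> A" "K1 + K2 < \<bar>\<nu> C\<bar>"
        using \<open>bad A\<close> unfolding bad_def by blast
      ultimately show False by force
    qed
    then show ?thesis
    proof
      assume "bad B"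
      then show ?thesis using B diff by (intro exI[of _ B]) auto
    next
      assume "bad (A - B)"
      then show ?thesis using B AB by (intro exI[of _ "A - B"]) auto
    qed
  qed
  obtain F where F0: "\<And>n. bad (F n)" and F: "\<And>n::nat. F (Suc n) \<subseteq> F n \<and> 1 \<le> \<bar>\<nu> (F n - F (Suc n))\<bar>"
    using dependent_nat_choice[of "\<lambda>_. bad" "\<lambda>_ A B. B \<subseteq> A \<and> 1 \<le> \<bar>\<nu> (A - B)\<bar>"] \<open>bad (space M)\<close> shrink
    by metis
  have "decseq F" using F by (intro decseq_SucI) simp
  have "disjoint_family (\<lambda>n. F n - F (Suc n))"
    unfolding disjoint_family_on_def
  proof (intro ballI impI)
    have "(F i - F (Suc i)) \<inter> (F j - F (Suc j)) = {}" if "i < j" for i j :: nat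
      using decseqD[OF \<open>decseq F\<close>, of "Suc i" j] that by auto
    then show "(F i - F (Suc i)) \<inter> (F j - F (Suc j)) = {}" if "i \<noteq> j" for i j :: nat
      using that by (metis Int_commute linorder_neqE_nat)
  qed
  moreover have "range (\<lambda>n. F n - F (Suc n)) \<subseteq> sets M" using F0 by (auto simp: bad_def)
  ultimately have "(\<lambda>n. \<nu> (F n - F (Suc n))) sums \<nu> (\<Union>n. F n - F (Suc n))"
    by (intro signed_measures_sums[OF \<nu>])
  then have "(\<lambda>n. \<nu> (F n - F (Suc n))) \<longlonglongrightarrow> 0"
    using summable_LIMSEQ_zero sums_summable by blast
  then have "\<forall>\<^sub>F n in sequentially. \<bar>\<nu> (F n - F (Suc n))\<bar> < 1"
    using order_tendstoD(2)[OF tendsto_rabs_zero, of _ sequentially 1] by auto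
  then show False using F by (auto simp: eventually_sequentially not_less[symmetric])
qed

lemma finite_measure_pos_part:
  assumes \<nu>: "\<nu> \<in> signed_measures M"
  shows "finite_measure (pos_part M \<nu>)"
proof
  obtain K where K: "\<And>A. A \<in> sets M \<Longrightarrow> \<bar>\<nu> A\<bar> \<le> K" using signed_measures_bounded[OF \<nu>] by blast
  have "emeasure (pos_part M \<nu>) (space M) \<le> ennreal K"
    unfolding emeasure_pos_part[OF \<nu> sets.top]
  proof (rule SUP_least)
    fix B assume "B \<in> {B \<in> sets M. B \<subseteq> space M}"
    then have "\<bar>\<nu> B\<bar> \<le> K" using K by simp
    then show "ennreal (\<nu> B) \<le> ennreal K" by (intro ennreal_leI) simp
  qed
  then show "emeasure (pos_part M \<nu>) (space (pos_part M \<nu>)) \<noteq> \<infinity>"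
    using le_less_trans[OF _ ennreal_less_top] by (auto simp: top_unique)
qed

lemma finite_measure_neg_part:
  "\<nu> \<in> signed_measures M \<Longrightarrow> finite_measure (neg_part M \<nu>)"
  unfolding neg_part_def by (intro finite_measure_pos_part signed_measures_uminus)

text \<open>
  One half of the Jordan decomposition: if \<open>B \<subseteq> A\<close> then \<open>\<nu> B = \<nu> A - \<nu> (A - B)\<close>, and the last term is
  bounded by the negative part.
\<close>

lemma pos_part_le:
  assumes \<nu>: "\<nu> \<in> signed_measures M" and A: "A \<in> sets M"
  shows "measure (pos_part M \<nu>) A \<le> \<nu> A + measure (neg_part M \<nu>) A"
proof -
  interpret P: finite_measure "pos_part M \<nu>" by (rule finite_measure_pos_part[OF \<nu>])
  interpret Q: finite_measure "neg_part M \<nu>" by (rule finite_measure_neg_part[OF \<nu>])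
  have le: "\<nu> B \<le> \<nu> A + measure (neg_part M \<nu>) A" if B: "B \<in> sets M" "B \<subseteq> A" for B
  proof -
    have "ennreal (- \<nu> (A - B)) \<le> emeasure (neg_part M \<nu>) A"
      unfolding neg_part_def emeasure_pos_part[OF signed_measures_uminus[OF \<nu>] A]
      using A B by (intro SUP_upper) auto
    then have "- \<nu> (A - B) \<le> measure (neg_part M \<nu>) A"
      unfolding Q.emeasure_eq_measure by (subst (asm) ennreal_le_iff) auto
    then show ?thesis using signed_measures_Diff[OF \<nu> A B] by simp
  qed
  have "0 \<le> \<nu> A + measure (neg_part M \<nu>) A"
    using le[of "{}"] signed_measures_empty[OF \<nu>] by simp
  have "emeasure (pos_part M \<nu>) A \<le> ennreal (\<nu> A + measure (neg_part M \<nu>) A)"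
    unfolding emeasure_pos_part[OF \<nu> A] by (intro SUP_least ennreal_leI le) auto
  then show ?thesis
    unfolding P.emeasure_eq_measure using \<open>0 \<le> _\<close> by (subst (asm) ennreal_le_iff) auto
qed

lemma jordan_decomposition:
  assumes \<nu>: "\<nu> \<in> signed_measures M" and A: "A \<in> sets M"
  shows "\<nu> A = measure (pos_part M \<nu>) A - measure (neg_part M \<nu>) A"
  using pos_part_le[OF \<nu> A] pos_part_le[OF signed_measures_uminus[OF \<nu>] A]
  by (simp add: neg_part_def)

text \<open>
  The signed measure with density \<open>f\<close>. The value \<open>0\<close> outside \<open>sets N\<close> makes it an element of
  \<^const>\<open>signed_measures\<close>.
\<close>

definition dens :: "'a measure \<Rightarrow> ('a \<Rightarrow> real) \<Rightarrow> 'a set \<Rightarrow> real" where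
  "dens N f = (\<lambda>A. if A \<in> sets N then \<integral>x. indicator A x * f x \<partial>N else 0)"

lemma integrable_indicator_times:
  fixes f :: "'a \<Rightarrow> real"
  shows "A \<in> sets N \<Longrightarrow> integrable N f \<Longrightarrow> integrable N (\<lambda>x. indicator A x * f x)"
  using integrable_real_mult_indicator[of A N f] by (simp add: mult.commute)

lemma finite_measure_density:
  fixes g :: "'a \<Rightarrow> real"
  assumes g: "integrable N g"
  shows "finite_measure (density N (\<lambda>x. ennreal (g x)))"
proof
  have [measurable]: "g \<in> borel_measurable N" using g by simp
  have "(\<integral>\<^sup>+x. ennreal (g x) \<partial>N) \<le> (\<integral>\<^sup>+x. ennreal (norm (g x)) \<partial>N)"
    by (intro nn_integral_mono ennreal_leI) simp
  also have "\<dots> < \<infinity>" using g by (simp add: integrable_iff_bounded)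
  finally have fin: "(\<integral>\<^sup>+x. ennreal (g x) \<partial>N) < \<infinity>" .
  have "emeasure (density N (\<lambda>x. ennreal (g x))) (space N) = (\<integral>\<^sup>+x. ennreal (g x) * indicator (space N) x \<partial>N)"
    by (intro emeasure_density) auto
  also have "\<dots> = (\<integral>\<^sup>+x. ennreal (g x) \<partial>N)"
    by (intro nn_integral_cong) simp
  finally show "emeasure (density N (\<lambda>x. ennreal (g x))) (space (density N (\<lambda>x. ennreal (g x)))) \<noteq> \<infinity>"
    using fin by simp
qed

lemma measure_density_real:
  fixes g :: "'a \<Rightarrow> real"
  assumes g: "integrable N g" and A: "A \<in> sets N"
  shows "measure (density N (\<lambda>x. ennreal (g x))) A = (\<integral>x. indicator A x * max 0 (g x) \<partial>N)"
proof -
  have [measurable]: "g \<in> borel_measurable N" using g by simp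
  have "emeasure (density N (\<lambda>x. ennreal (g x))) A = (\<integral>\<^sup>+x. ennreal (g x) * indicator A x \<partial>N)"
    using A by (intro emeasure_density) auto
  also have "\<dots> = (\<integral>\<^sup>+x. ennreal (indicator A x * max 0 (g x)) \<partial>N)"
    by (intro nn_integral_cong) (auto simp: indicator_def max_def ennreal_neg)
  also have "\<dots> = ennreal (\<integral>x. indicator A x * max 0 (g x) \<partial>N)"
    using A g by (intro nn_integral_eq_integral integrable_indicator_times) auto
  finally show ?thesis
    unfolding measure_def by (simp add: integral_nonneg_AE)
qed

lemma dens_eq_measures:
  assumes f: "integrable N f"
  shows "dens N f = (\<lambda>A. measure (density N (\<lambda>x. ennreal (f x))) A - measure (density N (\<lambda>x. ennreal (- f x))) A)"
proof
  fix A
  show "dens N f A = measure (density N (\<lambda>x. ennreal (f x))) A - measure (density N (\<lambda>x. ennreal (- f x))) A"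
  proof (cases "A \<in> sets N")
    case True
    have "integrable N (\<lambda>x. - f x)" using f by simp
    then have "measure (density N (\<lambda>x. ennreal (f x))) A - measure (density N (\<lambda>x. ennreal (- f x))) A =
      (\<integral>x. indicator A x * max 0 (f x) \<partial>N) - (\<integral>x. indicator A x * max 0 (- f x) \<partial>N)"
      using f True by (simp add: measure_density_real)
    also have "\<dots> = (\<integral>x. indicator A x * max 0 (f x) - indicator A x * max 0 (- f x) \<partial>N)"
      using f True by (intro Bochner_Integration.integral_diff[symmetric] integrable_indicator_times) auto
    also have "\<dots> = (\<integral>x. indicator A x * f x \<partial>N)"
      by (intro Bochner_Integration.integral_cong) (auto simp: max_def indicator_def)
    finally show ?thesis using True by (simp add: dens_def)
  next
    case False
    then show ?thesis by (simp add: dens_def measure_notin_sets)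
  qed
qed

lemma dens_signed:
  assumes f: "integrable N f" and sets: "sets N = sets M"
  shows "dens N f \<in> signed_measures M"
proof -
  interpret P: finite_measure "density N (\<lambda>x. ennreal (f x))" by (rule finite_measure_density[OF f])
  interpret Q: finite_measure "density N (\<lambda>x. ennreal (- f x))"
    by (rule finite_measure_density) (use f in simp)
  show ?thesis
    unfolding signed_measures_def
  proof (intro CollectI conjI allI impI)
    show "dens N f {} = 0" by (simp add: dens_def)
    show "dens N f A = 0" if "A \<notin> sets M" for A using that sets by (simp add: dens_def)
    fix A :: "nat \<Rightarrow> 'a set" assume "range A \<subseteq> sets M" "disjoint_family A"
    then show "(\<lambda>i. dens N f (A i)) sums dens N f (\<Union>i. A i)"
      unfolding dens_eq_measures[OF f] using sets
      by (intro sums_diff P.finite_measure_UNION Q.finite_measure_UNION) auto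
  qed
qed

lemma dens_inj:
  assumes "integrable N f" "integrable N g" "dens N f = dens N g"
  shows "AE x in N. f x = g x"
proof (rule density_unique_real[OF assms(1,2)])
  fix A assume "A \<in> sets N"
  then show "set_lebesgue_integral N A f = set_lebesgue_integral N A g"
    using fun_cong[OF assms(3), of A] by (simp add: dens_def set_lebesgue_integral_def)
qed

lemma dens_diff:
  assumes "integrable N f" "integrable N g"
  shows "dens N f A - dens N g A = dens N (\<lambda>x. f x - g x) A"
  using assms by (simp add: dens_def right_diff_distrib integrable_indicator_times)

lemma pos_part_dens:
  assumes f: "integrable N f" and sets: "sets N = sets M"
  shows "pos_part M (dens N f) = density N (\<lambda>x. ennreal (f x))"
proof (rule measure_eqI)
  show "sets (pos_part M (dens N f)) = sets (density N (\<lambda>x. ennreal (f x)))" using sets by simp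
  fix A assume "A \<in> sets (pos_part M (dens N f))"
  then have A: "A \<in> sets N" "A \<in> sets M" using sets by simp_all
  interpret P: finite_measure "density N (\<lambda>x. ennreal (f x))" by (rule finite_measure_density[OF f])
  have [measurable]: "f \<in> borel_measurable N" using f by simp
  define B where "B = {x \<in> space N. 0 \<le> f x} \<inter> A"
  have B: "B \<in> sets N" using A unfolding B_def by measurable
  have eq: "dens N f B = measure (density N (\<lambda>x. ennreal (f x))) A"
  proof -
    have "dens N f B = (\<integral>x. indicator B x * f x \<partial>N)" using B by (simp add: dens_def)
    also have "\<dots> = (\<integral>x. indicator A x * max 0 (f x) \<partial>N)"
      by (intro Bochner_Integration.integral_cong) (auto simp: B_def max_def indicator_def)
    finally show ?thesis using measure_density_real[OF f A(1)] by simp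
  qed
  have "emeasure (pos_part M (dens N f)) A = ennreal (measure (density N (\<lambda>x. ennreal (f x))) A)"
    unfolding emeasure_pos_part[OF dens_signed[OF f sets] A(2)]
  proof (intro antisym SUP_least)
    fix D assume "D \<in> {D \<in> sets M. D \<subseteq> A}"
    then have D: "D \<in> sets N" "D \<subseteq> A" using sets by auto
    have "dens N f D \<le> measure (density N (\<lambda>x. ennreal (f x))) D"
      unfolding dens_eq_measures[OF f] by simp
    also have "\<dots> \<le> measure (density N (\<lambda>x. ennreal (f x))) A"
      using D A by (intro P.finite_measure_mono) auto
    finally show "ennreal (dens N f D) \<le> ennreal (measure (density N (\<lambda>x. ennreal (f x))) A)"
      by (rule ennreal_leI)
  next
    show "ennreal (measure (density N (\<lambda>x. ennreal (f x))) A) \<le> (SUP D \<in> {D \<in> sets M. D \<subseteq> A}. ennreal (dens N f D))"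
      unfolding eq[symmetric] by (rule SUP_upper) (use B sets in \<open>auto simp: B_def\<close>)
  qed
  then show "emeasure (pos_part M (dens N f)) A = emeasure (density N (\<lambda>x. ennreal (f x))) A"
    by (simp add: P.emeasure_eq_measure)
qed

lemma signed_integral_dens:
  assumes f: "integrable N f" and sets: "sets N = sets M"
    and h: "h \<in> borel_measurable M" "\<And>x. x \<in> space M \<Longrightarrow> \<bar>h x\<bar> \<le> c"
  shows "signed_integral M (dens N f) h = (\<integral>x. f x * h x \<partial>N)" and "integrable N (\<lambda>x. f x * h x)"
proof -
  have [measurable]: "f \<in> borel_measurable N" using f by simp
  have [measurable]: "h \<in> borel_measurable N" using h sets by (simp cong: measurable_cong_sets)
  have h_bd: "\<bar>h x\<bar> \<le> \<bar>c\<bar>" if "x \<in> space N" for x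
    using h(2)[of x] that sets_eq_imp_space_eq[OF sets] by simp
  have gh: "integrable N (\<lambda>x. g x * h x)" if g: "integrable N g" for g :: "'a \<Rightarrow> real"
  proof (rule Bochner_Integration.integrable_bound)
    show "integrable N (\<lambda>x. g x * c)" using g by simp
    show "(\<lambda>x. g x * h x) \<in> borel_measurable N" using g by simp
    show "AE x in N. norm (g x * h x) \<le> norm (g x * c)"
      using h_bd by (auto intro!: AE_I2 mult_left_mono simp: abs_mult)
  qed
  show "integrable N (\<lambda>x. f x * h x)" by (rule gh[OF f])
  have part: "(\<integral>x. h x \<partial>density N (\<lambda>x. ennreal (g x))) = (\<integral>x. max 0 (g x) * h x \<partial>N)"
    if [measurable]: "g \<in> borel_measurable N" for g :: "'a \<Rightarrow> real"
  proof -
    have "density N (\<lambda>x. ennreal (g x)) = density N (\<lambda>x. ennreal (max 0 (g x)))"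
      by (intro arg_cong[where f="density N"]) (auto simp: fun_eq_iff max_def ennreal_neg)
    then show ?thesis by (simp only:) (subst integral_real_density, auto)
  qed
  have "neg_part M (dens N f) = density N (\<lambda>x. ennreal (- f x))"
  proof -
    have "(\<lambda>A. - dens N f A) = dens N (\<lambda>x. - f x)" by (auto simp: dens_def fun_eq_iff)
    then show ?thesis
      unfolding neg_part_def using f sets by (simp add: pos_part_dens)
  qed
  then have "signed_integral M (dens N f) h = (\<integral>x. max 0 (f x) * h x \<partial>N) - (\<integral>x. max 0 (- f x) * h x \<partial>N)"
    unfolding signed_integral_def pos_part_dens[OF f sets] by (simp add: part)
  also have "\<dots> = (\<integral>x. max 0 (f x) * h x - max 0 (- f x) * h x \<partial>N)"
    using f by (intro Bochner_Integration.integral_diff[symmetric] gh) auto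
  also have "\<dots> = (\<integral>x. f x * h x \<partial>N)"
    by (intro Bochner_Integration.integral_cong) (auto simp: max_def)
  finally show "signed_integral M (dens N f) h = (\<integral>x. f x * h x \<partial>N)" .
qed

lemma (in finite_measure) signed_Radon_Nikodym:
  assumes \<nu>: "\<nu> \<in> signed_measures M" and ac: "\<And>A. A \<in> sets M \<Longrightarrow> emeasure M A = 0 \<Longrightarrow> \<nu> A = 0"
  shows "\<exists>f. integrable M f \<and> dens M f = \<nu>"
proof -
  have part: "\<exists>D. integrable M D \<and> (\<forall>A\<in>sets M. measure (pos_part M \<eta>) A = (\<integral>x. indicator A x * D x \<partial>M))"
    if \<eta>: "\<eta> \<in> signed_measures M" and ac: "\<And>A. A \<in> sets M \<Longrightarrow> emeasure M A = 0 \<Longrightarrow> \<eta> A = 0" for \<eta>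
  proof -
    interpret P: finite_measure "pos_part M \<eta>" by (rule finite_measure_pos_part[OF \<eta>])
    have abs: "absolutely_continuous M (pos_part M \<eta>)"
      unfolding absolutely_continuous_def
    proof
      fix A assume "A \<in> null_sets M"
      then have A: "A \<in> sets M" "emeasure M A = 0" by auto
      have "\<eta> B = 0" if "B \<in> sets M" "B \<subseteq> A" for B
        using ac[OF that(1)] emeasure_mono[OF that(2) A(1)] A(2) by simp
      then have "emeasure (pos_part M \<eta>) A \<le> 0"
        unfolding emeasure_pos_part[OF \<eta> A(1)] by (intro SUP_least) auto
      then show "A \<in> null_sets (pos_part M \<eta>)" using A by (auto simp: null_sets_def)
    qed
    obtain D where D [measurable]: "D \<in> borel_measurable M" and
      "AE x in M. RN_deriv M (pos_part M \<eta>) x = ennreal (D x)" and D0: "\<And>x. 0 \<le> D x"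
      by (rule real_RN_deriv[OF P.finite_measure_axioms abs]) simp_all
    then have "density M (\<lambda>x. ennreal (D x)) = density M (RN_deriv M (pos_part M \<eta>))"
      by (intro density_cong) auto
    also have "\<dots> = pos_part M \<eta>" by (rule density_RN_deriv[OF abs]) simp
    finally have eq: "density M (\<lambda>x. ennreal (D x)) = pos_part M \<eta>" .
    have "(\<integral>\<^sup>+x. ennreal (D x) \<partial>M) = emeasure (density M (\<lambda>x. ennreal (D x))) (space M)"
      by (subst emeasure_density) (auto intro!: nn_integral_cong)
    also have "\<dots> < \<infinity>" unfolding eq by (simp add: P.emeasure_eq_measure)
    finally have D_int: "integrable M D"
      using D0 by (intro integrableI_nonneg) auto
    have "max 0 (D x) = D x" for x using D0[of x] by simp
    then have "measure (pos_part M \<eta>) A = (\<integral>x. indicator A x * D x \<partial>M)" if "A \<in> sets M" for A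
      using measure_density_real[OF D_int that] unfolding eq by simp
    with D_int show ?thesis by blast
  qed
  obtain D1 where D1: "integrable M D1" "\<And>A. A \<in> sets M \<Longrightarrow> measure (pos_part M \<nu>) A = (\<integral>x. indicator A x * D1 x \<partial>M)"
    using part[OF \<nu> ac] by blast
  obtain D2 where D2: "integrable M D2" "\<And>A. A \<in> sets M \<Longrightarrow> measure (neg_part M \<nu>) A = (\<integral>x. indicator A x * D2 x \<partial>M)"
    unfolding neg_part_def using part[OF signed_measures_uminus[OF \<nu>]] ac by fastforce
  have "dens M (\<lambda>x. D1 x - D2 x) A = \<nu> A" for A
  proof (cases "A \<in> sets M")
    case True
    then show ?thesis
      using D1 D2 jordan_decomposition[OF \<nu> True]
      by (simp add: dens_def right_diff_distrib integrable_indicator_times)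
  next
    case False
    then show ?thesis using signed_measures_outside[OF \<nu>] by (simp add: dens_def)
  qed
  then show ?thesis using D1 D2 by (intro exI[of _ "\<lambda>x. D1 x - D2 x"]) auto
qed

lemma tv_norm_dens_le:
  assumes f: "integrable N f" and sets: "sets N = sets M"
  shows "tv_norm M (dens N f) \<le> ennreal (norm1 N f)"
  unfolding tv_norm_def variation_def
proof (rule SUP_least)
  fix P assume "P \<in> {P. finite P \<and> disjoint P \<and> P \<subseteq> sets M \<and> \<Union>P = space M}"
  then have P: "finite P" "disjoint P" "P \<subseteq> sets N" "\<Union>P = space N"
    using sets sets_eq_imp_space_eq[OF sets] by auto
  let ?V = "density N (\<lambda>x. ennreal \<bar>f x\<bar>)"
  have fa: "integrable N (\<lambda>x. \<bar>f x\<bar>)" using f by simp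
  interpret V: finite_measure ?V by (rule finite_measure_density[OF fa])
  have le: "\<bar>dens N f B\<bar> \<le> measure ?V B" if "B \<in> P" for B
  proof -
    have B: "B \<in> sets N" using that P by auto
    have "\<bar>dens N f B\<bar> \<le> (\<integral>x. \<bar>indicator B x * f x\<bar> \<partial>N)"
      using B integral_abs_bound by (simp add: dens_def)
    also have "\<dots> = measure ?V B"
      unfolding measure_density_real[OF fa B]
      by (intro Bochner_Integration.integral_cong) (auto simp: indicator_def)
    finally show ?thesis .
  qed
  have "(\<Sum>B\<in>P. ennreal \<bar>dens N f B\<bar>) \<le> (\<Sum>B\<in>P. ennreal (measure ?V B))"
    by (intro sum_mono ennreal_leI le)
  also have "\<dots> = ennreal (\<Sum>B\<in>P. measure ?V B)" by (rule sum_ennreal) simp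
  also have "(\<Sum>B\<in>P. measure ?V B) = measure ?V (\<Union>B\<in>P. B)"
    using P by (intro V.finite_measure_finite_Union[symmetric])
      (auto simp: disjoint_family_on_def disjoint_def)
  also have "\<dots> = norm1 N f"
    using P(4) measure_density_real[OF fa sets.top]
    by (simp add: norm1_def) (rule Bochner_Integration.integral_cong, auto)
  finally show "(\<Sum>B\<in>P. ennreal \<bar>dens N f B\<bar>) \<le> ennreal (norm1 N f)" .
qed

lemma abs_le_tv_norm: "ennreal \<bar>\<nu> (space M)\<bar> \<le> tv_norm M \<nu>"
  unfolding tv_norm_def variation_def
  by (rule SUP_upper2[of "{space M}"]) (auto simp: disjoint_def)

lemma variation_eq_0:
  assumes "\<And>B. B \<in> sets M \<Longrightarrow> B \<subseteq> A \<Longrightarrow> \<nu> B = 0"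
  shows "variation M \<nu> A = 0"
proof -
  have "variation M \<nu> A \<le> 0"
    unfolding variation_def
  proof (rule SUP_least)
    fix P assume "P \<in> {P. finite P \<and> disjoint P \<and> P \<subseteq> sets M \<and> \<Union>P = A}"
    then have "\<nu> B = 0" if "B \<in> P" for B using that by (intro assms) auto
    then show "(\<Sum>B\<in>P. ennreal \<bar>\<nu> B\<bar>) \<le> 0" by simp
  qed
  then show ?thesis by simp
qed

lemma nonneg_measure_mono:
  assumes \<nu>: "\<nu> \<in> signed_measures M" "nonneg_measure M \<nu>" and "A \<in> sets M" "B \<in> sets M" "B \<subseteq> A"
  shows "\<nu> B \<le> \<nu> A"
  using signed_measures_Diff[OF \<nu>(1) assms(3-5)] \<nu>(2) assms(3,4)
  unfolding nonneg_measure_def by (metis diff_ge_0_iff_ge sets.Diff)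

lemma emeasure_pos_part_nonneg:
  assumes \<nu>: "\<nu> \<in> signed_measures M" "nonneg_measure M \<nu>" and A: "A \<in> sets M"
  shows "emeasure (pos_part M \<nu>) A = ennreal (\<nu> A)"
  unfolding emeasure_pos_part[OF \<nu>(1) A]
  by (intro antisym SUP_least SUP_upper) (use nonneg_measure_mono[OF \<nu> A] A in \<open>auto intro: ennreal_leI\<close>)

section \<open>Densities of kernels\<close>

text \<open>
  The scaled kernel \<open>K\<close> consists of subprobability measures, so \<open>L = M(dx) K(x, dy)\<close> is a measure on the
  product. Its sections over \<open>x\<close> are absolutely continuous, hence so is \<open>L\<close>, and the Radon-Nikodym
  theorem on the product yields a jointly measurable density. For each \<open>A\<close> the exceptional null set of
  \<open>x\<close> may be a different one.
\<close>

lemma (in finite_measure) kernel_has_density: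
  fixes k :: "'a \<Rightarrow> 'a set \<Rightarrow> real"
  assumes k_meas: "\<And>A. A \<in> sets M \<Longrightarrow> (\<lambda>x. k x A) \<in> borel_measurable M"
    and k_signed: "\<And>x. x \<in> space M \<Longrightarrow> k x \<in> signed_measures M"
    and k_nonneg: "\<And>x. x \<in> space M \<Longrightarrow> nonneg_measure M (k x)"
    and k_le: "\<And>x. x \<in> space M \<Longrightarrow> k x (space M) \<le> c"
    and k_ac: "\<And>x A. x \<in> space M \<Longrightarrow> A \<in> sets M \<Longrightarrow> emeasure M A = 0 \<Longrightarrow> k x A = 0"
  shows "\<exists>p. integrable (M \<Otimes>\<^sub>M M) p \<and>
    (\<forall>A\<in>sets M. AE x in M. k x A = (\<integral>y. p (x, y) * indicator A y \<partial>M))"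
proof (cases "space M = {}")
  case True
  have "AE x in M. P x" for P by (rule AE_I2) (simp add: True)
  then show ?thesis by (intro exI[of _ "\<lambda>_. 0"]) auto
next
  case False
  define d where "d = \<bar>c\<bar> + 1"
  have d: "0 < d" by (simp add: d_def)
  have k0: "0 \<le> k x A" if "x \<in> space M" "A \<in> sets M" for x A
    using k_nonneg[OF that(1)] that(2) by (simp add: nonneg_measure_def)
  have kd: "k x A \<le> d" if "x \<in> space M" "A \<in> sets M" for x A
  proof -
    have "k x A \<le> k x (space M)"
      by (rule nonneg_measure_mono[OF k_signed[OF that(1)] k_nonneg[OF that(1)] sets.top that(2)])
        (rule sets.sets_into_space[OF that(2)])
    then show ?thesis using k_le[OF that(1)] by (simp add: d_def)
  qed
  define K where "K x = scale_measure (ennreal (1 / d)) (pos_part M (k x))" for x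
  have K_eq: "emeasure (K x) A = ennreal (k x A / d)" if "x \<in> space M" "A \<in> sets M" for x A
    unfolding K_def emeasure_scale_measure
    by (subst emeasure_pos_part_nonneg) (use that d k0[OF that] k_signed k_nonneg in \<open>simp_all flip: ennreal_mult\<close>)
  have K_sets: "sets (K x) = sets M" for x by (simp add: K_def)
  have K [measurable]: "K \<in> measurable M (subprob_algebra M)"
  proof (rule measurable_subprob_algebra)
    fix x assume x: "x \<in> space M"
    show "sets (K x) = sets M" by (rule K_sets)
    have sp: "space (K x) = space M" by (rule sets_eq_imp_space_eq[OF K_sets])
    show "subprob_space (K x)"
    proof
      show "emeasure (K x) (space (K x)) \<le> 1"
        unfolding sp K_eq[OF x sets.top] using kd[OF x sets.top] d by (simp add: field_simps)
      show "space (K x) \<noteq> {}" using sp False by simp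
    qed
  next
    fix A assume A: "A \<in> sets M"
    have "(\<lambda>x. ennreal (k x A / d)) \<in> borel_measurable M"
      using k_meas[OF A] by measurable
    then show "(\<lambda>x. emeasure (K x) A) \<in> borel_measurable M"
      by (rule measurable_cong[THEN iffD2, rotated]) (rule K_eq[OF _ A])
  qed
  define L where "L = M \<bind> (\<lambda>x. distr (K x) (M \<Otimes>\<^sub>M M) (Pair x))"
  have distr_meas: "(\<lambda>x. distr (K x) (M \<Otimes>\<^sub>M M) (Pair x)) \<in> measurable M (subprob_algebra (M \<Otimes>\<^sub>M M))"
    by (rule measurable_distr2[OF _ K]) simp
  have L_sets [simp]: "sets L = sets (M \<Otimes>\<^sub>M M)"
    unfolding L_def by (rule sets_bind[OF _ False]) simp
  have L_eq: "emeasure L E = (\<integral>\<^sup>+x. emeasure (K x) (Pair x -` E) \<partial>M)" if E: "E \<in> sets (M \<Otimes>\<^sub>M M)" for E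
  proof -
    have "emeasure L E = (\<integral>\<^sup>+x. emeasure (distr (K x) (M \<Otimes>\<^sub>M M) (Pair x)) E \<partial>M)"
      unfolding L_def by (rule emeasure_bind[OF False distr_meas E])
    also have "\<dots> = (\<integral>\<^sup>+x. emeasure (K x) (Pair x -` E) \<partial>M)"
    proof (rule nn_integral_cong)
      fix x assume x: "x \<in> space M"
      have sp: "space (K x) = space M" by (rule sets_eq_imp_space_eq[OF K_sets])
      have "Pair x \<in> measurable (K x) (M \<Otimes>\<^sub>M M)"
        using x measurable_Pair1'[OF x, of M] by (simp cong: measurable_cong_sets add: K_sets)
      then have "emeasure (distr (K x) (M \<Otimes>\<^sub>M M) (Pair x)) E = emeasure (K x) (Pair x -` E \<inter> space (K x))"
        using E by (rule emeasure_distr)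
      also have "Pair x -` E \<inter> space (K x) = Pair x -` E"
        using sets.sets_into_space[OF sets_Pair1[OF E]] sp by blast
      finally show "emeasure (distr (K x) (M \<Otimes>\<^sub>M M) (Pair x)) E = emeasure (K x) (Pair x -` E)" .
    qed
    finally show ?thesis .
  qed
  interpret PM: finite_measure "M \<Otimes>\<^sub>M M"
    by (intro finite_measure_pair_measure) unfold_locales
  have L_fin: "finite_measure L"
  proof
    have "emeasure L (space (M \<Otimes>\<^sub>M M)) \<le> (\<integral>\<^sup>+x. 1 \<partial>M)"
      unfolding L_eq[OF sets.top]
    proof (rule nn_integral_mono)
      fix x assume x: "x \<in> space M"
      have "Pair x -` space (M \<Otimes>\<^sub>M M) \<in> sets M" by (rule sets_Pair1[OF sets.top])
      from K_eq[OF x this] kd[OF x this] show "emeasure (K x) (Pair x -` space (M \<Otimes>\<^sub>M M)) \<le> 1"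
        using d by (simp add: field_simps)
    qed
    also have "\<dots> < \<infinity>" by (simp add: emeasure_eq_measure)
    finally show "emeasure L (space L) \<noteq> \<infinity>"
      using sets_eq_imp_space_eq[OF L_sets] by simp
  qed
  have L_ac: "absolutely_continuous (M \<Otimes>\<^sub>M M) L"
    unfolding absolutely_continuous_def
  proof
    fix E assume "E \<in> null_sets (M \<Otimes>\<^sub>M M)"
    then have E: "E \<in> sets (M \<Otimes>\<^sub>M M)" "(\<integral>\<^sup>+x. emeasure M (Pair x -` E) \<partial>M) = 0"
      by (auto simp: null_sets_def emeasure_pair_measure_alt)
    have "AE x in M. emeasure M (Pair x -` E) = 0"
      using E(2) by (subst (asm) nn_integral_0_iff_AE) (use measurable_emeasure_Pair[OF E(1)] in auto)
    then have "AE x in M. emeasure (K x) (Pair x -` E) = 0"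
      using AE_space
    proof eventually_elim
      case (elim x)
      show ?case
        using K_eq[OF elim(2) sets_Pair1[OF E(1)]] k_ac[OF elim(2) sets_Pair1[OF E(1)] elim(1)] by simp
    qed
    then have "emeasure L E = 0"
      unfolding L_eq[OF E(1)] by (subst nn_integral_cong_AE[of _ "\<lambda>_. 0"]) auto
    then show "E \<in> null_sets L" using E by (auto simp: null_sets_def)
  qed
  obtain D where D [measurable]: "D \<in> borel_measurable (M \<Otimes>\<^sub>M M)" and
    D_RN: "AE z in M \<Otimes>\<^sub>M M. RN_deriv (M \<Otimes>\<^sub>M M) L z = ennreal (D z)" and D0: "\<And>z. 0 \<le> D z"
    by (rule PM.real_RN_deriv[OF L_fin L_ac L_sets]) simp_all
  have "density (M \<Otimes>\<^sub>M M) (\<lambda>z. ennreal (D z)) = density (M \<Otimes>\<^sub>M M) (RN_deriv (M \<Otimes>\<^sub>M M) L)"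
    using D_RN by (intro density_cong) auto
  also have "\<dots> = L" by (rule PM.density_RN_deriv[OF L_ac L_sets])
  finally have L_dens: "emeasure L E = (\<integral>\<^sup>+z. ennreal (D z) * indicator E z \<partial>(M \<Otimes>\<^sub>M M))"
    if "E \<in> sets (M \<Otimes>\<^sub>M M)" for E
    using that emeasure_density[of "\<lambda>z. ennreal (D z)" "M \<Otimes>\<^sub>M M" E] by simp
  have D_int: "integrable (M \<Otimes>\<^sub>M M) D"
  proof (rule integrableI_nonneg)
    interpret L: finite_measure L by (rule L_fin)
    have "(\<integral>\<^sup>+z. ennreal (D z) \<partial>(M \<Otimes>\<^sub>M M)) = emeasure L (space (M \<Otimes>\<^sub>M M))"
      unfolding L_dens[OF sets.top] by (intro nn_integral_cong) simp
    also have "\<dots> < \<infinity>" by (simp add: L.emeasure_eq_measure)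
    finally show "(\<integral>\<^sup>+z. ennreal (D z) \<partial>(M \<Otimes>\<^sub>M M)) < \<infinity>" .
  qed (use D0 in auto)
  have "AE x in M. k x A = (\<integral>y. d * D (x, y) * indicator A y \<partial>M)" if A [measurable]: "A \<in> sets M" for A
  proof -
    have [measurable]: "(\<lambda>x. k x A) \<in> borel_measurable M" by (rule k_meas[OF A])
    have "AE x in M. ennreal (k x A / d) = (\<integral>\<^sup>+y. ennreal (D (x, y)) * indicator A y \<partial>M)"
    proof (rule density_unique2)
      fix B assume B [measurable]: "B \<in> sets M"
      have AB: "B \<times> A \<in> sets (M \<Otimes>\<^sub>M M)" by measurable
      have "(\<integral>\<^sup>+x. ennreal (k x A / d) * indicator B x \<partial>M) = emeasure L (B \<times> A)"
        unfolding L_eq[OF AB]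
      proof (rule nn_integral_cong)
        fix x assume x: "x \<in> space M"
        show "ennreal (k x A / d) * indicator B x = emeasure (K x) (Pair x -` (B \<times> A))"
          using K_eq[OF x A] by (cases "x \<in> B") (auto simp: vimage_def)
      qed
      also have "\<dots> = (\<integral>\<^sup>+x. \<integral>\<^sup>+y. ennreal (D (x, y)) * indicator (B \<times> A) (x, y) \<partial>M \<partial>M)"
        unfolding L_dens[OF AB] by (rule nn_integral_fst[symmetric]) measurable
      also have "\<dots> = (\<integral>\<^sup>+x. (\<integral>\<^sup>+y. ennreal (D (x, y)) * indicator A y \<partial>M) * indicator B x \<partial>M)"
        by (intro nn_integral_cong) (auto simp: indicator_def)
      finally show "(\<integral>\<^sup>+x\<in>B. ennreal (k x A / d) \<partial>M) = (\<integral>\<^sup>+x\<in>B. (\<integral>\<^sup>+y. ennreal (D (x, y)) * indicator A y \<partial>M) \<partial>M)" .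
    qed measurable
    then show ?thesis
      using AE_space
    proof eventually_elim
      case (elim x)
      have "(\<integral>\<^sup>+y. ennreal (D (x, y) * indicator A y) \<partial>M) = (\<integral>\<^sup>+y. ennreal (D (x, y)) * indicator A y \<partial>M)"
        by (intro nn_integral_cong) (auto simp: indicator_def)
      also have "\<dots> = ennreal (k x A / d)" using elim(1) by simp
      finally have "(\<integral>y. D (x, y) * indicator A y \<partial>M) = k x A / d"
        using elim(2) D0 k0[OF elim(2) A] d by (subst integral_eq_nn_integral) auto
      then show ?case using d by (simp add: mult.assoc)
    qed
  qed
  then show ?thesis using D_int by (intro exI[of _ "\<lambda>z. d * D z"]) auto
qed

section \<open>Semigroups of positive kernel operators\<close>

text \<open>
  The densities of \<open>S t\<close> with respect to \<open>\<mu>\<close> form an instance of \<^locale>\<open>L1_semigroup\<close>.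
\<close>

locale positive_kernel_semigroup =
  fixes M :: "'a measure"
    and S :: "real \<Rightarrow> ('a set \<Rightarrow> real) \<Rightarrow> ('a set \<Rightarrow> real)"
    and k :: "real \<Rightarrow> 'a \<Rightarrow> 'a set \<Rightarrow> real"
    and \<mu> :: "'a set \<Rightarrow> real"
    and t\<^sub>0 :: real
  assumes bounded: "bounded_semigroup M S"
    and kernel: "\<And>t. t > 0 \<Longrightarrow> kernel_operator M (k t) (S t)"
    and positive: "\<And>t. t > 0 \<Longrightarrow> positive_operator M (S t)"
    and \<mu>: "\<mu> \<in> signed_measures M" "nonneg_measure M \<mu>"
    and invariant: "\<And>t. t > 0 \<Longrightarrow> S t \<mu> = \<mu>"
    and t0: "t\<^sub>0 > 0" and ac: "\<And>x. x \<in> space M \<Longrightarrow> abs_cont M (k t\<^sub>0 x) \<mu>"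
begin

definition N :: "'a measure" where
  "N = pos_part M \<mu>"

lemma sets_N [simp, measurable_cong]: "sets N = sets M" and space_N [simp]: "space N = space M"
  by (simp_all add: N_def)

lemma borel_N [simp]: "borel_measurable N = borel_measurable M"
  by (rule measurable_cong_sets) simp_all

sublocale N: finite_measure N
  unfolding N_def by (rule finite_measure_pos_part[OF \<mu>(1)])

lemma emeasure_N: "A \<in> sets M \<Longrightarrow> emeasure N A = ennreal (\<mu> A)"
  unfolding N_def by (rule emeasure_pos_part_nonneg[OF \<mu>])

lemma \<mu>_nonneg: "A \<in> sets M \<Longrightarrow> 0 \<le> \<mu> A"
  using \<mu>(2) by (simp add: nonneg_measure_def)

lemma N_null_iff: "A \<in> sets M \<Longrightarrow> emeasure N A = 0 \<longleftrightarrow> \<mu> A = 0"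
  using \<mu>_nonneg[of A] by (simp add: emeasure_N ennreal_eq_0_iff antisym)

lemma measure_N: "A \<in> sets M \<Longrightarrow> measure N A = \<mu> A"
  using \<mu>_nonneg[of A] by (simp add: measure_def emeasure_N)

lemma dens_one: "dens N (\<lambda>_. 1) = \<mu>"
proof
  fix A
  show "dens N (\<lambda>_. 1) A = \<mu> A"
    using signed_measures_outside[OF \<mu>(1), of A] measure_N[of A] by (simp add: dens_def)
qed

lemma kernel_measurable: "0 < t \<Longrightarrow> A \<in> sets M \<Longrightarrow> (\<lambda>x. k t x A) \<in> borel_measurable M"
  using kernel[of t] by (simp add: kernel_operator_def bounded_kernel_def)

lemma kernel_signed: "0 < t \<Longrightarrow> x \<in> space M \<Longrightarrow> k t x \<in> signed_measures M"
  using kernel[of t] by (simp add: kernel_operator_def bounded_kernel_def)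

lemma kernel_nonneg: "0 < t \<Longrightarrow> x \<in> space M \<Longrightarrow> nonneg_measure M (k t x)"
  using kernel_operator_positive_iff[OF kernel[of t]] positive[of t] by (simp add: nonneg_measure_def)

lemma kernel_bounded:
  assumes t: "0 < t"
  shows "\<exists>c. \<forall>x\<in>space M. \<forall>A\<in>sets M. 0 \<le> k t x A \<and> k t x A \<le> c"
proof -
  define s where "s = (SUP x\<in>space M. variation M (k t x) (space M))"
  have s: "s < \<infinity>" using kernel[OF t] by (simp add: s_def kernel_operator_def bounded_kernel_def)
  have "0 \<le> k t x A \<and> k t x A \<le> enn2real s" if x: "x \<in> space M" and A: "A \<in> sets M" for x A
  proof
    show "0 \<le> k t x A" using kernel_nonneg[OF t x] A by (simp add: nonneg_measure_def)
    have "ennreal \<bar>k t x (space M)\<bar> \<le> s"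
      unfolding s_def using abs_le_tv_norm[of "k t x" M] x
      by (intro SUP_upper2[of x]) (auto simp: tv_norm_def)
    then have "enn2real (ennreal \<bar>k t x (space M)\<bar>) \<le> enn2real s"
      using s by (intro enn2real_mono) auto
    then have "\<bar>k t x (space M)\<bar> \<le> enn2real s" by simp
    moreover have "k t x A \<le> k t x (space M)"
      by (rule nonneg_measure_mono[OF kernel_signed[OF t x] kernel_nonneg[OF t x] sets.top A])
        (rule sets.sets_into_space[OF A])
    ultimately show "k t x A \<le> enn2real s" by simp
  qed
  then show ?thesis by blast
qed

lemma S_signed: "0 < t \<Longrightarrow> \<nu> \<in> signed_measures M \<Longrightarrow> S t \<nu> \<in> signed_measures M"
  using kernel[of t] by (auto simp: kernel_operator_def)

lemma S_eq: "0 < t \<Longrightarrow> \<nu> \<in> signed_measures M \<Longrightarrow> A \<in> sets M \<Longrightarrow> S t \<nu> A = signed_integral M \<nu> (\<lambda>x. k t x A)"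
  using kernel[of t] by (simp add: kernel_operator_def)

lemma dens_N_signed: "integrable N f \<Longrightarrow> dens N f \<in> signed_measures M"
  by (rule dens_signed) simp_all

lemma S_dens:
  assumes t: "0 < t" and f: "integrable N f" and A: "A \<in> sets M"
  shows "S t (dens N f) A = (\<integral>x. f x * k t x A \<partial>N)" and "integrable N (\<lambda>x. f x * k t x A)"
proof -
  obtain c where c: "\<forall>x\<in>space M. \<forall>A\<in>sets M. 0 \<le> k t x A \<and> k t x A \<le> c"
    using kernel_bounded[OF t] by blast
  have b: "\<bar>k t x A\<bar> \<le> c" if "x \<in> space M" for x using c that A by auto
  note sd = signed_integral_dens[OF f sets_N kernel_measurable[OF t A] b]
  show "S t (dens N f) A = (\<integral>x. f x * k t x A \<partial>N)"
    unfolding S_eq[OF t dens_N_signed[OF f] A] by (rule sd(1))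
  show "integrable N (\<lambda>x. f x * k t x A)" by (rule sd(2))
qed

text \<open>
  By invariance, the kernel integrated against \<open>\<mu>\<close> gives \<open>\<mu> A = 0\<close>.
\<close>

lemma kernel_null:
  assumes t: "0 < t" and A: "A \<in> sets M" and null: "emeasure N A = 0"
  shows "AE x in N. k t x A = 0"
proof -
  have one: "integrable N (\<lambda>_. 1 :: real)" by simp
  have int: "integrable N (\<lambda>x. k t x A)" using S_dens(2)[OF t one A] by simp
  have nn: "AE x in N. 0 \<le> k t x A"
    using kernel_nonneg[OF t] A by (intro AE_I2) (simp add: nonneg_measure_def)
  have "(\<integral>x. k t x A \<partial>N) = \<mu> A"
    using S_dens(1)[OF t one A] by (simp add: dens_one invariant[OF t])
  then have "(\<integral>x. k t x A \<partial>N) = 0" using null N_null_iff[OF A] by simp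
  then show ?thesis using integral_nonneg_eq_0_iff_AE[OF int nn] by simp
qed

text \<open>
  The choice depends only on the signed measure. Therefore the semigroup law for \<open>S\<close> becomes an equality
  of functions for \<open>T\<close>, not merely one almost everywhere.
\<close>

definition density_of :: "('a set \<Rightarrow> real) \<Rightarrow> 'a \<Rightarrow> real" where
  "density_of \<nu> = (SOME f. integrable N f \<and> dens N f = \<nu>)"

definition T :: "real \<Rightarrow> ('a \<Rightarrow> real) \<Rightarrow> 'a \<Rightarrow> real" where
  "T t f = density_of (S t (dens N f))"

lemma density_of:
  assumes "\<nu> \<in> signed_measures M" "\<And>A. A \<in> sets M \<Longrightarrow> emeasure N A = 0 \<Longrightarrow> \<nu> A = 0"
  shows "integrable N (density_of \<nu>)" "dens N (density_of \<nu>) = \<nu>"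
proof -
  have "\<nu> \<in> signed_measures N" using assms(1) by (simp add: signed_measures_def)
  then have "\<exists>f. integrable N f \<and> dens N f = \<nu>"
    using assms(2) by (intro N.signed_Radon_Nikodym) auto
  then have "integrable N (density_of \<nu>) \<and> dens N (density_of \<nu>) = \<nu>"
    unfolding density_of_def by (rule someI_ex)
  then show "integrable N (density_of \<nu>)" "dens N (density_of \<nu>) = \<nu>" by simp_all
qed

lemma
  assumes t: "0 < t" and f: "integrable N f"
  shows T_integrable: "integrable N (T t f)" and dens_T: "dens N (T t f) = S t (dens N f)"
proof -
  have "S t (dens N f) A = 0" if A: "A \<in> sets M" and null: "emeasure N A = 0" for A
  proof -
    have "(\<integral>x. f x * k t x A \<partial>N) = 0"
      by (rule integral_eq_zero_AE) (use kernel_null[OF t A null] in auto)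
    then show ?thesis by (simp add: S_dens(1)[OF t f A])
  qed
  from density_of[OF S_signed[OF t dens_N_signed[OF f]] this]
  show "integrable N (T t f)" "dens N (T t f) = S t (dens N f)"
    unfolding T_def by blast+
qed

lemma T_set_integral:
  assumes t: "0 < t" and f: "integrable N f" and A: "A \<in> sets M"
  shows "(\<integral>x. indicator A x * T t f x \<partial>N) = (\<integral>x. f x * k t x A \<partial>N)"
  using fun_cong[OF dens_T[OF t f], of A] A by (simp add: dens_def[of N "T t f"] S_dens(1)[OF t f A])

lemma AE_eq_T:
  assumes t: "0 < t" and f: "integrable N f" and g: "integrable N g"
    and eq: "\<And>A. A \<in> sets M \<Longrightarrow> (\<integral>x. indicator A x * g x \<partial>N) = (\<integral>x. f x * k t x A \<partial>N)"
  shows "AE x in N. T t f x = g x"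
proof (rule density_unique_real[OF T_integrable[OF t f] g])
  fix A assume "A \<in> sets N"
  then have A: "A \<in> sets M" by simp
  show "set_lebesgue_integral N A (T t f) = set_lebesgue_integral N A g"
    using T_set_integral[OF t f A] eq[OF A] by (simp add: set_lebesgue_integral_def)
qed

definition bound :: real where
  "bound = max 1 (enn2real (SUP t\<in>{0<..}. operator_norm M (S t)))"

lemma S_mass_le:
  assumes t: "0 < t" and f: "integrable N f" and f1: "norm1 N f \<le> 1"
  shows "S t (dens N f) (space M) \<le> bound"
proof -
  define s where "s = (SUP t\<in>{0<..}. operator_norm M (S t))"
  have s: "s < \<infinity>" using bounded by (simp add: s_def bounded_semigroup_def)
  have "tv_norm M (dens N f) \<le> ennreal (norm1 N f)" by (rule tv_norm_dens_le[OF f sets_N])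
  also have "\<dots> \<le> ennreal 1" by (rule ennreal_leI[OF f1])
  finally have tv: "tv_norm M (dens N f) \<le> 1" by simp
  have "ennreal \<bar>S t (dens N f) (space M)\<bar> \<le> tv_norm M (S t (dens N f))" by (rule abs_le_tv_norm)
  also have "\<dots> \<le> operator_norm M (S t)"
    unfolding operator_norm_def using tv dens_N_signed[OF f] by (intro SUP_upper) simp
  also have "\<dots> \<le> s" unfolding s_def using t by (intro SUP_upper) simp
  finally have "ennreal \<bar>S t (dens N f) (space M)\<bar> \<le> s" .
  then have "enn2real (ennreal \<bar>S t (dens N f) (space M)\<bar>) \<le> enn2real s"
    using s by (intro enn2real_mono) auto
  then show ?thesis by (simp add: bound_def s_def[symmetric])
qed

text \<open>
  Otherwise a normalised indicator of a set on which the mass exceeds \<open>bound\<close> would violate the bound on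
  the operator norm.
\<close>

lemma kernel_mass_le:
  assumes t: "0 < t"
  shows "AE x in N. k t x (space M) \<le> bound"
proof -
  have one: "integrable N (\<lambda>_. 1 :: real)" by simp
  have int: "integrable N (\<lambda>x. k t x (space M))" using S_dens(2)[OF t one sets.top] by simp
  have "AE x in N. 0 \<le> bound - k t x (space M)"
  proof (rule N.density_nonneg)
    show "integrable N (\<lambda>x. bound - k t x (space M))" using int by simp
    fix A assume "A \<in> sets N"
    then have A: "A \<in> sets M" "A \<in> sets N" by simp_all
    have ind: "integrable N (indicator A :: _ \<Rightarrow> real)"
      using A by (intro integrable_real_indicator) (auto simp: N.emeasure_eq_measure)
    have kA: "(\<integral>x. indicator A x * k t x (space M) \<partial>N) \<le> bound * measure N A"
    proof (cases "measure N A = 0")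
      case True
      then have "AE x in N. x \<notin> A" using A by (intro AE_not_in) (auto simp: null_sets_def N.emeasure_eq_measure)
      then have "(\<integral>x. indicator A x * k t x (space M) \<partial>N) = 0"
        by (intro integral_eq_zero_AE) auto
      then show ?thesis using True by simp
    next
      case False
      then have m: "0 < measure N A" by (simp add: zero_less_measure_iff)
      let ?f = "\<lambda>x. inverse (measure N A) * indicator A x"
      have f: "integrable N ?f" using ind by simp
      have "norm1 N ?f \<le> 1" using m A by (simp add: norm1_def abs_mult)
      from S_mass_le[OF t f this] S_dens(1)[OF t f sets.top]
      have "inverse (measure N A) * (\<integral>x. indicator A x * k t x (space M) \<partial>N) \<le> bound"
        by (simp add: mult.assoc)
      then show ?thesis using m by (simp add: field_simps)
    qed
    have "set_lebesgue_integral N A (\<lambda>x. bound - k t x (space M)) =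
        (\<integral>x. indicator A x * bound - indicator A x * k t x (space M) \<partial>N)"
      by (simp add: set_lebesgue_integral_def right_diff_distrib)
    also have "\<dots> = bound * measure N A - (\<integral>x. indicator A x * k t x (space M) \<partial>N)"
      using A ind integrable_indicator_times[OF A(2) int]
      by (subst Bochner_Integration.integral_diff) auto
    finally show "0 \<le> set_lebesgue_integral N A (\<lambda>x. bound - k t x (space M))" using kA by simp
  qed
  then show ?thesis by eventually_elim simp
qed

text \<open>
  The mass of the kernel, truncated so that the bounds that hold almost everywhere hold everywhere.
\<close>

definition w :: "real \<Rightarrow> 'a \<Rightarrow> real" where
  "w t x = max 0 (min bound (k t x (space M)))"

lemma bound_ge: "1 \<le> bound"
  by (simp add: bound_def)

lemma w_eq:
  assumes t: "0 < t"
  shows "AE x in N. w t x = k t x (space M)"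
  using kernel_mass_le[OF t] AE_space
  by eventually_elim (use kernel_nonneg[OF t] in \<open>auto simp: w_def nonneg_measure_def\<close>)

lemma kernel_t0_null:
  assumes x: "x \<in> space M" and A: "A \<in> sets M" and null: "emeasure N A = 0"
  shows "k t\<^sub>0 x A = 0"
proof -
  have "\<mu> B = 0" if "B \<in> sets M" "B \<subseteq> A" for B
    using nonneg_measure_mono[OF \<mu> A that] \<mu>_nonneg[OF that(1)] null N_null_iff[OF A] by simp
  then have "variation M \<mu> A = 0" by (rule variation_eq_0)
  then show ?thesis using ac[OF x] A by (simp add: abs_cont_def)
qed

lemma exists_kernel_density:
  "\<exists>p. integrable (N \<Otimes>\<^sub>M N) p \<and> (\<forall>A\<in>sets M. AE x in N. k t\<^sub>0 x A = (\<integral>y. p (x, y) * indicator A y \<partial>N))"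
proof -
  obtain c where c: "\<forall>x\<in>space M. \<forall>A\<in>sets M. 0 \<le> k t\<^sub>0 x A \<and> k t\<^sub>0 x A \<le> c"
    using kernel_bounded[OF t0] by blast
  have "\<exists>p. integrable (N \<Otimes>\<^sub>M N) p \<and> (\<forall>A\<in>sets N. AE x in N. k t\<^sub>0 x A = (\<integral>y. p (x, y) * indicator A y \<partial>N))"
  proof (rule N.kernel_has_density)
    show "(\<lambda>x. k t\<^sub>0 x A) \<in> borel_measurable N" if "A \<in> sets N" for A
      using that kernel_measurable[OF t0, of A] by simp
    fix x assume "x \<in> space N"
    then have x: "x \<in> space M" by simp
    show "k t\<^sub>0 x \<in> signed_measures N" using kernel_signed[OF t0 x] by (simp add: signed_measures_def)
    show "nonneg_measure N (k t\<^sub>0 x)" using kernel_nonneg[OF t0 x] by (simp add: nonneg_measure_def)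
    show "k t\<^sub>0 x (space N) \<le> c" using c x by simp
    show "k t\<^sub>0 x A = 0" if "A \<in> sets N" "emeasure N A = 0" for A
      using kernel_t0_null[OF x] that by simp
  qed
  then show ?thesis by simp
qed

lemma L1_semigroup_exists: "\<exists>p. L1_semigroup N T w p bound t\<^sub>0"
proof -
  obtain p where p: "integrable (N \<Otimes>\<^sub>M N) p"
    and p_eq: "\<And>A. A \<in> sets M \<Longrightarrow> AE x in N. k t\<^sub>0 x A = (\<integral>y. p (x, y) * indicator A y \<partial>N)"
    using exists_kernel_density by blast
  interpret P: pair_sigma_finite N N by unfold_locales
  have "L1_semigroup N T w p bound t\<^sub>0"
  proof
    fix t :: real and f g :: "'a \<Rightarrow> real" and a b :: real
    assume t: "0 < t"
    show "AE x in N. T t (\<lambda>_. 1) x = 1"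
    proof (rule dens_inj[OF T_integrable[OF t]])
      show "dens N (T t (\<lambda>_. 1)) = dens N (\<lambda>_. 1)"
        by (subst dens_T[OF t]) (simp_all add: dens_one invariant[OF t])
    qed simp_all
    have kt [measurable]: "(\<lambda>x. k t x (space M)) \<in> borel_measurable M"
      by (rule kernel_measurable[OF t sets.top])
    show w_meas: "w t \<in> borel_measurable N"
      unfolding w_def borel_N by measurable
    show "0 \<le> w t x \<and> w t x \<le> bound" for x using bound_ge by (auto simp: w_def)
    assume f: "integrable N f"
    show "integrable N (T t f)" by (rule T_integrable[OF t f])
    show "(\<integral>x. T t f x \<partial>N) = (\<integral>x. f x * w t x \<partial>N)"
    proof -
      have "(\<integral>x. T t f x \<partial>N) = (\<integral>x. indicator (space M) x * T t f x \<partial>N)"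
        by (intro Bochner_Integration.integral_cong) auto
      also have "\<dots> = (\<integral>x. f x * k t x (space M) \<partial>N)" by (rule T_set_integral[OF t f sets.top])
      also have "\<dots> = (\<integral>x. f x * w t x \<partial>N)"
        by (rule integral_cong_AE) (use w_eq[OF t] f w_meas S_dens(2)[OF t f sets.top] in auto)
      finally show ?thesis .
    qed
    show "T u (T t f) = T (u + t) f" if u: "0 < u" for u
    proof -
      have "S (u + t) (dens N f) = S u (S t (dens N f))"
        using bounded t u dens_N_signed[OF f] unfolding bounded_semigroup_def by blast
      then show ?thesis unfolding T_def[of u] dens_T[OF t f] T_def[of "u + t"] by simp
    qed
    show "AE x in N. 0 \<le> T t f x" if f0: "AE x in N. 0 \<le> f x"
    proof (rule N.density_nonneg[OF T_integrable[OF t f]])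
      fix A assume "A \<in> sets N"
      then have A: "A \<in> sets M" by simp
      have "0 \<le> (\<integral>x. f x * k t x A \<partial>N)"
        using f0 AE_space
        by (intro integral_nonneg_AE, eventually_elim)
          (use kernel_nonneg[OF t] A in \<open>auto simp: nonneg_measure_def\<close>)
      then show "0 \<le> set_lebesgue_integral N A (T t f)"
        using T_set_integral[OF t f A] by (simp add: set_lebesgue_integral_def)
    qed
    assume g: "integrable N g"
    show "AE x in N. T t (\<lambda>x. a * f x + b * g x) x = a * T t f x + b * T t g x"
    proof (rule AE_eq_T[OF t])
      show "integrable N (\<lambda>x. a * f x + b * g x)" using f g by simp
      show "integrable N (\<lambda>x. a * T t f x + b * T t g x)" using T_integrable[OF t] f g by simp
      fix A assume A: "A \<in> sets M"
      have Tf: "integrable N (\<lambda>x. indicator A x * T t f x)" "integrable N (\<lambda>x. indicator A x * T t g x)"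
        using A by (intro integrable_indicator_times T_integrable t f g; simp)+
      have "(\<integral>x. indicator A x * (a * T t f x + b * T t g x) \<partial>N) =
          (\<integral>x. a * (indicator A x * T t f x) + b * (indicator A x * T t g x) \<partial>N)"
        by (intro Bochner_Integration.integral_cong) (auto simp: algebra_simps)
      also have "\<dots> = a * (\<integral>x. f x * k t x A \<partial>N) + b * (\<integral>x. g x * k t x A \<partial>N)"
        using Tf by (simp add: T_set_integral[OF t f A] T_set_integral[OF t g A])
      also have "\<dots> = (\<integral>x. a * (f x * k t x A) + b * (g x * k t x A) \<partial>N)"
        using S_dens(2)[OF t f A] S_dens(2)[OF t g A] by simp
      also have "\<dots> = (\<integral>x. (a * f x + b * g x) * k t x A \<partial>N)"
        by (intro Bochner_Integration.integral_cong) (auto simp: algebra_simps)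
      finally show "(\<integral>x. indicator A x * (a * T t f x + b * T t g x) \<partial>N) = (\<integral>x. (a * f x + b * g x) * k t x A \<partial>N)" .
    qed
  next
    show "1 \<le> bound" by (rule bound_ge)
    show "0 < t\<^sub>0" by (rule t0)
    show "integrable (N \<Otimes>\<^sub>M N) p" by (rule p)
    fix f :: "'a \<Rightarrow> real"
    assume f: "f \<in> borel_measurable N" and f1: "\<And>x. \<bar>f x\<bar> \<le> 1"
    have f_int: "integrable N f" by (rule N.integrable_bdd[OF f AE_I2[OF f1]])
    note kb = N.kernel_integral_bound[OF p f, of 1]
    have pf: "integrable (N \<Otimes>\<^sub>M N) (\<lambda>(x, y). p (x, y) * f x)" by (rule kb(1)) (rule f1)
    show "AE y in N. T t\<^sub>0 f y = (\<integral>x. p (x, y) * f x \<partial>N)"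
    proof (rule AE_eq_T[OF t0 f_int])
      show "integrable N (\<lambda>y. \<integral>x. p (x, y) * f x \<partial>N)" by (rule kb(3)) (rule f1)
      fix A assume A: "A \<in> sets M"
      then have [measurable]: "A \<in> sets N" by simp
      have pfA: "integrable (N \<Otimes>\<^sub>M N) (\<lambda>(x, y). p (x, y) * f x * indicator A y)"
      proof (rule Bochner_Integration.integrable_bound[OF pf])
        have [measurable]: "p \<in> borel_measurable (N \<Otimes>\<^sub>M N)" "f \<in> borel_measurable N" using p f by auto
        show "(\<lambda>(x, y). p (x, y) * f x * indicator A y) \<in> borel_measurable (N \<Otimes>\<^sub>M N)" by measurable
      qed (auto simp: indicator_def)
      have "(\<integral>y. indicator A y * (\<integral>x. p (x, y) * f x \<partial>N) \<partial>N) = (\<integral>y. \<integral>x. p (x, y) * f x * indicator A y \<partial>N \<partial>N)"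
        by (simp add: mult.commute)
      also have "\<dots> = (\<integral>x. \<integral>y. p (x, y) * f x * indicator A y \<partial>N \<partial>N)"
        by (rule P.Fubini_integral[OF pfA])
      also have "\<dots> = (\<integral>x. f x * (\<integral>y. p (x, y) * indicator A y \<partial>N) \<partial>N)"
        by (simp add: mult_ac flip: integral_mult_right_zero)
      also have "\<dots> = (\<integral>x. f x * k t\<^sub>0 x A \<partial>N)"
      proof (rule integral_cong_AE)
        show "AE x in N. f x * (\<integral>y. p (x, y) * indicator A y \<partial>N) = f x * k t\<^sub>0 x A"
          using p_eq[OF A] by eventually_elim simp
        have [measurable]: "p \<in> borel_measurable (N \<Otimes>\<^sub>M N)" "f \<in> borel_measurable N" using p f by auto
        show "(\<lambda>x. f x * (\<integral>y. p (x, y) * indicator A y \<partial>N)) \<in> borel_measurable N" by measurable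
        show "(\<lambda>x. f x * k t\<^sub>0 x A) \<in> borel_measurable N"
          using S_dens(2)[OF t0 f_int A] by (rule borel_measurable_integrable)
      qed
      finally show "(\<integral>y. indicator A y * (\<integral>x. p (x, y) * f x \<partial>N) \<partial>N) = (\<integral>x. f x * k t\<^sub>0 x A \<partial>N)" .
    qed
  qed
  then show ?thesis by blast
qed

text \<open>
  \<open>S t \<nu>\<close> has a density at time \<open>t\<^sub>0\<close>, and from then on it evolves by \<open>T\<close>.
\<close>

theorem converges:
  assumes \<nu>: "\<nu> \<in> signed_measures M"
  shows "tv_convergent M (\<lambda>t. S t \<nu>)"
proof -
  obtain p where "L1_semigroup N T w p bound t\<^sub>0" using L1_semigroup_exists by blast
  then interpret L: L1_semigroup N T w p bound t\<^sub>0 .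
  have "S t\<^sub>0 \<nu> A = 0" if A: "A \<in> sets M" and null: "emeasure N A = 0" for A
  proof -
    have "(\<integral>x. k t\<^sub>0 x A \<partial>L) = 0" if "space L = space M" for L
      using that kernel_t0_null[OF _ A null] by (intro integral_eq_zero_AE AE_I2) simp
    then show ?thesis unfolding S_eq[OF t0 \<nu> A] signed_integral_def neg_part_def by simp
  qed
  from density_of[OF S_signed[OF t0 \<nu>] this]
  obtain f where f: "integrable N f" and f_eq: "dens N f = S t\<^sub>0 \<nu>" by blast
  obtain g where g: "integrable N g" and lim: "((\<lambda>t. dist1 N (T t f) g) \<longlongrightarrow> 0) at_top"
    using L.L1_converges[OF f] by blast
  show ?thesis
    unfolding tv_convergent_def
  proof (rule bexI[OF _ dens_N_signed[OF g]])
    show "((\<lambda>t. tv_norm M (\<lambda>A. S t \<nu> A - dens N g A)) \<longlongrightarrow> 0) at_top"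
    proof (rule tendsto_sandwich[OF _ _ tendsto_const])
      have "filterlim (\<lambda>t. t - t\<^sub>0) at_top at_top"
        unfolding filterlim_at_top
      proof
        fix Z
        show "\<forall>\<^sub>F t in at_top. Z \<le> t - t\<^sub>0"
          using eventually_ge_at_top[of "Z + t\<^sub>0"] by eventually_elim simp
      qed
      from filterlim_compose[OF lim this]
      have "((\<lambda>t. ennreal (dist1 N (T (t - t\<^sub>0) f) g)) \<longlongrightarrow> ennreal 0) at_top"
        by (rule tendsto_ennrealI)
      then show "((\<lambda>t. ennreal (dist1 N (T (t - t\<^sub>0) f) g)) \<longlongrightarrow> 0) at_top" by simp
      show "\<forall>\<^sub>F t in at_top. tv_norm M (\<lambda>A. S t \<nu> A - dens N g A) \<le> ennreal (dist1 N (T (t - t\<^sub>0) f) g)"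
        using eventually_gt_at_top[of t\<^sub>0]
      proof eventually_elim
        case (elim t)
        then have t: "0 < t - t\<^sub>0" by simp
        have "S ((t - t\<^sub>0) + t\<^sub>0) \<nu> = S (t - t\<^sub>0) (S t\<^sub>0 \<nu>)"
          using bounded t t0 \<nu> unfolding bounded_semigroup_def by blast
        then have "S t \<nu> = dens N (T (t - t\<^sub>0) f)"
          using dens_T[OF t f] f_eq by simp
        then have "(\<lambda>A. S t \<nu> A - dens N g A) = dens N (\<lambda>x. T (t - t\<^sub>0) f x - g x)"
          using dens_diff[OF T_integrable[OF t f] g] by simp
        then show ?case
          using tv_norm_dens_le[OF Bochner_Integration.integrable_diff[OF T_integrable[OF t f] g] sets_N] by simp
      qed
    qed simp
  qed
qed

end

theorem theorem6p1:
  fixes M :: "'a measure"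
    and S :: "real \<Rightarrow> ('a set \<Rightarrow> real) \<Rightarrow> ('a set \<Rightarrow> real)"
    and k :: "real \<Rightarrow> 'a \<Rightarrow> 'a set \<Rightarrow> real"
    and \<mu> :: "'a set \<Rightarrow> real"
    and t\<^sub>0 :: real
  assumes "countably_generated M"
    and "bounded_semigroup M S"
    and "\<And>t. t > 0 \<Longrightarrow> kernel_operator M (k t) (S t)"
    and "\<And>t. t > 0 \<Longrightarrow> positive_operator M (S t)"
    and "\<mu> \<in> signed_measures M" and "nonneg_measure M \<mu>"
    and "\<And>t. t > 0 \<Longrightarrow> S t \<mu> = \<mu>"
    and "t\<^sub>0 > 0" and "\<And>x. x \<in> space M \<Longrightarrow> abs_cont M (k t\<^sub>0 x) \<mu>"
  shows "\<forall>\<nu>\<in>signed_measures M. tv_convergent M (\<lambda>t. S t \<nu>)"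
proof -
  interpret positive_kernel_semigroup M S k \<mu> t\<^sub>0
    by (rule positive_kernel_semigroup.intro) (fact assms)+
  show ?thesis using converges by blast
qed

end
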